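(* There is a universal constant $C>0$ such that for every $n\ge1$ and all centrally symmetric convex functions $f,g:\mathbb{R}^n\to\mathbb{R}$ in $L^2(\mathbb{R}^n,\gamma)$ with $\|f\|\le1$ and $\|g\|\le1$, $$\mathbb{E}[fg]-\mathbb{E}[f]\,\mathbb{E}[g]\;\ge\;\frac1C\cdot\Phi\left(\sum_{\alpha\in\mathbb{N}^n,\ |\alpha|=2}\widetilde f(\alpha)\widetilde g(\alpha)\right),$$ where expectations are with respect to the standard Gaussian measure $\gamma=\mathcal{N}(0,1)^n$ and $\Phi:[0,1]\to[0,1]$ is $\Phi(x)=\min\left\{x,\frac{x}{\log^2(1/x)}\right\}$.
   Context: A function $f:\mathbb{R}^n\to\mathbb{R}$ is centrally symmetric if $f(x)=f(-x)$ for all $x$. $\|f\|=\mathbb{E}_{x\sim\gamma}[f(x)^2]^{1/2}$. $\mathbb{N}=\{0,1,2,\dots\}$; for $\alpha\in\mathbb{N}^n$, $|\alpha|=\sum_{i=1}^n\alpha_i$. The normalized univariate Hermite polynomials are $h_j(x)=\frac{(-1)^j}{\sqrt{j!}}e^{x^2/2}\frac{d^j}{dx^j}e^{-x^2/2}$, and $h_\alpha(x)=\prod_{i=1}^nh_{\alpha_i}(x_i)$. The Hermite coefficients of $f\in L^2(\mathbb{R}^n,\gamma)$ are $\widetilde f(\alpha)=\mathbb{E}_{x\sim\gamma}[f(x)h_\alpha(x)]$. Conventions for $\Phi$: $\Phi(0)=0$, $\Phi(1)=1$. The inequality is read as including that the argument of $\Phi$ lies in its domain $[0,1]$. *)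

theory Defs
  imports "HOL-Probability.Probability"
begin

text \<open>
  The dimension is a natural number rather than a type, so that a constant can be chosen before
  it. A point of n-dimensional space is an element of \<open>{..<n} \<rightarrow>\<^sub>E UNIV\<close>, the space of the
  product measure below; a function on that space is given by its values there, and whatever it
  does outside is irrelevant.
\<close>

definition std_gaussian :: "nat \<Rightarrow> (nat \<Rightarrow> real) measure" where
  "std_gaussian n = Pi\<^sub>M {..<n} (\<lambda>_. std_normal_distribution)"

lemma space_std_gaussian: "space (std_gaussian n) = {..<n} \<rightarrow>\<^sub>E UNIV"
  by (simp add: std_gaussian_def space_PiM)

lemma prob_space_std_gaussian: "prob_space (std_gaussian n)"
  unfolding std_gaussian_def
  by (intro prob_space_PiM prob_space_normal_density) simp

definition centrally_symmetric :: "nat \<Rightarrow> ((nat \<Rightarrow> real) \<Rightarrow> real) \<Rightarrow> bool" where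
  "centrally_symmetric n f \<longleftrightarrow>
     (\<forall>x \<in> {..<n} \<rightarrow>\<^sub>E UNIV. f x = f (\<lambda>i\<in>{..<n}. - x i))"

text \<open>
  The type \<^typ>\<open>nat \<Rightarrow> real\<close> is not an instance of \<^class>\<open>real_vector\<close>, so \<^const>\<open>convex_on\<close> does not
  apply; this is its definition with coordinatewise operations.
\<close>

definition convex_fun :: "nat \<Rightarrow> ((nat \<Rightarrow> real) \<Rightarrow> real) \<Rightarrow> bool" where
  "convex_fun n f \<longleftrightarrow>
     (\<forall>x \<in> {..<n} \<rightarrow>\<^sub>E UNIV. \<forall>y \<in> {..<n} \<rightarrow>\<^sub>E UNIV. \<forall>u\<ge>0. \<forall>v\<ge>0. u + v = 1 \<longrightarrow>
        f (\<lambda>i\<in>{..<n}. u * x i + v * y i) \<le> u * f x + v * f y)"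

definition square_integrable :: "nat \<Rightarrow> ((nat \<Rightarrow> real) \<Rightarrow> real) \<Rightarrow> bool" where
  "square_integrable n f \<longleftrightarrow>
     f \<in> borel_measurable (std_gaussian n) \<and> integrable (std_gaussian n) (\<lambda>x. (f x)\<^sup>2)"

definition gauss_expectation :: "nat \<Rightarrow> ((nat \<Rightarrow> real) \<Rightarrow> real) \<Rightarrow> real" where
  "gauss_expectation n f = (\<integral>x. f x \<partial>std_gaussian n)"

definition gauss_norm :: "nat \<Rightarrow> ((nat \<Rightarrow> real) \<Rightarrow> real) \<Rightarrow> real" where
  "gauss_norm n f = sqrt (gauss_expectation n (\<lambda>x. (f x)\<^sup>2))"

definition hermite :: "nat \<Rightarrow> real \<Rightarrow> real" where
  "hermite j x =
     (-1) ^ j / sqrt (fact j) * exp (x\<^sup>2 / 2) * (deriv ^^ j) (\<lambda>t. exp (- (t\<^sup>2) / 2)) x"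

definition hermite_multi :: "nat \<Rightarrow> (nat \<Rightarrow> nat) \<Rightarrow> (nat \<Rightarrow> real) \<Rightarrow> real" where
  "hermite_multi n \<alpha> x = (\<Prod>i<n. hermite (\<alpha> i) (x i))"

definition hermite_coeff :: "nat \<Rightarrow> ((nat \<Rightarrow> real) \<Rightarrow> real) \<Rightarrow> (nat \<Rightarrow> nat) \<Rightarrow> real" where
  "hermite_coeff n f \<alpha> = gauss_expectation n (\<lambda>x. f x * hermite_multi n \<alpha> x)"

definition multi_indices :: "nat \<Rightarrow> nat \<Rightarrow> (nat \<Rightarrow> nat) set" where
  "multi_indices n d = {\<alpha> \<in> {..<n} \<rightarrow>\<^sub>E UNIV. (\<Sum>i<n. \<alpha> i) = d}"

lemma finite_multi_indices: "finite (multi_indices n d)"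
proof (rule finite_subset)
  show "multi_indices n d \<subseteq> {..<n} \<rightarrow>\<^sub>E {..d}"
  proof
    fix \<alpha> assume a: "\<alpha> \<in> multi_indices n d"
    have "\<alpha> i \<le> d" if "i < n" for i
      using member_le_sum[of i "{..<n}" \<alpha>] that a by (simp add: multi_indices_def)
    with a show "\<alpha> \<in> {..<n} \<rightarrow>\<^sub>E {..d}"
      by (auto simp: multi_indices_def PiE_iff)
  qed
  show "finite ({..<n} \<rightarrow>\<^sub>E {..d})"
    by (intro finite_PiE) auto
qed

text \<open>
  The endpoint values are conventions; the formula alone would give 0 at 1, since division by
  zero yields 0. Only arguments in \<open>{0..1}\<close> are meaningful.
\<close>

definition Phi :: "real \<Rightarrow> real" where
  "Phi x = (if x = 0 then 0 else if x = 1 then 1 else min x (x / (ln (1 / x))\<^sup>2))"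

end

theory Submission
  imports Defs
begin

text \<open>
  Let \<open>a k\<close> be the sum of \<open>hermite_coeff n f \<alpha> * hermite_coeff n g \<alpha>\<close> over the multi-indices of degree \<open>k\<close>,
  and let \<open>F c = E f(X) g(Y)\<close> where \<open>X, Y\<close> are standard Gaussian vectors whose corresponding coordinates
  have correlation \<open>c\<close>. By Mehler's formula \<open>F c\<close> is the power series with coefficients \<open>a k\<close>; the odd ones
  vanish by symmetry. If \<open>f\<close> and \<open>g\<close> are convex, then their degree-two Hermite coefficients, read as
  averaged Hessians, form positive semidefinite matrices, so \<open>a 2 \<ge> 0\<close>. Splitting off a common
  component of variance \<open>\<rho>\<close> from \<open>X\<close> and \<open>Y\<close> and applying this to the conditioned functions gives
  \<open>F'' \<rho> \<ge> 0\<close>; as \<open>F' 0 = a 1 = 0\<close>, \<open>F\<close> increases on \<open>[0,1)\<close> from \<open>E f * E g\<close>, and it stays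
  below \<open>E (f g)\<close>. Hence \<open>p t = F (sqrt t) - F 0\<close> is a power series with coefficients bounded by 1, with
  linear coefficient \<open>a 2\<close>, and with values between 0 and the covariance. Markov's bound for the
  derivative of a polynomial at an end point, applied to a truncation at degree about \<open>ln (1 / a 2)\<close>,
  bounds the covariance from below.
\<close>

section \<open>Univariate Hermite polynomials\<close>

text \<open>The square of the logarithm in \<open>Phi\<close> is the square of a degree. The
  derivative of a polynomial of degree d at an end point of an interval can exceed its supremum
  there by a factor of order \<open>d\<^sup>2\<close>, and d has to be about
  \<open>ln (1 / a 2)\<close> before the truncation error falls below \<open>a 2\<close>.

  Conditioning on the common component keeps convexity but destroys central symmetry, so the linear
  coefficients of the conditioned functions are arbitrary. At a point \<open>\<rho>\<close> only the
  sign of the second derivative of \<open>F\<close> is visible, and the sign of the first has to be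
  carried over from 0.

  The Hermite polynomials are estimated crudely, and the Mehler series is used only for
  \<open>\<bar>r\<bar> < 1 / 8\<close>. Local expansions are enough: each \<open>\<rho>\<close> has
  its own one, in the variable r of the correlation \<open>\<rho> + (1 - \<rho>) * r\<close>, and
  the value at correlation 1 is approached as a limit from below.\<close>

fun hermite_poly :: "nat \<Rightarrow> real poly" where
  "hermite_poly 0 = 1"
| "hermite_poly (Suc 0) = [:0, 1:]"
| "hermite_poly (Suc (Suc k)) =
     [:0, 1:] * hermite_poly (Suc k) - smult (real (Suc k)) (hermite_poly k)"

lemma pderiv_hermite_poly: "pderiv (hermite_poly (Suc k)) = smult (real (Suc k)) (hermite_poly k)"
proof (induction k rule: less_induct)
  case (less k)
  show ?case
  proof (cases k)
    case 0
    then show ?thesis by (simp add: pderiv_pCons)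
  next
    case (Suc l)
    have 1: "pderiv (hermite_poly (Suc l)) = smult (real (Suc l)) (hermite_poly l)"
      using less Suc by simp
    have 2: "smult (real (Suc l)) (pderiv (hermite_poly l)) =
        smult (real (Suc l)) ([:0, 1:] * hermite_poly l - hermite_poly (Suc l))"
    proof (cases l)
      case (Suc m)
      have "pderiv (hermite_poly l) = smult (real (Suc m)) (hermite_poly m)"
        using less Suc \<open>k = Suc l\<close> by simp
      then show ?thesis using Suc by simp
    qed simp
    have "pderiv (hermite_poly (Suc k)) = hermite_poly (Suc l)
        + [:0, 1:] * pderiv (hermite_poly (Suc l)) - smult (real (Suc l)) (pderiv (hermite_poly l))"
      by (simp add: Suc pderiv_diff pderiv_mult pderiv_smult pderiv_pCons)
    also have "\<dots> = smult (real (Suc k)) (hermite_poly k)"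
    proof -
      have "smult (real (Suc k)) (hermite_poly k)
          = hermite_poly (Suc l) + smult (real (Suc l)) (hermite_poly (Suc l))"
        using smult_add_left[of 1 "real (Suc l)" "hermite_poly (Suc l)"] by (simp add: Suc)
      then show ?thesis unfolding 1 2 by (simp add: smult_diff_right del: of_nat_Suc)
    qed
    finally show ?thesis .
  qed
qed

lemma hermite_poly_Suc: "hermite_poly (Suc k) = [:0, 1:] * hermite_poly k - pderiv (hermite_poly k)"
  by (cases k) (simp_all add: pderiv_hermite_poly)

text \<open>Differentiating \<open>p x * exp (- (x\<^sup>2) / 2)\<close> replaces the polynomial p
  by \<open>p' - x p\<close>, which for a Hermite polynomial is minus the next one.\<close>

lemma higher_deriv_exp:
  "(deriv ^^ j) (\<lambda>t. exp (- (t\<^sup>2) / 2)) = (\<lambda>x::real. (- 1) ^ j * poly (hermite_poly j) x * exp (- (x\<^sup>2) / 2))"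
proof (induction j)
  case (Suc j)
  have dv: "((\<lambda>x. (- 1) ^ j * poly (hermite_poly j) x * exp (- (x\<^sup>2) / 2)) has_real_derivative
     (- 1) ^ Suc j * poly (hermite_poly (Suc j)) x * exp (- (x\<^sup>2) / 2)) (at x)" for x
    unfolding hermite_poly_Suc
    by (auto intro!: derivative_eq_intros simp: algebra_simps poly_DERIV)
  have "deriv (\<lambda>x. (- 1) ^ j * poly (hermite_poly j) x * exp (- (x\<^sup>2) / 2)) =
      (\<lambda>x. (- 1) ^ Suc j * poly (hermite_poly (Suc j)) x * exp (- (x\<^sup>2) / 2))"
    by (rule ext) (rule DERIV_imp_deriv[OF dv])
  then show ?case
    by (simp only: Suc funpow.simps o_apply)
qed simp

lemma hermite_eq: "hermite j x = poly (hermite_poly j) x / sqrt (fact j)"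
proof -
  have "exp (x\<^sup>2 / 2) * exp (- (x\<^sup>2) / 2) = 1" "(- 1) ^ j * (- 1) ^ j = (1 :: real)"
    by (simp_all add: mult_exp_exp flip: power_mult_distrib)
  then show ?thesis unfolding hermite_def higher_deriv_exp
    by (simp add: field_simps)
qed

lemma hermite_0 [simp]: "hermite 0 x = 1"
  by (simp add: hermite_eq)

lemma hermite_measurable [measurable]: "hermite j \<in> borel_measurable borel"
proof -
  have "continuous_on UNIV (\<lambda>x. poly (hermite_poly j) x / sqrt (fact j))"
    by (intro continuous_intros) auto
  then show ?thesis unfolding hermite_eq[abs_def]
    by (rule borel_measurable_continuous_onI)
qed

lemma hermite_poly_minus: "poly (hermite_poly j) (- x) = (- 1) ^ j * poly (hermite_poly j) x"
  by (induction j rule: hermite_poly.induct) (auto simp: algebra_simps)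

lemma hermite_minus: "hermite j (- x) = (- 1) ^ j * hermite j x"
  by (simp add: hermite_eq hermite_poly_minus)

section \<open>Pointwise growth of Hermite polynomials and their generating function\<close>

lemma hermite_rec:
  "hermite (Suc (Suc k)) x = (x * hermite (Suc k) x - sqrt (Suc k) * hermite k x) / sqrt (Suc (Suc k))"
  by (simp add: hermite_eq field_simps real_sqrt_mult power2_eq_square[symmetric] flip: of_nat_Suc)

text \<open>The normalised recurrence has the weights \<open>x / sqrt (k + 2)\<close> and
  \<open>sqrt (k + 1) / sqrt (k + 2)\<close>. Both are at most 1 in absolute value once k is at
  least \<open>x\<^sup>2\<close>, so from there on the values grow no faster than Fibonacci numbers;
  the earlier ones are absorbed into the constant.\<close>

lemma hermite_growth: "\<exists>C\<ge>0. \<forall>k. \<bar>hermite k x\<bar> \<le> C * 2 ^ k"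
proof -
  obtain K :: nat where K: "x\<^sup>2 \<le> real K" using real_arch_simple by blast
  define C where "C = (\<Sum>k\<le>Suc K. \<bar>hermite k x\<bar>)"
  have C: "C \<ge> 0" unfolding C_def by (intro sum_nonneg) auto
  have "\<bar>hermite k x\<bar> \<le> C * 2 ^ k" for k
  proof (induction k rule: less_induct)
    case (less k)
    show ?case
    proof (cases "k \<le> Suc K")
      case True
      have "\<bar>hermite k x\<bar> \<le> C" unfolding C_def
        using True by (intro member_le_sum) auto
      also have "C * 1 \<le> C * 2 ^ k" using C by (intro mult_left_mono) auto
      finally show ?thesis by simp
    next
      case False
      then obtain l where l: "k = Suc (Suc l)" "l \<ge> K"
        by (cases k; cases "k - 1") auto
      have le: "\<bar>x\<bar> \<le> sqrt (Suc (Suc l))"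
        using K l by (intro real_le_rsqrt) auto
      have "\<bar>hermite k x\<bar> = \<bar>x * hermite (Suc l) x - sqrt (Suc l) * hermite l x\<bar> / sqrt (Suc (Suc l))"
        unfolding l hermite_rec by (simp add: abs_divide)
      also have "\<dots> \<le> (sqrt (Suc (Suc l)) * \<bar>hermite (Suc l) x\<bar> + sqrt (Suc (Suc l)) * \<bar>hermite l x\<bar>) / sqrt (Suc (Suc l))"
        using mult_right_mono[OF le, of "\<bar>hermite (Suc l) x\<bar>"]
          mult_right_mono[of "sqrt (Suc l)" "sqrt (Suc (Suc l))" "\<bar>hermite l x\<bar>"]
        by (intro divide_right_mono order_trans[OF abs_triangle_ineq4]) (auto simp: abs_mult)
      also have "\<dots> = \<bar>hermite (Suc l) x\<bar> + \<bar>hermite l x\<bar>"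
        by (simp add: field_simps)
      also have "\<dots> \<le> C * 2 ^ Suc l + C * 2 ^ l"
        using less[of "Suc l"] less[of l] l by auto
      also have "\<dots> \<le> C * 2 ^ k" using C l by (simp add: algebra_simps)
      finally show ?thesis .
    qed
  qed
  then show ?thesis using C by blast
qed

lemma summable_power_div_sqrt_fact: "summable (\<lambda>k. z ^ k / sqrt (fact k) :: real)"
proof -
  obtain N :: nat where N: "(2 * z)\<^sup>2 \<le> real N" using real_arch_simple by blast
  have "norm (z ^ Suc k / sqrt (fact (Suc k))) \<le> 1 / 2 * norm (z ^ k / sqrt (fact k))" if "k \<ge> N" for k
  proof -
    have "\<bar>2 * z\<bar> \<le> sqrt (Suc k)"
      using N that by (intro real_le_rsqrt) (auto simp: power_mult_distrib)
    then have "\<bar>z\<bar> / sqrt (Suc k) \<le> 1 / 2" by (simp add: field_simps)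
    from mult_right_mono[OF this, of "norm (z ^ k / sqrt (fact k))"] show ?thesis
      by (simp add: abs_mult power_abs real_sqrt_mult abs_divide mult_ac del: of_nat_Suc)
  qed
  then show ?thesis by (intro summable_ratio_test[of "1/2" N]) auto
qed

text \<open>The integrating factor \<open>exp (- p t)\<close> makes the product constant. This
  identifies the sums of both the generating series and the Mehler series from their differential
  equations.\<close>

lemma linear_ODE_unique:
  fixes A p q :: "real \<Rightarrow> real"
  assumes A: "\<And>t. \<bar>t\<bar> < R \<Longrightarrow> (A has_real_derivative q t * A t) (at t)"
    and p: "\<And>t. \<bar>t\<bar> < R \<Longrightarrow> (p has_real_derivative q t) (at t)"
    and t: "\<bar>t\<bar> < R"
  shows "A t = A 0 * exp (p t - p 0)"
proof -
  have "((\<lambda>t. A t * exp (- p t)) has_real_derivative 0) (at u)" if "\<bar>u\<bar> < R" for u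
    using that by (auto intro!: derivative_eq_intros A p simp: algebra_simps)
  then have "\<exists>c. \<forall>u\<in>{-R<..<R}. A u * exp (- p u) = c"
    by (intro has_field_derivative_zero_constant) (auto intro: has_field_derivative_at_within)
  then have "A t * exp (- p t) = A 0 * exp (- p 0)"
    using t by fastforce
  then have "A t * exp (- p t) * exp (p t) = A 0 * exp (- p 0) * exp (p t)" by simp
  then show ?thesis by (simp add: exp_diff exp_minus field_simps)
qed

text \<open>Writes multiplication by the variable as a series in the same powers, so that
  recurrences between coefficients can be summed. The case k = 0 is separate because
  \<open>k - 1\<close> is truncated there.\<close>

lemma sums_shift_mult:
  fixes c :: "nat \<Rightarrow> real"
  assumes "(\<lambda>k. c k * t ^ k) sums S"
  shows "(\<lambda>k. (if k = 0 then 0 else c (k - 1)) * t ^ k) sums (t * S)"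
proof -
  have "(\<lambda>k. c k * t ^ Suc k) sums (t * S)"
    using sums_mult[OF assms, of t] by (simp add: mult_ac)
  then show ?thesis
    using sums_Suc_iff[of "\<lambda>k. (if k = 0 then 0 else c (k - 1)) * t ^ k" "t * S"] by simp
qed

lemma abs_summable_hermite_generating: "summable (\<lambda>k. \<bar>hermite k x * (t ^ k / sqrt (fact k))\<bar>)"
proof -
  obtain C where C: "C \<ge> 0" "\<And>k. \<bar>hermite k x\<bar> \<le> C * 2 ^ k" using hermite_growth by blast
  have "summable (\<lambda>k. C * ((2 * \<bar>t\<bar>) ^ k / sqrt (fact k)))"
    by (intro summable_mult summable_power_div_sqrt_fact)
  then show ?thesis
  proof (rule summable_comparison_test[rotated], intro exI allI impI)
    fix k :: nat
    have "\<bar>hermite k x\<bar> * (\<bar>t\<bar> ^ k / sqrt (fact k)) \<le> C * 2 ^ k * (\<bar>t\<bar> ^ k / sqrt (fact k))"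
      by (intro mult_right_mono C) auto
    then show "norm \<bar>hermite k x * (t ^ k / sqrt (fact k))\<bar> \<le> C * ((2 * \<bar>t\<bar>) ^ k / sqrt (fact k))"
      by (simp add: abs_mult power_abs power_mult_distrib mult_ac)
  qed
qed

text \<open>Summing the recurrence of the coefficients yields \<open>A' = (x - t) * A\<close>, and
  \<open>A 0 = 1\<close> fixes the solution.\<close>

lemma hermite_generating: "(\<lambda>k. hermite k x * (t ^ k / sqrt (fact k))) sums exp (x * t - t\<^sup>2 / 2)"
proof -
  define c where "c k = hermite k x / sqrt (fact k)" for k
  have sm: "summable (\<lambda>k. c k * u ^ k)" for u
    using summable_rabs_cancel[OF abs_summable_hermite_generating[of x u]] by (simp add: c_def)
  define A where "A u = (\<Sum>k. c k * u ^ k)" for u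
  have As: "(\<lambda>k. c k * u ^ k) sums A u" for u
    using sm unfolding A_def by (rule summable_sums)
  have c: "c k = poly (hermite_poly k) x / fact k" for k
    by (simp add: c_def hermite_eq)
  have d: "diffs c k = x * c k - (if k = 0 then 0 else c (k - 1))" for k
    by (cases k) (auto simp: diffs_def c field_simps simp del: of_nat_Suc)
  have dA: "(A has_real_derivative (x - u) * A u) (at u)" for u
  proof -
    have "(\<lambda>k. x * (c k * u ^ k) - (if k = 0 then 0 else c (k - 1)) * u ^ k) sums (x * A u - u * A u)"
      by (intro sums_diff sums_mult As sums_shift_mult)
    then have "(\<lambda>k. diffs c k * u ^ k) sums ((x - u) * A u)"
      by (simp add: d algebra_simps)
    then show ?thesis
      using termdiffs_strong_converges_everywhere[OF sm, of u] unfolding A_def[abs_def] by (simp add: sums_iff)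
  qed
  have "A t = A 0 * exp ((x * t - t\<^sup>2 / 2) - (x * 0 - 0\<^sup>2 / 2))"
    by (rule linear_ODE_unique[where R = "\<bar>t\<bar> + 1" and q = "\<lambda>u. x - u" and p = "\<lambda>t. x * t - t\<^sup>2 / 2"])
      (auto intro!: derivative_eq_intros dA)
  moreover have "A 0 = 1" unfolding A_def powser_zero by (simp add: c_def)
  ultimately show ?thesis using As[of t] by (simp add: c_def)
qed

text \<open>The radius 1/8 originates here: each Hermite factor costs \<open>2 ^ k\<close>, and so
  does \<open>real (Suc k)\<close>, which dominates the factor \<open>sqrt (k + 1)\<close> of the
  auxiliary series in Mehler's formula. The shifts i and j serve the series with a raised Hermite
  index.\<close>

lemma abs_summable_mehler_aux:
  assumes "\<bar>r\<bar> < 1 / 8"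
  shows "summable (\<lambda>k. \<bar>real (Suc k) * (hermite (k + i) x * hermite (k + j) y) * r ^ k\<bar>)"
proof -
  obtain C where C: "C \<ge> 0" "\<And>k. \<bar>hermite k x\<bar> \<le> C * 2 ^ k" using hermite_growth by blast
  obtain D where D: "D \<ge> 0" "\<And>k. \<bar>hermite k y\<bar> \<le> D * 2 ^ k" using hermite_growth by blast
  have le: "real (Suc k) \<le> 2 ^ k" for k
    using of_nat_mono[OF Suc_leI[OF less_exp[of k]], where 'a=real] by simp
  have "summable (\<lambda>k. (C * 2 ^ i) * (D * 2 ^ j) * (8 * \<bar>r\<bar>) ^ k)"
    using assms by (intro summable_mult summable_geometric) auto
  then show ?thesis
  proof (rule summable_comparison_test[rotated], intro exI allI impI)
    fix k :: nat
    have "real (Suc k) * (\<bar>hermite (k + i) x\<bar> * \<bar>hermite (k + j) y\<bar>) * \<bar>r\<bar> ^ k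
       \<le> 2 ^ k * ((C * 2 ^ (k + i)) * (D * 2 ^ (k + j))) * \<bar>r\<bar> ^ k"
      by (intro mult_right_mono mult_mono C D le mult_nonneg_nonneg) auto
    also have "\<dots> = (C * 2 ^ i) * (D * 2 ^ j) * ((2 * 2 * 2) * \<bar>r\<bar>) ^ k"
      by (simp only: power_add power_mult_distrib mult_ac)
    finally show "norm \<bar>real (Suc k) * (hermite (k + i) x * hermite (k + j) y) * r ^ k\<bar>
        \<le> (C * 2 ^ i) * (D * 2 ^ j) * (8 * \<bar>r\<bar>) ^ k"
      by (simp add: abs_mult power_abs)
  qed
qed

text \<open>The joint density of two standard normal variables with correlation r, relative to the
  product of the marginals.\<close>

definition mehler_kernel :: "real \<Rightarrow> real \<Rightarrow> real \<Rightarrow> real" where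
  "mehler_kernel r x y = exp (- (r\<^sup>2 * x\<^sup>2 - 2 * r * x * y + r\<^sup>2 * y\<^sup>2) / (2 * (1 - r\<^sup>2))) / sqrt (1 - r\<^sup>2)"

lemma abs_summable_mehler:
  assumes "\<bar>r\<bar> < 1 / 8"
  shows "summable (\<lambda>k. \<bar>hermite k x * hermite k y * r ^ k\<bar>)"
proof (rule summable_comparison_test[OF _ abs_summable_mehler_aux[OF assms, of 0 x 0 y]], intro exI allI impI)
  fix k :: nat
  have "1 * \<bar>hermite k x * hermite k y * r ^ k\<bar> \<le> real (Suc k) * \<bar>hermite k x * hermite k y * r ^ k\<bar>"
    by (intro mult_right_mono) auto
  then show "norm \<bar>hermite k x * hermite k y * r ^ k\<bar> \<le> \<bar>real (Suc k) * (hermite (k + 0) x * hermite (k + 0) y) * r ^ k\<bar>"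
    by (simp add: abs_mult)
qed

text \<open>The series \<open>A\<close>, \<open>B\<close>, \<open>C\<close>, \<open>D\<close> and the one with coefficients \<open>e\<close> satisfy a linear system whose elimination leaves a first-order
  linear differential equation for \<open>A\<close> in the variable \<open>r\<close>.\<close>

lemma mehler_sums:
  assumes r: "\<bar>r\<bar> < 1 / 8"
  shows "(\<lambda>k. hermite k x * hermite k y * r ^ k) sums mehler_kernel r x y"
proof -
  define H where "H k z = poly (hermite_poly k) z" for k and z :: real
  have H_Suc: "H (Suc k) z = z * H k z - (if k = 0 then 0 else real k * H (k - 1) z)" for k z
    by (cases k) (auto simp: H_def)
  have hH: "H k z = hermite k z * sqrt (fact k)" for k z
    by (simp add: H_def hermite_eq)
  have hH': "H (Suc k) z = sqrt (Suc k) * hermite (Suc k) z * sqrt (fact k)" for k z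
    by (simp add: hH real_sqrt_mult mult_ac del: of_nat_Suc)
  define a where "a k = H k x * H k y / fact k" for k
  define b where "b k = H (Suc k) x * H k y / fact k" for k
  define c where "c k = H k x * H (Suc k) y / fact k" for k
  define e where "e k = H k x * H (Suc (Suc k)) y / fact k" for k
  have a_eq: "a k = hermite k x * hermite k y" for k
    by (simp add: a_def hH field_simps)
  have sq: "sqrt (real (Suc k)) \<le> real (Suc k)" for k
    by (rule real_le_lsqrt) (auto simp: power2_eq_square)
  have sma: "summable (\<lambda>k. a k * u ^ k)" if "\<bar>u\<bar> < 1/8" for u
    using summable_rabs_cancel[OF abs_summable_mehler[OF that]] by (simp add: a_eq)
  have smb: "summable (\<lambda>k. b k * u ^ k)" if "\<bar>u\<bar> < 1/8" for u
  proof (rule summable_comparison_test[OF _ abs_summable_mehler_aux[OF that, of 1 x 0 y]], intro exI allI impI)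
    fix k :: nat
    have "b k = sqrt (Suc k) * (hermite (k + 1) x * hermite (k + 0) y)"
      by (simp add: b_def hH[of k] hH' field_simps del: of_nat_Suc)
    then show "norm (b k * u ^ k) \<le> \<bar>real (Suc k) * (hermite (k + 1) x * hermite (k + 0) y) * u ^ k\<bar>"
      using sq[of k] by (simp add: abs_mult mult_right_mono)
  qed
  have smc: "summable (\<lambda>k. c k * u ^ k)" if "\<bar>u\<bar> < 1/8" for u
  proof (rule summable_comparison_test[OF _ abs_summable_mehler_aux[OF that, of 0 x 1 y]], intro exI allI impI)
    fix k :: nat
    have "c k = sqrt (Suc k) * (hermite (k + 0) x * hermite (k + 1) y)"
      by (simp add: c_def hH[of k] hH' field_simps del: of_nat_Suc)
    then show "norm (c k * u ^ k) \<le> \<bar>real (Suc k) * (hermite (k + 0) x * hermite (k + 1) y) * u ^ k\<bar>"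
      using sq[of k] by (simp add: abs_mult mult_right_mono)
  qed
  define A B C D where "A u = (\<Sum>k. a k * u ^ k)" and "B u = (\<Sum>k. b k * u ^ k)"
    and "C u = (\<Sum>k. c k * u ^ k)" and "D u = (\<Sum>k. diffs a k * u ^ k)" for u
  have q: "(A has_real_derivative ((x - u * y) * (y - u * x) / (1 - u\<^sup>2)\<^sup>2 + u / (1 - u\<^sup>2)) * A u) (at u)"
    if u: "\<bar>u\<bar> < 1/8" for u
  proof -
    have pos: "1 - u\<^sup>2 > 0" using abs_square_less_1[of u] u by simp
    have sA: "(\<lambda>k. a k * u ^ k) sums A u" and sB: "(\<lambda>k. b k * u ^ k) sums B u"
      and sC: "(\<lambda>k. c k * u ^ k) sums C u"
      unfolding A_def B_def C_def by (intro summable_sums sma smb smc u)+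
    have smd: "summable (\<lambda>k. diffs a k * u ^ k)"
      by (rule termdiff_converges[of u "1/8"]) (use u sma in auto)
    then have sD: "(\<lambda>k. diffs a k * u ^ k) sums D u" unfolding D_def by (rule summable_sums)
    have dA: "(A has_real_derivative D u) (at u)" unfolding A_def[abs_def] D_def
      by (rule termdiffs_strong'[of "1/8"]) (use u sma in auto)
    have "b k = x * a k - (if k = 0 then 0 else c (k - 1))" for k
      by (cases k) (auto simp del: of_nat_Suc simp: a_def b_def c_def H_Suc[of _ x] field_simps)
    then have "(\<lambda>k. b k * u ^ k) sums (x * A u - u * C u)"
      using sums_diff[OF sums_mult[OF sA, of x] sums_shift_mult[OF sC]]
      by (simp only: left_diff_distrib mult.assoc)
    then have eB: "B u = x * A u - u * C u" using sB sums_unique2 by blast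
    have "c k = y * a k - (if k = 0 then 0 else b (k - 1))" for k
      by (cases k) (auto simp del: of_nat_Suc simp: a_def b_def c_def H_Suc[of _ y] field_simps)
    then have "(\<lambda>k. c k * u ^ k) sums (y * A u - u * B u)"
      using sums_diff[OF sums_mult[OF sA, of y] sums_shift_mult[OF sB]]
      by (simp only: left_diff_distrib mult.assoc)
    then have eC: "C u = y * A u - u * B u" using sC sums_unique2 by blast
    have "e k * u ^ k = y * (c k * u ^ k) - (a k * u ^ k
        + (if k = 0 then 0 else diffs a (k - 1)) * u ^ k)" for k
      by (cases k) (auto simp del: of_nat_Suc simp: a_def e_def c_def diffs_def H_Suc[of "Suc _" y] of_nat_Suc[of "Suc _"] field_simps)
    then have sE: "(\<lambda>k. e k * u ^ k) sums (y * C u - (A u + u * D u))"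
      using sums_diff[OF sums_mult[OF sC, of y] sums_add[OF sA sums_shift_mult[OF sD]]] by simp
    have "diffs a k = x * c k - (if k = 0 then 0 else e (k - 1))" for k
      by (cases k) (auto simp del: of_nat_Suc simp: a_def e_def c_def diffs_def H_Suc[of _ x] field_simps)
    then have "(\<lambda>k. diffs a k * u ^ k) sums (x * C u - u * (y * C u - (A u + u * D u)))"
      using sums_diff[OF sums_mult[OF sC, of x] sums_shift_mult[OF sE]]
      by (simp only: left_diff_distrib mult.assoc)
    then have eD: "D u = x * C u - u * (y * C u - (A u + u * D u))" using sD sums_unique2 by blast
    have "C u * (1 - u\<^sup>2) = (y - u * x) * A u" using eB eC by algebra
    then have C': "C u = (y - u * x) * A u / (1 - u\<^sup>2)" using pos by (simp add: eq_divide_eq)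
    have "D u * (1 - u\<^sup>2) = (x - u * y) * C u + u * A u" using eD by algebra
    then have "D u = ((x - u * y) * C u + u * A u) / (1 - u\<^sup>2)" using pos by (simp add: eq_divide_eq)
    also have "\<dots> = ((x - u * y) * (y - u * x) / (1 - u\<^sup>2)\<^sup>2 + u / (1 - u\<^sup>2)) * A u"
    proof -
      have "(p * (q * a / w) + u * a) / w = (p * q / w\<^sup>2 + u / w) * a" if "w \<noteq> 0" for p q a w :: real
        using that by (simp add: field_simps power2_eq_square)
      then show ?thesis unfolding C' using pos by simp
    qed
    finally show ?thesis using dA by simp
  qed
  \<comment> \<open>The logarithm of the kernel, whose derivative is the coefficient of the
    differential equation.\<close>
  define p where "p u = - ln (1 - u\<^sup>2) / 2 - (u\<^sup>2 * x\<^sup>2 - 2 * u * x * y + u\<^sup>2 * y\<^sup>2) / (2 * (1 - u\<^sup>2))" for u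
  have p': "(p has_real_derivative ((x - u * y) * (y - u * x) / (1 - u\<^sup>2)\<^sup>2 + u / (1 - u\<^sup>2))) (at u)"
    if u: "\<bar>u\<bar> < 1/8" for u
  proof -
    have pos: "1 - u\<^sup>2 > 0" using abs_square_less_1[of u] u by simp
    then have ne: "1 - u\<^sup>2 \<noteq> 0" by simp
    have 1: "((\<lambda>u. - ln (1 - u\<^sup>2) / 2) has_real_derivative u / (1 - u\<^sup>2)) (at u)"
      using pos by (auto intro!: derivative_eq_intros simp: divide_simps)
    have 2: "((\<lambda>u. u\<^sup>2 * x\<^sup>2 - 2 * u * x * y + u\<^sup>2 * y\<^sup>2) has_real_derivative
        2 * u * x\<^sup>2 - 2 * x * y + 2 * u * y\<^sup>2) (at u)"
      by (auto intro!: derivative_eq_intros)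
    have 3: "((\<lambda>u. 2 * (1 - u\<^sup>2)) has_real_derivative - 4 * u) (at u)"
      by (auto intro!: derivative_eq_intros)
    have 4: "((\<lambda>u. (u\<^sup>2 * x\<^sup>2 - 2 * u * x * y + u\<^sup>2 * y\<^sup>2) / (2 * (1 - u\<^sup>2))) has_real_derivative
        ((2 * u * x\<^sup>2 - 2 * x * y + 2 * u * y\<^sup>2) * (2 * (1 - u\<^sup>2))
          - (u\<^sup>2 * x\<^sup>2 - 2 * u * x * y + u\<^sup>2 * y\<^sup>2) * (- 4 * u)) / (2 * (1 - u\<^sup>2) * (2 * (1 - u\<^sup>2)))) (at u)"
      using ne by (intro DERIV_divide 2 3) simp
    have num: "(2 * u * x\<^sup>2 - 2 * x * y + 2 * u * y\<^sup>2) * (2 * (1 - u\<^sup>2))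
          - (u\<^sup>2 * x\<^sup>2 - 2 * u * x * y + u\<^sup>2 * y\<^sup>2) * (- 4 * u) = - 4 * ((x - u * y) * (y - u * x))"
      by algebra
    have quot: "- 4 * z / (2 * w * (2 * w)) = - (z / w\<^sup>2)" for z w :: real
      by (simp add: power2_eq_square)
    have 5: "((2 * u * x\<^sup>2 - 2 * x * y + 2 * u * y\<^sup>2) * (2 * (1 - u\<^sup>2))
          - (u\<^sup>2 * x\<^sup>2 - 2 * u * x * y + u\<^sup>2 * y\<^sup>2) * (- 4 * u)) / (2 * (1 - u\<^sup>2) * (2 * (1 - u\<^sup>2)))
        = - ((x - u * y) * (y - u * x) / (1 - u\<^sup>2)\<^sup>2)"
      unfolding num by (rule quot)
    show ?thesis using DERIV_diff[OF 1 4] unfolding p_def[abs_def] 5 by (simp add: add.commute)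
  qed
  have pos: "1 - r\<^sup>2 > 0" using abs_square_less_1[of r] r by simp
  have "A r = A 0 * exp (p r - p 0)"
    by (rule linear_ODE_unique[OF q p' r]) auto
  moreover have "A 0 = 1" unfolding A_def powser_zero by (simp add: a_def H_def)
  moreover have "exp (p r - p 0) = mehler_kernel r x y"
  proof -
    have "exp (- ln (1 - r\<^sup>2) / 2) = 1 / sqrt (1 - r\<^sup>2)"
      using pos by (simp add: exp_minus inverse_eq_divide ln_sqrt[symmetric])
    moreover have "p r - p 0 = - ln (1 - r\<^sup>2) / 2
        + - (r\<^sup>2 * x\<^sup>2 - 2 * r * x * y + r\<^sup>2 * y\<^sup>2) / (2 * (1 - r\<^sup>2))"
      unfolding p_def minus_divide_left[symmetric] by simp
    ultimately show ?thesis
      unfolding mehler_kernel_def by (simp only: exp_add) simp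
  qed
  ultimately have "A r = mehler_kernel r x y" by simp
  then show ?thesis
    using summable_sums[OF sma[OF r]] by (simp add: a_eq A_def)
qed

section \<open>Gaussian moments and orthonormality\<close>

lemma integrable_poly_std_normal: "integrable std_normal_distribution (poly p)"
proof -
  have "integrable std_normal_distribution (\<lambda>x. x ^ k)" for k
    using integrable_std_normal_moment[of k] by (subst integrable_real_density) auto
  then show ?thesis unfolding poly_altdef[abs_def] by auto
qed

text \<open>On monomials this is the recurrence \<open>m (k + 1) = k * m (k - 1)\<close> for
  moments, which follows from the closed form of the even moments and the vanishing of the odd
  ones.\<close>

lemma gauss_integration_by_parts:
  "(\<integral>x. x * poly p x \<partial>std_normal_distribution) = (\<integral>x. poly (pderiv p) x \<partial>std_normal_distribution)"
proof -
  define m where "m k = (\<integral>x. x ^ k \<partial>std_normal_distribution)" for k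
  have m: "m k = (\<integral>x. std_normal_density x * x ^ k \<partial>lborel)" for k
    unfolding m_def by (subst integral_real_density) auto
  have int: "integrable std_normal_distribution (\<lambda>x. x ^ k)" for k
    using integrable_poly_std_normal[of "monom 1 k"] by (simp add: poly_monom[abs_def])
  have odd: "m (2 * k + 1) = 0" for k
    using integral_std_normal_moment_odd[of k] by (simp add: m)
  have even: "m (2 * k) = fact (2 * k) / (2 ^ k * fact k)" for k
    using integral_std_normal_moment_even[of k] by (simp add: m)
  \<comment> \<open>At k = 0 the truncated \<open>k - 1\<close> is harmless because of the factor
    \<open>real k\<close>.\<close>
  have step: "m (Suc k) = real k * m (k - 1)" for k
  proof (cases "even k")
    case True
    then obtain l where l: "k = 2 * l" by auto
    show ?thesis
    proof (cases l)
      case (Suc j)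
      then have "k - 1 = 2 * j + 1" using l by simp
      then show ?thesis using odd[of j] odd[of l] l by simp
    qed (use l odd[of 0] in auto)
  next
    case False
    then obtain l where l: "k = 2 * l + 1" using oddE by blast
    have "m (Suc k) = fact (2 * Suc l) / (2 ^ Suc l * fact (Suc l))"
      using even[of "Suc l"] l by simp
    also have "fact (2 * Suc l) = (2 * real (Suc l)) * (real k * fact (2 * l))"
      using l by (simp add: algebra_simps)
    also have "2 ^ Suc l * fact (Suc l) = (2 * real (Suc l)) * (2 ^ l * fact l :: real)"
      by (simp add: algebra_simps)
    also have "(2 * real (Suc l)) * (real k * fact (2 * l)) / ((2 * real (Suc l)) * (2 ^ l * fact l))
        = real k * (fact (2 * l) / (2 ^ l * fact l))"
      by (simp del: of_nat_Suc)
    finally show ?thesis using even[of l] l by simp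
  qed
  have "(\<integral>x. x * poly p x \<partial>std_normal_distribution) = (\<Sum>i\<le>degree p. coeff p i * m (Suc i))"
  proof -
    have "x * poly p x = (\<Sum>i\<le>degree p. coeff p i * x ^ Suc i)" for x
      by (simp add: poly_altdef sum_distrib_left mult_ac)
    then show ?thesis unfolding m_def by (simp add: int del: power_Suc)
  qed
  also have "\<dots> = (\<Sum>i\<le>degree p. coeff p i * (real i * m (i - 1)))"
    by (simp only: step)
  also have "\<dots> = (\<integral>x. (\<Sum>i\<le>degree p. coeff p i * (real i * x ^ (i - 1))) \<partial>std_normal_distribution)"
    unfolding m_def by (simp add: int)
  also have "\<dots> = (\<integral>x. poly (pderiv p) x \<partial>std_normal_distribution)"
  proof (intro Bochner_Integration.integral_cong refl)
    fix x :: real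
    have "((\<lambda>x. \<Sum>i\<le>degree p. coeff p i * x ^ i) has_real_derivative
        (\<Sum>i\<le>degree p. coeff p i * (real i * x ^ (i - 1)))) (at x)"
      by (auto intro!: derivative_eq_intros sum.cong)
    moreover have "((\<lambda>x. \<Sum>i\<le>degree p. coeff p i * x ^ i) has_real_derivative poly (pderiv p) x) (at x)"
      using poly_DERIV[of p x] by (simp add: poly_altdef[abs_def])
    ultimately show "(\<Sum>i\<le>degree p. coeff p i * (real i * x ^ (i - 1))) = poly (pderiv p) x"
      by (rule DERIV_unique)
  qed
  finally show ?thesis .
qed

text \<open>Integration by parts lowers the first polynomial by one order and differentiates the
  second, which again gives a lower Hermite polynomial. Both degrees drop together until one is 0,
  and a Hermite polynomial of positive degree has mean 0.\<close>

lemma integral_hermite_poly_mult: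
  "(\<integral>x. poly (hermite_poly j) x * poly (hermite_poly k) x \<partial>std_normal_distribution)
     = (if j = k then fact j else 0)"
proof -
  interpret prob_space std_normal_distribution by (rule prob_space_normal_density) simp
  have int: "integrable std_normal_distribution (\<lambda>x. poly p x * poly q x)" for p q :: "real poly"
    using integrable_poly_std_normal[of "p * q"] by (simp add: poly_mult[abs_def])
  have ibp: "(\<integral>x. poly (hermite_poly (Suc i)) x * poly q x \<partial>std_normal_distribution)
      = (\<integral>x. poly (hermite_poly i) x * poly (pderiv q) x \<partial>std_normal_distribution)" for i q
  proof -
    have "(\<integral>x. poly (hermite_poly (Suc i)) x * poly q x \<partial>std_normal_distribution) =
      (\<integral>x. x * poly (hermite_poly i * q) x - poly (pderiv (hermite_poly i)) x * poly q x \<partial>std_normal_distribution)"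
      by (simp add: hermite_poly_Suc algebra_simps)
    also have "\<dots> = (\<integral>x. x * poly (hermite_poly i * q) x \<partial>std_normal_distribution)
        - (\<integral>x. poly (pderiv (hermite_poly i)) x * poly q x \<partial>std_normal_distribution)"
      using integrable_poly_std_normal[of "[:0,1:] * (hermite_poly i * q)"]
      by (intro Bochner_Integration.integral_diff int) (simp add: poly_pCons[abs_def] poly_mult[abs_def])
    also have "\<dots> = (\<integral>x. poly (pderiv (hermite_poly i * q)) x - poly (pderiv (hermite_poly i)) x * poly q x \<partial>std_normal_distribution)"
      unfolding gauss_integration_by_parts
      by (intro Bochner_Integration.integral_diff[symmetric] int integrable_poly_std_normal)
    finally show ?thesis by (simp add: pderiv_mult algebra_simps)
  qed
  have mean: "(\<integral>x. poly (hermite_poly (Suc i)) x \<partial>std_normal_distribution) = 0" for i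
    using ibp[of i 1] by simp
  show ?thesis
  proof (induction j arbitrary: k)
    case 0
    show ?case using mean prob_space by (cases k) (auto simp del: hermite_poly.simps(2,3))
  next
    case (Suc j)
    show ?case
    proof (cases k)
      case 0
      then show ?thesis using mean by simp
    next
      case (Suc l)
      show ?thesis using Suc.IH[of l] unfolding Suc ibp pderiv_hermite_poly by (auto simp: mult.left_commute)
    qed
  qed
qed

lemma hermite_orthonormal:
  "integrable std_normal_distribution (\<lambda>x. hermite j x * hermite k x)"
  "(\<integral>x. hermite j x * hermite k x \<partial>std_normal_distribution) = (if j = k then 1 else 0)"
proof -
  have eq: "(\<lambda>x. hermite j x * hermite k x) =
      (\<lambda>x. poly (hermite_poly j) x * poly (hermite_poly k) x / (sqrt (fact j) * sqrt (fact k)))"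
    by (simp add: hermite_eq)
  show "integrable std_normal_distribution (\<lambda>x. hermite j x * hermite k x)"
    using integrable_poly_std_normal[of "hermite_poly j * hermite_poly k"] unfolding eq
    by (simp add: poly_mult[abs_def])
  show "(\<integral>x. hermite j x * hermite k x \<partial>std_normal_distribution) = (if j = k then 1 else 0)"
    unfolding eq by (simp add: integral_hermite_poly_mult)
qed

section \<open>Affine images and rotations of Gaussian measures\<close>

text \<open>The density of the law of \<open>a + s * Z\<close>, Z standard normal, relative to the
  standard normal law itself. With the Gaussian as reference measure, a change of variables is a
  reweighting that passes to products coordinate by coordinate.\<close>

definition affine_density :: "real \<Rightarrow> real \<Rightarrow> real \<Rightarrow> real" where
  "affine_density a s y = exp (y\<^sup>2 / 2 - (y - a)\<^sup>2 / (2 * s\<^sup>2)) / \<bar>s\<bar>"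

lemma affine_density_measurable [measurable]: "affine_density a s \<in> borel_measurable borel"
  unfolding affine_density_def[abs_def] by measurable

lemma affine_density_nonneg: "affine_density a s y \<ge> 0"
  by (simp add: affine_density_def)

lemma nn_integral_std_normal_affine:
  assumes [measurable]: "\<psi> \<in> borel_measurable borel" and s: "s \<noteq> 0"
  shows "(\<integral>\<^sup>+z. \<psi> (a + s * z) \<partial>std_normal_distribution)
       = (\<integral>\<^sup>+y. ennreal (affine_density a s y) * \<psi> y \<partial>std_normal_distribution)"
proof -
  have "(\<integral>\<^sup>+y. ennreal (affine_density a s y) * \<psi> y \<partial>std_normal_distribution)
      = (\<integral>\<^sup>+y. ennreal (std_normal_density y) * (ennreal (affine_density a s y) * \<psi> y) \<partial>lborel)"
    by (subst nn_integral_density) auto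
  also have "\<dots> = \<bar>s\<bar> * (\<integral>\<^sup>+z. ennreal (std_normal_density (a + s * z)) * (ennreal (affine_density a s (a + s * z)) * \<psi> (a + s * z)) \<partial>lborel)"
    by (rule nn_integral_real_affine[OF _ s]) measurable
  also have "\<dots> = (\<integral>\<^sup>+z. ennreal (std_normal_density z) * \<psi> (a + s * z) \<partial>lborel)"
  proof (subst nn_integral_cmult[symmetric], measurable, intro nn_integral_cong)
    fix z
    have "std_normal_density (a + s * z) * affine_density a s (a + s * z) = std_normal_density z / \<bar>s\<bar>"
      using s by (simp add: std_normal_density_def affine_density_def power_mult_distrib flip: exp_add)
    then have "\<bar>s\<bar> * (std_normal_density (a + s * z) * affine_density a s (a + s * z)) = std_normal_density z"
      using s by simp
    then have "ennreal \<bar>s\<bar> * (ennreal (std_normal_density (a + s * z)) * ennreal (affine_density a s (a + s * z)))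
        = ennreal (std_normal_density z)"
      by (simp add: affine_density_nonneg flip: ennreal_mult)
    then show "ennreal \<bar>s\<bar> * (ennreal (std_normal_density (a + s * z)) * (ennreal (affine_density a s (a + s * z)) * \<psi> (a + s * z)))
        = ennreal (std_normal_density z) * \<psi> (a + s * z)"
      by (metis mult.assoc)
  qed
  also have "\<dots> = (\<integral>\<^sup>+z. \<psi> (a + s * z) \<partial>std_normal_distribution)"
    by (subst nn_integral_density) auto
  finally show ?thesis ..
qed

lemma std_gaussian_component [measurable (raw)]:
  assumes "g \<in> M \<rightarrow>\<^sub>M std_gaussian n" and "i < n"
  shows "(\<lambda>w. g w i) \<in> borel_measurable M"
proof -
  have "(\<lambda>x. x i) \<in> std_gaussian n \<rightarrow>\<^sub>M std_normal_distribution"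
    unfolding std_gaussian_def using assms(2) by (intro measurable_component_singleton) auto
  then have "(\<lambda>x. x i) \<in> borel_measurable (std_gaussian n)" by simp
  from measurable_compose[OF assms(1) this] show ?thesis .
qed

lemma measurable_std_gaussian_restrict:
  assumes "\<And>i. i < n \<Longrightarrow> g i \<in> borel_measurable M"
  shows "(\<lambda>w. \<lambda>i\<in>{..<n}. g i w) \<in> M \<rightarrow>\<^sub>M std_gaussian n"
  unfolding std_gaussian_def using assms by (intro measurable_restrict) simp

text \<open>Both measures agree on boxes with the product of the one-dimensional image laws
  \<open>M' i\<close>.\<close>

lemma distr_std_gaussian_affine:
  assumes s: "s \<noteq> 0"
  shows "distr (std_gaussian n) (std_gaussian n) (\<lambda>z. \<lambda>i\<in>{..<n}. a i + s * z i)
       = density (std_gaussian n) (\<lambda>y. ennreal (\<Prod>i<n. affine_density (a i) s (y i)))"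
proof -
  let ?N = std_normal_distribution and ?I = "{..<n}"
  define T where "T i z = a i + s * z" for i :: nat and z
  have T [measurable]: "T i \<in> borel_measurable borel" for i unfolding T_def by measurable
  define M' where "M' i = distr ?N borel (T i)" for i
  have pN: "prob_space ?N" by (rule prob_space_normal_density) simp
  interpret N: product_sigma_finite "\<lambda>_. ?N"
    by (rule product_sigma_finite.intro) (rule prob_space_imp_sigma_finite[OF pN])
  have pM': "prob_space (M' i)" for i
    unfolding M'_def by (rule prob_space.prob_space_distr[OF pN]) simp
  interpret M': product_sigma_finite M'
    by (rule product_sigma_finite.intro) (rule prob_space_imp_sigma_finite[OF pM'])
  have sM': "sets (M' i) = sets borel" for i by (simp add: M'_def)
  have sets_eq: "sets (Pi\<^sub>M ?I M') = sets (std_gaussian n)"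
    unfolding std_gaussian_def by (intro sets_PiM_cong refl) (simp add: sM')
  have TT: "(\<lambda>z. \<lambda>i\<in>?I. a i + s * z i) \<in> std_gaussian n \<rightarrow>\<^sub>M std_gaussian n"
    by (intro measurable_std_gaussian_restrict) measurable
  have "distr (std_gaussian n) (std_gaussian n) (\<lambda>z. \<lambda>i\<in>?I. a i + s * z i) = Pi\<^sub>M ?I M'"
  proof (rule M'.PiM_eqI)
    fix A assume A: "\<And>i. i \<in> ?I \<Longrightarrow> A i \<in> sets (M' i)"
    then have Ab: "A i \<in> sets borel" if "i < n" for i using that by (simp add: sM')
    have PA: "Pi\<^sub>E ?I A \<in> sets (std_gaussian n)"
      unfolding std_gaussian_def using Ab by (intro sets_PiM_I_finite) auto
    have "emeasure (distr (std_gaussian n) (std_gaussian n) (\<lambda>z. \<lambda>i\<in>?I. a i + s * z i)) (Pi\<^sub>E ?I A)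
       = emeasure (std_gaussian n) ((\<lambda>z. \<lambda>i\<in>?I. a i + s * z i) -` Pi\<^sub>E ?I A \<inter> space (std_gaussian n))"
      by (rule emeasure_distr[OF TT PA])
    also have "(\<lambda>z. \<lambda>i\<in>?I. a i + s * z i) -` Pi\<^sub>E ?I A \<inter> space (std_gaussian n) = Pi\<^sub>E ?I (\<lambda>i. T i -` A i)"
      by (auto simp: space_std_gaussian T_def PiE_iff)
    also have "emeasure (std_gaussian n) \<dots> = (\<Prod>i\<in>?I. emeasure ?N (T i -` A i))"
      unfolding std_gaussian_def
      using measurable_sets[OF T Ab] by (intro N.emeasure_PiM) auto
    also have "\<dots> = (\<Prod>i\<in>?I. emeasure (M' i) (A i))"
      unfolding M'_def using Ab by (intro prod.cong refl, subst emeasure_distr) auto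
    finally show "emeasure (distr (std_gaussian n) (std_gaussian n) (\<lambda>z. \<lambda>i\<in>?I. a i + s * z i)) (Pi\<^sub>E ?I A)
      = (\<Prod>i\<in>?I. emeasure (M' i) (A i))" .
  qed (use sets_eq in auto)
  moreover have "density (std_gaussian n) (\<lambda>y. ennreal (\<Prod>i<n. affine_density (a i) s (y i))) = Pi\<^sub>M ?I M'"
  proof (rule M'.PiM_eqI)
    fix A assume A: "\<And>i. i \<in> ?I \<Longrightarrow> A i \<in> sets (M' i)"
    then have Ab: "A i \<in> sets borel" if "i < n" for i using that by (simp add: sM')
    have PA: "Pi\<^sub>E ?I A \<in> sets (std_gaussian n)"
      unfolding std_gaussian_def using Ab by (intro sets_PiM_I_finite) auto
    have "emeasure (density (std_gaussian n) (\<lambda>y. ennreal (\<Prod>i<n. affine_density (a i) s (y i)))) (Pi\<^sub>E ?I A)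
      = (\<integral>\<^sup>+y. ennreal (\<Prod>i<n. affine_density (a i) s (y i)) * indicator (Pi\<^sub>E ?I A) y \<partial>std_gaussian n)"
      using PA by (intro emeasure_density) measurable
    also have "\<dots> = (\<integral>\<^sup>+y. (\<Prod>i\<in>?I. ennreal (affine_density (a i) s (y i)) * indicator (A i) (y i)) \<partial>std_gaussian n)"
    proof (rule nn_integral_cong)
      fix y assume y: "y \<in> space (std_gaussian n)"
      have "indicator (Pi\<^sub>E ?I A) y = (\<Prod>i\<in>?I. indicator (A i) (y i) :: ennreal)"
        using y by (auto simp: indicator_def space_std_gaussian PiE_iff intro!: prod.neutral[symmetric] prod_zero[symmetric])
      then show "ennreal (\<Prod>i<n. affine_density (a i) s (y i)) * indicator (Pi\<^sub>E ?I A) y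
        = (\<Prod>i\<in>?I. ennreal (affine_density (a i) s (y i)) * indicator (A i) (y i))"
        by (simp add: prod.distrib prod_ennreal affine_density_nonneg)
    qed
    also have "\<dots> = (\<Prod>i\<in>?I. \<integral>\<^sup>+y. ennreal (affine_density (a i) s y) * indicator (A i) y \<partial>?N)"
      unfolding std_gaussian_def using Ab
      by (intro N.product_nn_integral_prod[where f = "\<lambda>i y. ennreal (affine_density (a i) s y) * indicator (A i) y"])
        auto
    also have "\<dots> = (\<Prod>i\<in>?I. emeasure (M' i) (A i))"
    proof (intro prod.cong refl)
      fix i assume "i \<in> ?I"
      then have [measurable]: "A i \<in> sets borel" using Ab by simp
      have "emeasure (M' i) (A i) = (\<integral>\<^sup>+y. indicator (A i) y \<partial>M' i)" by (simp add: sM')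
      also have "\<dots> = (\<integral>\<^sup>+z. indicator (A i) (a i + s * z) \<partial>?N)"
        unfolding M'_def T_def by (subst nn_integral_distr) auto
      also have "\<dots> = (\<integral>\<^sup>+y. ennreal (affine_density (a i) s y) * indicator (A i) y \<partial>?N)"
        by (rule nn_integral_std_normal_affine[OF _ s]) simp
      finally show "(\<integral>\<^sup>+y. ennreal (affine_density (a i) s y) * indicator (A i) y \<partial>?N) = emeasure (M' i) (A i)" ..
    qed
    finally show "emeasure (density (std_gaussian n) (\<lambda>y. ennreal (\<Prod>i<n. affine_density (a i) s (y i)))) (Pi\<^sub>E ?I A)
      = (\<Prod>i\<in>?I. emeasure (M' i) (A i))" .
  qed (use sets_eq in auto)
  ultimately show ?thesis by simp
qed

lemma nn_integral_std_gaussian_affine: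
  assumes [measurable]: "\<psi> \<in> borel_measurable (std_gaussian n)" and s: "s \<noteq> 0"
  shows "(\<integral>\<^sup>+z. \<psi> (\<lambda>i\<in>{..<n}. a i + s * z i) \<partial>std_gaussian n)
       = (\<integral>\<^sup>+y. ennreal (\<Prod>i<n. affine_density (a i) s (y i)) * \<psi> y \<partial>std_gaussian n)"
proof -
  have TT[measurable]: "(\<lambda>z. \<lambda>i\<in>{..<n}. a i + s * z i) \<in> std_gaussian n \<rightarrow>\<^sub>M std_gaussian n"
    by (intro measurable_std_gaussian_restrict) measurable
  have "(\<integral>\<^sup>+z. \<psi> (\<lambda>i\<in>{..<n}. a i + s * z i) \<partial>std_gaussian n)
      = (\<integral>\<^sup>+y. \<psi> y \<partial>distr (std_gaussian n) (std_gaussian n) (\<lambda>z. \<lambda>i\<in>{..<n}. a i + s * z i))"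
    by (subst nn_integral_distr) auto
  also have "\<dots> = (\<integral>\<^sup>+y. ennreal (\<Prod>i<n. affine_density (a i) s (y i)) * \<psi> y \<partial>std_gaussian n)"
    unfolding distr_std_gaussian_affine[OF s] by (subst nn_integral_density) measurable
  finally show ?thesis .
qed

section \<open>Rotation invariance of pairs of Gaussian vectors\<close>

definition lincomb :: "nat \<Rightarrow> real \<Rightarrow> (nat \<Rightarrow> real) \<Rightarrow> real \<Rightarrow> (nat \<Rightarrow> real) \<Rightarrow> nat \<Rightarrow> real" where
  "lincomb n a x b y = (\<lambda>i\<in>{..<n}. a * x i + b * y i)"

lemma lincomb_in [simp]: "lincomb n a x b y \<in> {..<n} \<rightarrow>\<^sub>E UNIV"
  by (simp add: lincomb_def)

lemma lincomb_space [simp]: "lincomb n a x b y \<in> space (std_gaussian n)"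
  by (simp add: space_std_gaussian)

lemma lincomb_apply: "i < n \<Longrightarrow> lincomb n a x b y i = a * x i + b * y i"
  by (simp add: lincomb_def)

lemma PiE_UNIV_eqI:
  "x \<in> {..<n} \<rightarrow>\<^sub>E UNIV \<Longrightarrow> y \<in> {..<n} \<rightarrow>\<^sub>E UNIV \<Longrightarrow> (\<And>i. i < n \<Longrightarrow> x i = y i) \<Longrightarrow> x = (y :: nat \<Rightarrow> real)"
  by (rule PiE_ext) auto

lemma lincomb_measurable [measurable (raw)]:
  assumes [measurable]: "g \<in> M \<rightarrow>\<^sub>M std_gaussian n" "h \<in> M \<rightarrow>\<^sub>M std_gaussian n"
  shows "(\<lambda>w. lincomb n a (g w) b (h w)) \<in> M \<rightarrow>\<^sub>M std_gaussian n"
  unfolding lincomb_def by (intro measurable_std_gaussian_restrict) measurable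

text \<open>Reversibility: the step from x to \<open>c * x + s * Z\<close> leaves the standard
  normal law invariant, and its transition density relative to that law is symmetric.\<close>

lemma affine_density_commute:
  assumes "c\<^sup>2 + s\<^sup>2 = 1" "s \<noteq> 0"
  shows "affine_density (c * x) s y = affine_density (c * y) s x"
proof -
  have c: "c\<^sup>2 = 1 - s\<^sup>2" using assms by simp
  have *: "u\<^sup>2 / 2 - (u - c * v)\<^sup>2 / (2 * s\<^sup>2) = (2 * c * u * v - c\<^sup>2 * u\<^sup>2 - c\<^sup>2 * v\<^sup>2) / (2 * s\<^sup>2)" for u v
  proof -
    have "u\<^sup>2 * s\<^sup>2 - (u - c * v)\<^sup>2 = 2 * c * u * v - c\<^sup>2 * u\<^sup>2 - c\<^sup>2 * v\<^sup>2"
      using assms(1) by algebra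
    moreover have "u\<^sup>2 / 2 - (u - c * v)\<^sup>2 / (2 * s\<^sup>2) = (u\<^sup>2 * s\<^sup>2 - (u - c * v)\<^sup>2) / (2 * s\<^sup>2)"
      using assms(2) by (simp add: field_simps)
    ultimately show ?thesis by simp
  qed
  show ?thesis unfolding affine_density_def * by (simp add: algebra_simps)
qed

lemma affine_density_eq_mehler:
  assumes "\<bar>c\<bar> < 1"
  shows "affine_density (c * x) (sqrt (1 - c\<^sup>2)) y = mehler_kernel c x y"
proof -
  have pos: "1 - c\<^sup>2 > 0" using assms by (simp add: abs_square_less_1)
  have "y\<^sup>2 * (1 - c\<^sup>2) - (y - c * x)\<^sup>2 = - (c\<^sup>2 * x\<^sup>2 - 2 * c * x * y + c\<^sup>2 * y\<^sup>2)"
    by algebra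
  moreover have "y\<^sup>2 / 2 - (y - c * x)\<^sup>2 / (2 * (1 - c\<^sup>2)) = (y\<^sup>2 * (1 - c\<^sup>2) - (y - c * x)\<^sup>2) / (2 * (1 - c\<^sup>2))"
    using pos by (simp add: field_simps)
  ultimately show ?thesis
    using pos by (simp add: affine_density_def mehler_kernel_def)
qed

context
  fixes n :: nat
begin

interpretation G: prob_space "std_gaussian n" by (rule prob_space_std_gaussian)
interpretation GG: pair_sigma_finite "std_gaussian n" "std_gaussian n" ..

text \<open>Two substitutions in one vector at a time replace a change of variables on pairs. For
  fixed x, \<open>u = c x + s y\<close> becomes the inner variable and leaves the kernel
  \<open>?K x u\<close>. After the integrals are exchanged, symmetry of the kernel permits the
  substitution \<open>x = c u + s z\<close> for fixed u, and this turns the second argument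
  \<open>(x - c u) / s\<close> into z.\<close>

lemma nn_integral_gauss_rotation:
  assumes [measurable]: "\<phi> \<in> borel_measurable (std_gaussian n \<Otimes>\<^sub>M std_gaussian n)"
    and cs: "c\<^sup>2 + s\<^sup>2 = 1" and s: "s \<noteq> 0"
  shows "(\<integral>\<^sup>+x. \<integral>\<^sup>+y. \<phi> (lincomb n c x s y, lincomb n s x (- c) y) \<partial>std_gaussian n \<partial>std_gaussian n)
       = (\<integral>\<^sup>+x. \<integral>\<^sup>+y. \<phi> (x, y) \<partial>std_gaussian n \<partial>std_gaussian n)"
proof -
  let ?K = "\<lambda>x y. ennreal (\<Prod>i<n. affine_density (c * x i) s (y i))"
  have K [measurable]: "case_prod ?K \<in> borel_measurable (std_gaussian n \<Otimes>\<^sub>M std_gaussian n)"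
    unfolding affine_density_def by measurable
  have "(\<integral>\<^sup>+x. \<integral>\<^sup>+y. \<phi> (lincomb n c x s y, lincomb n s x (- c) y) \<partial>std_gaussian n \<partial>std_gaussian n)
      = (\<integral>\<^sup>+x. \<integral>\<^sup>+u. ?K x u * \<phi> (u, lincomb n (1 / s) x (- c / s) u) \<partial>std_gaussian n \<partial>std_gaussian n)"
  proof (rule nn_integral_cong)
    fix x assume x: "x \<in> space (std_gaussian n)"
    have "lincomb n s x (- c) y = lincomb n (1 / s) x (- c / s) (\<lambda>i\<in>{..<n}. c * x i + s * y i)" for y
    proof -
      have "s * u - c * v = (u - c * (c * u + s * v)) / s" for u v
      proof -
        have "u - c * (c * u + s * v) = s * (s * u - c * v)" using cs by algebra
        then show ?thesis using s by simp
      qed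
      then show ?thesis
        by (intro PiE_UNIV_eqI[OF lincomb_in lincomb_in]) (auto simp: lincomb_apply diff_divide_distrib)
    qed
    then have "(\<integral>\<^sup>+y. \<phi> (lincomb n c x s y, lincomb n s x (- c) y) \<partial>std_gaussian n)
       = (\<integral>\<^sup>+y. (\<lambda>u. \<phi> (u, lincomb n (1 / s) x (- c / s) u)) (\<lambda>i\<in>{..<n}. c * x i + s * y i) \<partial>std_gaussian n)"
      by (simp add: lincomb_def)
    also have "\<dots> = (\<integral>\<^sup>+u. ?K x u * \<phi> (u, lincomb n (1 / s) x (- c / s) u) \<partial>std_gaussian n)"
      using x by (intro nn_integral_std_gaussian_affine s) measurable
    finally show "(\<integral>\<^sup>+y. \<phi> (lincomb n c x s y, lincomb n s x (- c) y) \<partial>std_gaussian n)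
       = (\<integral>\<^sup>+u. ?K x u * \<phi> (u, lincomb n (1 / s) x (- c / s) u) \<partial>std_gaussian n)" .
  qed
  also have "\<dots> = (\<integral>\<^sup>+u. \<integral>\<^sup>+x. ?K x u * \<phi> (u, lincomb n (1 / s) x (- c / s) u) \<partial>std_gaussian n \<partial>std_gaussian n)"
    by (rule GG.Fubini'[symmetric]) measurable
  also have "\<dots> = (\<integral>\<^sup>+u. \<integral>\<^sup>+z. \<phi> (u, z) \<partial>std_gaussian n \<partial>std_gaussian n)"
  proof (rule nn_integral_cong)
    fix u assume u: "u \<in> space (std_gaussian n)"
    have "(\<integral>\<^sup>+x. ?K x u * \<phi> (u, lincomb n (1 / s) x (- c / s) u) \<partial>std_gaussian n)
      = (\<integral>\<^sup>+x. ?K u x * \<phi> (u, lincomb n (1 / s) x (- c / s) u) \<partial>std_gaussian n)"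
      by (simp only: affine_density_commute[OF cs s])
    also have "\<dots> = (\<integral>\<^sup>+z. \<phi> (u, lincomb n (1 / s) (\<lambda>i\<in>{..<n}. c * u i + s * z i) (- c / s) u) \<partial>std_gaussian n)"
      using u by (intro nn_integral_std_gaussian_affine[symmetric] s) measurable
    also have "\<dots> = (\<integral>\<^sup>+z. \<phi> (u, z) \<partial>std_gaussian n)"
    proof (rule nn_integral_cong)
      fix z assume z: "z \<in> space (std_gaussian n)"
      have "lincomb n (1 / s) (\<lambda>i\<in>{..<n}. c * u i + s * z i) (- c / s) u = z"
        using z s by (intro PiE_UNIV_eqI[where n = n] lincomb_in, simp add: space_std_gaussian) (auto simp: lincomb_apply space_std_gaussian field_simps)
      then show "\<phi> (u, lincomb n (1 / s) (\<lambda>i\<in>{..<n}. c * u i + s * z i) (- c / s) u) = \<phi> (u, z)"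
        by simp
    qed
    finally show "(\<integral>\<^sup>+x. ?K x u * \<phi> (u, lincomb n (1 / s) x (- c / s) u) \<partial>std_gaussian n)
      = (\<integral>\<^sup>+z. \<phi> (u, z) \<partial>std_gaussian n)" .
  qed
  finally show ?thesis .
qed

lemma nn_integral_gauss_lincomb:
  assumes [measurable]: "\<psi> \<in> borel_measurable (std_gaussian n)"
    and cs: "c\<^sup>2 + s\<^sup>2 = 1" and s: "s \<noteq> 0"
  shows "(\<integral>\<^sup>+x. \<integral>\<^sup>+y. \<psi> (lincomb n c x s y) \<partial>std_gaussian n \<partial>std_gaussian n)
       = (\<integral>\<^sup>+x. \<psi> x \<partial>std_gaussian n)"
  using nn_integral_gauss_rotation[of "\<lambda>(x, y). \<psi> x" c s] assms by (simp add: G.emeasure_space_1)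

lemma distr_gauss_lincomb:
  assumes cs: "c\<^sup>2 + s\<^sup>2 = 1" and s: "s \<noteq> 0"
  shows "distr (std_gaussian n \<Otimes>\<^sub>M std_gaussian n) (std_gaussian n) (\<lambda>(x, y). lincomb n c x s y)
       = std_gaussian n"
proof (rule measure_eqI)
  fix A assume "A \<in> sets (distr (std_gaussian n \<Otimes>\<^sub>M std_gaussian n) (std_gaussian n) (\<lambda>(x, y). lincomb n c x s y))"
  then have [measurable]: "A \<in> sets (std_gaussian n)" by simp
  have "emeasure (distr (std_gaussian n \<Otimes>\<^sub>M std_gaussian n) (std_gaussian n) (\<lambda>(x, y). lincomb n c x s y)) A
    = (\<integral>\<^sup>+p. indicator A (case p of (x, y) \<Rightarrow> lincomb n c x s y) \<partial>(std_gaussian n \<Otimes>\<^sub>M std_gaussian n))"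
    by (subst nn_integral_indicator[symmetric], simp, subst nn_integral_distr) auto
  also have "\<dots> = (\<integral>\<^sup>+x. \<integral>\<^sup>+y. indicator A (lincomb n c x s y) \<partial>std_gaussian n \<partial>std_gaussian n)"
    by (subst G.nn_integral_fst[symmetric]) auto
  also have "\<dots> = emeasure (std_gaussian n) A"
    using nn_integral_gauss_lincomb[of "indicator A" c s] cs s by simp
  finally show "emeasure (distr (std_gaussian n \<Otimes>\<^sub>M std_gaussian n) (std_gaussian n) (\<lambda>(x, y). lincomb n c x s y)) A
    = emeasure (std_gaussian n) A" .
qed simp

section \<open>Laws of correlated Gaussian pairs\<close>

definition corr_law :: "real \<Rightarrow> ((nat \<Rightarrow> real) \<times> (nat \<Rightarrow> real)) measure" where
  "corr_law c = distr (std_gaussian n \<Otimes>\<^sub>M std_gaussian n) (std_gaussian n \<Otimes>\<^sub>M std_gaussian n)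
     (\<lambda>(x, z). (x, lincomb n c x (sqrt (1 - c\<^sup>2)) z))"

lemma sets_corr_law [measurable_cong]: "sets (corr_law c) = sets (std_gaussian n \<Otimes>\<^sub>M std_gaussian n)"
  by (simp add: corr_law_def)

lemma nn_integral_corr_law:
  assumes [measurable]: "\<phi> \<in> borel_measurable (std_gaussian n \<Otimes>\<^sub>M std_gaussian n)"
  shows "(\<integral>\<^sup>+p. \<phi> p \<partial>corr_law c)
     = (\<integral>\<^sup>+x. \<integral>\<^sup>+z. \<phi> (x, lincomb n c x (sqrt (1 - c\<^sup>2)) z) \<partial>std_gaussian n \<partial>std_gaussian n)"
  unfolding corr_law_def
  by (subst nn_integral_distr, measurable, subst G.nn_integral_fst[symmetric]) auto

lemma corr_law_eq_density:
  assumes c: "\<bar>c\<bar> < 1"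
  shows "corr_law c = density (std_gaussian n \<Otimes>\<^sub>M std_gaussian n)
           (\<lambda>(x, y). ennreal (\<Prod>i<n. mehler_kernel c (x i) (y i)))"
proof (rule measure_eqI)
  have pos: "1 - c\<^sup>2 > 0" using c by (simp add: abs_square_less_1)
  have [measurable]: "(\<lambda>(x, y). ennreal (\<Prod>i<n. mehler_kernel c (x i) (y i)))
     \<in> borel_measurable (std_gaussian n \<Otimes>\<^sub>M std_gaussian n)"
    unfolding mehler_kernel_def by measurable
  fix A assume "A \<in> sets (corr_law c)"
  then have [measurable]: "A \<in> sets (std_gaussian n \<Otimes>\<^sub>M std_gaussian n)" by (simp add: sets_corr_law)
  have "emeasure (corr_law c) A = (\<integral>\<^sup>+p. indicator A p \<partial>corr_law c)"
    by (simp add: sets_corr_law)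
  also have "\<dots> = (\<integral>\<^sup>+x. \<integral>\<^sup>+z. indicator A (x, lincomb n c x (sqrt (1 - c\<^sup>2)) z) \<partial>std_gaussian n \<partial>std_gaussian n)"
    by (rule nn_integral_corr_law) simp
  also have "\<dots> = (\<integral>\<^sup>+x. \<integral>\<^sup>+y. ennreal (\<Prod>i<n. mehler_kernel c (x i) (y i)) * indicator A (x, y) \<partial>std_gaussian n \<partial>std_gaussian n)"
  proof (rule nn_integral_cong)
    fix x assume x: "x \<in> space (std_gaussian n)"
    show "(\<integral>\<^sup>+z. indicator A (x, lincomb n c x (sqrt (1 - c\<^sup>2)) z) \<partial>std_gaussian n)
       = (\<integral>\<^sup>+y. ennreal (\<Prod>i<n. mehler_kernel c (x i) (y i)) * indicator A (x, y) \<partial>std_gaussian n)"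
      using nn_integral_std_gaussian_affine[of "\<lambda>y. indicator A (x, y)" n "sqrt (1 - c\<^sup>2)" "\<lambda>i. c * x i"] x pos c
      by (simp add: affine_density_eq_mehler lincomb_def)
  qed
  also have "\<dots> = emeasure (density (std_gaussian n \<Otimes>\<^sub>M std_gaussian n)
           (\<lambda>(x, y). ennreal (\<Prod>i<n. mehler_kernel c (x i) (y i)))) A"
    by (subst emeasure_density, measurable, subst G.nn_integral_fst[symmetric]) auto
  finally show "emeasure (corr_law c) A = emeasure (density (std_gaussian n \<Otimes>\<^sub>M std_gaussian n)
           (\<lambda>(x, y). ennreal (\<Prod>i<n. mehler_kernel c (x i) (y i)))) A" .
qed (simp add: sets_corr_law)

text \<open>Both vectors contain \<open>\<sigma> w\<close>, of variance \<open>\<rho>\<close>; the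
  remainders have variance \<open>1 - \<rho>\<close> and correlation r, which adds up to the
  correlation c. In the proof (w, h) is rotated into the first vector X and an independent X'. The
  second vector becomes \<open>c X + \<beta> X' + \<delta> z\<close>, and its last two terms form a
  Gaussian vector of variance \<open>1 - c\<^sup>2\<close> independent of X.\<close>

lemma corr_law_compose:
  assumes \<rho>: "0 \<le> \<rho>" "\<rho> < 1" and r: "\<bar>r\<bar> < 1"
  defines "\<sigma> \<equiv> sqrt \<rho>" and "\<tau> \<equiv> sqrt (1 - \<rho>)"
  shows "corr_law (\<rho> + (1 - \<rho>) * r) =
     distr (std_gaussian n \<Otimes>\<^sub>M (std_gaussian n \<Otimes>\<^sub>M std_gaussian n)) (std_gaussian n \<Otimes>\<^sub>M std_gaussian n)
       (\<lambda>(w, h, z). (lincomb n \<sigma> w \<tau> h, lincomb n \<sigma> w \<tau> (lincomb n r h (sqrt (1 - r\<^sup>2)) z)))"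
    (is "_ = distr ?GGG ?GG ?T")
proof (rule measure_eqI)
  let ?G = "std_gaussian n"
  define c where "c = \<rho> + (1 - \<rho>) * r"
  define q where "q = sqrt (1 - r\<^sup>2)"
  define \<beta> where "\<beta> = \<sigma> * \<tau> * (1 - r)"
  define \<delta> where "\<delta> = \<tau> * q"
  define \<kappa> where "\<kappa> = sqrt (1 - c\<^sup>2)"
  have st: "\<sigma>\<^sup>2 = \<rho>" "\<tau>\<^sup>2 = 1 - \<rho>" "\<tau> > 0" using \<rho> by (auto simp: \<sigma>_def \<tau>_def)
  have q: "q\<^sup>2 = 1 - r\<^sup>2" "q > 0" using r by (auto simp: q_def abs_square_less_1 abs_square_le_1)
  have cc: "1 - c = (1 - \<rho>) * (1 - r)" "1 + c = (1 - \<rho>) * (1 + r) + 2 * \<rho>"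
    by (simp_all add: c_def algebra_simps)
  have "(1 - \<rho>) * (1 - r) > 0" "(1 - \<rho>) * (1 + r) > 0"
    using \<rho> r by (auto simp: abs_less_iff intro!: mult_pos_pos)
  then have "1 - c > 0" "1 + c > 0"
    unfolding cc using \<rho> by simp_all
  then have "(1 - c) * (1 + c) > 0" by simp
  then have c2: "1 - c\<^sup>2 > 0" by (simp add: algebra_simps power2_eq_square)
  have \<kappa>: "\<kappa>\<^sup>2 = 1 - c\<^sup>2" "\<kappa> > 0" using c2 by (auto simp: \<kappa>_def)
  have \<delta>: "\<delta> > 0" using st q by (simp add: \<delta>_def)
  have "\<beta>\<^sup>2 + \<delta>\<^sup>2 = 1 - c\<^sup>2"
    unfolding \<beta>_def \<delta>_def power_mult_distrib st q c_def by algebra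
  then have unit: "(\<beta> / \<kappa>)\<^sup>2 + (\<delta> / \<kappa>)\<^sup>2 = 1"
    using \<kappa> c2 by (simp add: power_divide flip: add_divide_distrib)
  have T [measurable]: "?T \<in> ?GGG \<rightarrow>\<^sub>M ?GG" by measurable
  fix A assume "A \<in> sets (corr_law (\<rho> + (1 - \<rho>) * r))"
  then have [measurable]: "A \<in> sets ?GG" by (simp add: sets_corr_law)
  define \<Phi> :: "_ \<Rightarrow> ennreal" where "\<Phi> = indicator A"
  have [measurable]: "\<Phi> \<in> borel_measurable ?GG" unfolding \<Phi>_def by simp
  define F where "F = (\<lambda>(X, X'). \<integral>\<^sup>+z. \<Phi> (X, lincomb n c X \<kappa> (lincomb n (\<beta> / \<kappa>) X' (\<delta> / \<kappa>) z)) \<partial>?G)"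
  have F [measurable]: "F \<in> borel_measurable ?GG" unfolding F_def by measurable
  have "emeasure (distr ?GGG ?GG ?T) A = (\<integral>\<^sup>+p. \<Phi> (?T p) \<partial>?GGG)"
    unfolding \<Phi>_def by (subst nn_integral_indicator[symmetric], simp, subst nn_integral_distr) auto
  also have "\<dots> = (\<integral>\<^sup>+w. \<integral>\<^sup>+h. \<integral>\<^sup>+z. \<Phi> (lincomb n \<sigma> w \<tau> h, lincomb n \<sigma> w \<tau> (lincomb n r h q z)) \<partial>?G \<partial>?G \<partial>?G)"
    unfolding q_def
    by (subst GG.P.nn_integral_fst[symmetric], measurable, intro nn_integral_cong,
        subst G.nn_integral_fst[symmetric]) auto
  also have "\<dots> = (\<integral>\<^sup>+w. \<integral>\<^sup>+h. F (lincomb n \<sigma> w \<tau> h, lincomb n \<tau> w (- \<sigma>) h) \<partial>?G \<partial>?G)"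
  proof -
    have "lincomb n \<sigma> w \<tau> (lincomb n r h q z) = lincomb n c (lincomb n \<sigma> w \<tau> h) \<kappa>
        (lincomb n (\<beta> / \<kappa>) (lincomb n \<tau> w (- \<sigma>) h) (\<delta> / \<kappa>) z)" for w h z
    proof (rule PiE_UNIV_eqI[OF lincomb_in lincomb_in])
      fix i assume i: "i < n"
      have "\<sigma> * a + \<tau> * (r * b + q * d) = c * (\<sigma> * a + \<tau> * b) + (\<beta> * (\<tau> * a + - \<sigma> * b) + \<delta> * d)" for a b d
      proof -
        have c: "c = \<sigma>\<^sup>2 + \<tau>\<^sup>2 * r" by (simp add: c_def st)
        have "\<sigma>\<^sup>2 + \<tau>\<^sup>2 = 1" by (simp add: st)
        then show ?thesis unfolding c \<beta>_def \<delta>_def by algebra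
      qed
      then show "lincomb n \<sigma> w \<tau> (lincomb n r h q z) i = lincomb n c (lincomb n \<sigma> w \<tau> h) \<kappa>
        (lincomb n (\<beta> / \<kappa>) (lincomb n \<tau> w (- \<sigma>) h) (\<delta> / \<kappa>) z) i"
        using i \<kappa> by (simp add: lincomb_apply distrib_left)
    qed
    then show ?thesis by (simp add: F_def)
  qed
  also have "\<dots> = (\<integral>\<^sup>+X. \<integral>\<^sup>+X'. F (X, X') \<partial>?G \<partial>?G)"
    using st by (intro nn_integral_gauss_rotation) auto
  also have "\<dots> = (\<integral>\<^sup>+X. \<integral>\<^sup>+z. \<Phi> (X, lincomb n c X \<kappa> z) \<partial>?G \<partial>?G)"
  proof (rule nn_integral_cong)
    fix X assume X: "X \<in> space ?G"
    show "(\<integral>\<^sup>+X'. F (X, X') \<partial>?G) = (\<integral>\<^sup>+z. \<Phi> (X, lincomb n c X \<kappa> z) \<partial>?G)"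
      unfolding F_def using X \<delta> \<kappa> unit
      by (simp, intro nn_integral_gauss_lincomb[where \<psi> = "\<lambda>z. \<Phi> (X, lincomb n c X \<kappa> z)"]) auto
  qed
  also have "\<dots> = (\<integral>\<^sup>+p. \<Phi> p \<partial>corr_law c)"
    unfolding \<kappa>_def by (rule nn_integral_corr_law[symmetric]) measurable
  also have "\<dots> = emeasure (corr_law c) A"
    unfolding \<Phi>_def by (simp add: sets_corr_law)
  finally show "emeasure (corr_law (\<rho> + (1 - \<rho>) * r)) A = emeasure (distr ?GGG ?GG ?T) A"
    unfolding c_def ..
qed (simp add: sets_corr_law)

end

section \<open>Power series that are small on an interval\<close>

text \<open>The real part of a geometric sum over powers of a root of unity of order dividing 2d,
  which differs from 1 because j is not a multiple of 2d.\<close>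

lemma sum_cos_roots:
  fixes j :: int
  assumes d: "d \<ge> 1" and j: "\<bar>j\<bar> < 2 * int d" "j \<noteq> 0"
  shows "(\<Sum>m<2 * d. cos (real_of_int j * (pi * real m / real d))) = 0"
proof -
  define z where "z = cis (pi * real_of_int j / real d)"
  have zm: "z ^ m = cis (real_of_int j * (pi * real m / real d))" for m
    by (simp add: z_def Complex.DeMoivre mult_ac)
  have "z ^ (2 * d) = cis (2 * pi * real_of_int j)"
    unfolding zm using d by (simp add: mult_ac)
  also have "\<dots> = 1"
    by (simp add: cis_conv_exp exp_eq_1)
  finally have z1: "z ^ (2 * d) = 1" .
  have "z \<noteq> 1"
  proof
    assume "z = 1"
    then have "cos (pi * real_of_int j / real d) = 1"
      unfolding z_def by (metis cis.sel(1) one_complex.sel(1))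
    then obtain i :: int where "pi * real_of_int j / real d = real_of_int i * 2 * pi"
      using cos_one_2pi_int by blast
    then have "pi * real_of_int j = pi * (2 * real_of_int i * real d)"
      using d by (simp add: field_simps)
    then have "real_of_int j = real_of_int (2 * i * int d)" by simp
    then have ji: "j = 2 * i * int d" using of_int_eq_iff by blast
    then have "i \<noteq> 0" using j by auto
    then have "1 * (2 * int d) \<le> \<bar>i\<bar> * (2 * int d)" by (intro mult_right_mono) auto
    then show False using j ji by (simp add: abs_mult)
  qed
  then have "(\<Sum>m<2 * d. z ^ m) = 0"
    using z1 by (simp add: sum_gp_strict)
  then have "Re (\<Sum>m<2 * d. z ^ m) = 0" by simp
  then show ?thesis by (simp add: zm)
qed

text \<open>The kernel of the finite Fourier transform of \<open>k\<^sup>2\<close>, shifted by half a period: the shift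
  turns \<open>k\<^sup>2\<close> into a convex sequence, whose transform is nonnegative.\<close>

definition square_dft :: "nat \<Rightarrow> nat \<Rightarrow> real" where
  "square_dft d m = (\<Sum>k<2 * d. (real d - real k)\<^sup>2 * cos (real k * (pi * real m / real d))) / (2 * real d)"

lemma square_dft_nonneg:
  assumes d: "d \<ge> 1" and m: "m < 2 * d"
  shows "square_dft d m \<ge> 0"
proof (cases "m = 0")
  case True
  then show ?thesis by (auto simp: square_dft_def intro!: divide_nonneg_nonneg sum_nonneg)
next
  case False
  define \<theta> where "\<theta> = pi * real m / real d"
  define S where "S = (\<Sum>k<2 * d. (real d - real k)\<^sup>2 * cos (real k * \<theta>))"
  \<comment> \<open>Summation by parts: the second difference of \<open>(d - k)\<^sup>2\<close> is
    the constant 2, and the plain cosine sum vanishes. Telescoping \<open>V\<close> leaves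
    \<open>(1 - cos \<theta>) * S = 2 * d\<close>, so the transform equals
    \<open>1 / (1 - cos \<theta>)\<close> away from m = 0.\<close>
  define V where "V k = (real d + 1 - real k)\<^sup>2 * cos (real k * \<theta>) - (real d - real k)\<^sup>2 * cos ((real k - 1) * \<theta>)" for k
  have V: "V (Suc k) - V k = - 2 * (1 - cos \<theta>) * ((real d - real k)\<^sup>2 * cos (real k * \<theta>)) - 2 * cos (real k * \<theta>)" for k
  proof -
    have "cos (real (Suc k) * \<theta>) = cos (real k * \<theta>) * cos \<theta> - sin (real k * \<theta>) * sin \<theta>"
      "cos ((real k - 1) * \<theta>) = cos (real k * \<theta>) * cos \<theta> + sin (real k * \<theta>) * sin \<theta>"
      by (simp_all add: distrib_right left_diff_distrib cos_add cos_diff)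
    moreover have "real (Suc k) - 1 = real k" by simp
    ultimately show ?thesis unfolding V_def by (simp only:) (simp add: algebra_simps power2_eq_square)
  qed
  have "V (2 * d) - V 0 = (\<Sum>k<2 * d. V (Suc k) - V k)"
    by (rule sum_lessThan_telescope[symmetric])
  also have "\<dots> = - 2 * (1 - cos \<theta>) * S - 2 * (\<Sum>k<2 * d. cos (real k * \<theta>))"
    unfolding V S_def by (simp only: sum_subtractf sum_distrib_left)
  also have "(\<Sum>k<2 * d. cos (real k * \<theta>)) = 0"
    using sum_cos_roots[of d "int m"] d m False by (simp add: \<theta>_def mult_ac)
  also have "V (2 * d) - V 0 = - 4 * real d"
  proof -
    have arg: "real (2 * d) * \<theta> = 2 * real m * pi" using d by (simp add: \<theta>_def)
    have "cos (real (2 * d) * \<theta>) = 1" "sin (real (2 * d) * \<theta>) = 0"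
      unfolding arg by simp_all
    then show ?thesis
      unfolding V_def left_diff_distrib cos_diff by (simp add: algebra_simps power2_eq_square)
  qed
  finally have eq: "(1 - cos \<theta>) * S = 2 * real d" by (simp add: algebra_simps)
  then have "S \<ge> 0"
    using d cos_le_one[of \<theta>] by (smt (verit) mult_nonneg_nonpos2 of_nat_0_le_iff mult.commute of_nat_1 of_nat_mono)
  then show ?thesis by (simp add: square_dft_def S_def \<theta>_def)
qed

text \<open>The sign \<open>(- 1) ^ m\<close> is \<open>cos (d \<theta>)\<close> and undoes the
  shift by half a period. Product formulas and orthogonality of cosines on the 2d points then select
  the frequencies \<open>k = d - l\<close> and \<open>k = d + l\<close>, where
  \<open>(d - k)\<^sup>2 = l\<^sup>2\<close>.\<close>

lemma square_dft_inversion: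
  fixes l :: int
  assumes d: "d \<ge> 1" and l: "\<bar>l\<bar> \<le> int d"
  shows "(\<Sum>m<2 * d. (- 1) ^ m * square_dft d m * cos (real_of_int l * (pi * real m / real d))) = (real_of_int l)\<^sup>2"
proof -
  have *: "(\<Sum>m<2 * d. (- 1) ^ m * square_dft d m * cos (real l * (pi * real m / real d))) = (real l)\<^sup>2"
    if l: "l \<le> d" for l
  proof -
    let ?\<theta> = "\<lambda>m. pi * real m / real d"
    define T where "T j = (\<Sum>m<2 * d. cos (real_of_int j * ?\<theta> m))" for j :: int
    have T0: "T 0 = 2 * real d" by (simp add: T_def)
    have Tz: "T j = 0" if "\<bar>j\<bar> < 2 * int d" "j \<noteq> 0" for j
      unfolding T_def using sum_cos_roots[OF d that] .
    have T2: "T (2 * int d) = 2 * real d"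
    proof -
      have c1: "cos (real_of_int (2 * int d) * ?\<theta> m) = 1" for m
        using d cos_2npi[of m] by (simp add: mult_ac)
      show ?thesis unfolding T_def c1 by simp
    qed
    have prod: "(- 1) ^ m * cos (real k * ?\<theta> m) * cos (real l * ?\<theta> m)
        = (cos (real_of_int (int d - int k - int l) * ?\<theta> m) + cos (real_of_int (int d - int k + int l) * ?\<theta> m)) / 2" for k m
    proof -
      have "cos (real d * ?\<theta> m) = (- 1) ^ m" "sin (real d * ?\<theta> m) = 0"
        using d cos_npi2[of m] sin_npi2[of m] by simp_all
      then have "(- 1) ^ m * cos (real k * ?\<theta> m) = cos (real d * ?\<theta> m - real k * ?\<theta> m)"
        by (simp add: cos_diff)
      then have "(- 1) ^ m * cos (real k * ?\<theta> m) * cos (real l * ?\<theta> m)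
         = (cos (real d * ?\<theta> m - real k * ?\<theta> m - real l * ?\<theta> m)
          + cos (real d * ?\<theta> m - real k * ?\<theta> m + real l * ?\<theta> m)) / 2"
        by (simp only: cos_times_cos)
      then show ?thesis by (simp only: of_int_add of_int_diff of_int_of_nat_eq left_diff_distrib distrib_right)
    qed
    have "(\<Sum>m<2 * d. (- 1) ^ m * square_dft d m * cos (real l * ?\<theta> m))
      = (\<Sum>m<2 * d. \<Sum>k<2 * d. (real d - real k)\<^sup>2 * ((- 1) ^ m * cos (real k * ?\<theta> m) * cos (real l * ?\<theta> m))) / (2 * real d)"
      by (simp add: square_dft_def sum_divide_distrib sum_distrib_left sum_distrib_right mult_ac)
    also have "(\<Sum>m<2 * d. \<Sum>k<2 * d. (real d - real k)\<^sup>2 * ((- 1) ^ m * cos (real k * ?\<theta> m) * cos (real l * ?\<theta> m)))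
      = (\<Sum>k<2 * d. (real d - real k)\<^sup>2 * (T (int d - int k - int l) + T (int d - int k + int l)) / 2)"
      unfolding prod T_def
      by (subst sum.swap)
        (simp add: sum_distrib_left sum_divide_distrib sum.distrib[symmetric] add_divide_distrib distrib_left)
    \<comment> \<open>For l = d the frequency d + l = 2d is out of range, and k = 0 takes its place
      because \<open>T (2 * int d)\<close> is also a full sum. For l = 0 both indicators fall on k =
      d, where the value is 0.\<close>
    also have "\<dots> = (\<Sum>k<2 * d. (if k = d - l then (real l)\<^sup>2 * real d else 0) + (if k = (if l = d then 0 else d + l) then (real l)\<^sup>2 * real d else 0))"
    proof (intro sum.cong refl)
      fix k assume "k \<in> {..<2 * d}"
      then have k: "k < 2 * d" by simp
      have 1: "T (int d - int k - int l) = (if k = d - l then 2 * real d else 0)"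
        using Tz[of "int d - int k - int l"] T0 k l by (cases "k = d - l") (auto simp: of_nat_diff)
      have 2: "T (int d - int k + int l) = (if k = (if l = d then 0 else d + l) then 2 * real d else 0)"
      proof (cases "k = (if l = d then 0 else d + l)")
        case True
        then show ?thesis using T0 T2 by (cases "l = d") auto
      next
        case False
        then have "int d - int k + int l \<noteq> 0" "\<bar>int d - int k + int l\<bar> < 2 * int d"
          using k l by (auto split: if_splits)
        then show ?thesis using Tz False by simp
      qed
      show "(real d - real k)\<^sup>2 * (T (int d - int k - int l) + T (int d - int k + int l)) / 2
        = (if k = d - l then (real l)\<^sup>2 * real d else 0) + (if k = (if l = d then 0 else d + l) then (real l)\<^sup>2 * real d else 0)"
        unfolding 1 2 using l by (auto simp: of_nat_diff split: if_splits)
    qed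
    also have "\<dots> = 2 * real d * (real l)\<^sup>2"
      using d l by (simp add: sum.distrib) arith
    finally show ?thesis using d by simp
  qed
  have ce: "cos (real_of_int l * x) = cos (real (nat \<bar>l\<bar>) * x)" for x
    by (cases "l \<ge> 0") auto
  show ?thesis unfolding ce using *[of "nat \<bar>l\<bar>"] l by simp
qed

text \<open>With \<open>s = (1 - cos \<theta>) / 2\<close>, the functional \<open>q \<mapsto> (\<Sum>m. (-1)^m * square_dft d m * q (s m))\<close> on
  polynomials of degree at most \<open>d\<close> is \<open>- q' 0 / 2\<close>, and its norm is \<open>d\<^sup>2\<close>.\<close>

lemma endpoint_derivative_bound:
  fixes b :: "nat \<Rightarrow> real"
  assumes d: "d \<ge> 1" and b: "\<And>j. \<bar>b j\<bar> \<le> 1"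
    and p: "\<And>t. 0 \<le> t \<Longrightarrow> t \<le> 1 / 128 \<Longrightarrow> (\<lambda>j. b j * t ^ Suc j) sums p t"
    and M: "\<And>t. 0 \<le> t \<Longrightarrow> t \<le> 1 / 128 \<Longrightarrow> \<bar>p t\<bar> \<le> M"
  shows "b 0 \<le> 256 * (real d)\<^sup>2 * (M + (1 / 64) ^ d)"
proof -
  let ?\<theta> = "\<lambda>m. pi * real m / real d"
  define s where "s m = (1 - cos (?\<theta> m)) / 2" for m
  define w where "w m = (- 1) ^ m * square_dft d m" for m
  define L where "L \<phi> = (\<Sum>m<2 * d. w m * \<phi> m)" for \<phi> :: "nat \<Rightarrow> real"
  have s01: "0 \<le> s m" "s m \<le> 1" for m
    using cos_le_one[of "?\<theta> m"] cos_ge_minus_one[of "?\<theta> m"] unfolding s_def by auto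
  have Lcos: "L (\<lambda>m. cos (real_of_int l * ?\<theta> m)) = (real_of_int l)\<^sup>2" if "\<bar>l\<bar> \<le> int d" for l
    using square_dft_inversion[OF d that] by (simp add: L_def w_def mult_ac)
  have L_add: "L (\<lambda>m. \<phi> m + \<psi> m) = L \<phi> + L \<psi>" for \<phi> \<psi>
    by (simp add: L_def distrib_left sum.distrib)
  have L_scale: "L (\<lambda>m. c * \<phi> m) = c * L \<phi>" for c \<phi>
    by (simp add: L_def sum_distrib_left mult_ac)
  have cos_shift: "cos (x * y) * cos y = (cos ((x + 1) * y) + cos ((x - 1) * y)) / 2" for x y :: real
  proof -
    have "(x + 1) * y = x * y + y" "(x - 1) * y = x * y - y" by (simp_all add: algebra_simps)
    then show ?thesis by (simp only: cos_times_cos) simp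
  qed
  \<comment> \<open>In the frequency k, multiplication by s is -1/4 times the second difference.
    \<open>L\<close> turns the cosine of frequency k into \<open>k\<^sup>2\<close>, so one
    multiplication yields the constant -1/2 and every further one yields 0, as long as the
    frequencies stay within d.\<close>
  have s_cos: "s m * cos (real_of_int k * ?\<theta> m) = 1 / 2 * cos (real_of_int k * ?\<theta> m) +
      (- 1 / 4 * cos (real_of_int (k + 1) * ?\<theta> m) + - 1 / 4 * cos (real_of_int (k - 1) * ?\<theta> m))" for k m
    using cos_shift[of "real_of_int k" "?\<theta> m"] unfolding s_def by (simp add: field_simps)
  have L2: "L (\<lambda>m. s m ^ 2 * cos (real_of_int k * ?\<theta> m)) = 0" if "\<bar>k\<bar> + 2 \<le> int d" for k
  proof -
    have "(\<lambda>m. s m ^ 2 * cos (real_of_int k * ?\<theta> m)) = (\<lambda>m. 3 / 8 * cos (real_of_int k * ?\<theta> m)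
        + (- 1 / 4 * cos (real_of_int (k + 1) * ?\<theta> m) + (- 1 / 4 * cos (real_of_int (k - 1) * ?\<theta> m)
        + (1 / 16 * cos (real_of_int (k + 1 + 1) * ?\<theta> m) + 1 / 16 * cos (real_of_int (k - 1 - 1) * ?\<theta> m)))))"
    proof
      fix m
      have "s m ^ 2 * cos (real_of_int k * ?\<theta> m) = s m * (s m * cos (real_of_int k * ?\<theta> m))"
        by (simp add: power2_eq_square)
      also have "\<dots> = 1 / 2 * (s m * cos (real_of_int k * ?\<theta> m)) + (- 1 / 4 * (s m * cos (real_of_int (k + 1) * ?\<theta> m))
          + - 1 / 4 * (s m * cos (real_of_int (k - 1) * ?\<theta> m)))"
        using arg_cong[OF s_cos[of m k], of "\<lambda>z. s m * z"] by (simp only: distrib_left mult.left_commute)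
      also have "\<dots> = 3 / 8 * cos (real_of_int k * ?\<theta> m)
        + (- 1 / 4 * cos (real_of_int (k + 1) * ?\<theta> m) + (- 1 / 4 * cos (real_of_int (k - 1) * ?\<theta> m)
        + (1 / 16 * cos (real_of_int (k + 1 + 1) * ?\<theta> m) + 1 / 16 * cos (real_of_int (k - 1 - 1) * ?\<theta> m))))"
      proof -
        have shift: "k + 1 - 1 = k" "k - 1 + 1 = k" by simp_all
        have "1 / 2 * (1 / 2 * a + (- 1 / 4 * b + - 1 / 4 * c)) + (- 1 / 4 * (1 / 2 * b + (- 1 / 4 * e + - 1 / 4 * a))
            + - 1 / 4 * (1 / 2 * c + (- 1 / 4 * a + - 1 / 4 * f)))
          = 3 / 8 * a + (- 1 / 4 * b + (- 1 / 4 * c + (1 / 16 * e + 1 / 16 * f)))" for a b c e f :: real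
          by (simp add: field_simps)
        then show ?thesis unfolding s_cos shift .
      qed
      finally show "s m ^ 2 * cos (real_of_int k * ?\<theta> m) = 3 / 8 * cos (real_of_int k * ?\<theta> m)
        + (- 1 / 4 * cos (real_of_int (k + 1) * ?\<theta> m) + (- 1 / 4 * cos (real_of_int (k - 1) * ?\<theta> m)
        + (1 / 16 * cos (real_of_int (k + 1 + 1) * ?\<theta> m) + 1 / 16 * cos (real_of_int (k - 1 - 1) * ?\<theta> m))))" .
    qed
    then have "L (\<lambda>m. s m ^ 2 * cos (real_of_int k * ?\<theta> m)) = 3 / 8 * (real_of_int k)\<^sup>2
        + (- 1 / 4 * (real_of_int (k + 1))\<^sup>2 + (- 1 / 4 * (real_of_int (k - 1))\<^sup>2
        + (1 / 16 * (real_of_int (k + 1 + 1))\<^sup>2 + 1 / 16 * (real_of_int (k - 1 - 1))\<^sup>2)))"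
      using that by (simp only: L_add L_scale Lcos)
    then show ?thesis by (simp add: power2_eq_square algebra_simps)
  qed
  \<comment> \<open>The cosine factor is kept with a general k because every multiplication by s
    moves the frequency by one.\<close>
  have Lj: "L (\<lambda>m. s m ^ (j + 2) * cos (real_of_int k * ?\<theta> m)) = 0" if "\<bar>k\<bar> + int j + 2 \<le> int d" for j k
    using that
  proof (induction j arbitrary: k)
    case 0
    then show ?case using L2[of k] by (simp add: power2_eq_square)
  next
    case (Suc j)
    have "(\<lambda>m. s m ^ (Suc j + 2) * cos (real_of_int k * ?\<theta> m)) = (\<lambda>m. s m ^ (j + 2) * (s m * cos (real_of_int k * ?\<theta> m)))"
      by (simp add: mult_ac)
    also have "\<dots> = (\<lambda>m. 1 / 2 * (s m ^ (j + 2) * cos (real_of_int k * ?\<theta> m))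
      + (- 1 / 4 * (s m ^ (j + 2) * cos (real_of_int (k + 1) * ?\<theta> m)) + - 1 / 4 * (s m ^ (j + 2) * cos (real_of_int (k - 1) * ?\<theta> m))))"
      unfolding s_cos by (simp only: distrib_left mult.left_commute)
    finally show ?case
      using Suc.IH[of k] Suc.IH[of "k + 1"] Suc.IH[of "k - 1"] Suc.prems by (simp only: L_add L_scale)
  qed
  have Ls: "L s = - 1 / 2"
  proof -
    have "s = (\<lambda>m. 1 / 2 * cos (real_of_int 0 * ?\<theta> m) + - 1 / 2 * cos (real_of_int 1 * ?\<theta> m))"
      by (auto simp: s_def fun_eq_iff field_simps)
    then have "L s = 1 / 2 * (real_of_int 0)\<^sup>2 + - 1 / 2 * (real_of_int 1)\<^sup>2"
      using d by (simp only: L_add L_scale Lcos)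
    then show ?thesis by simp
  qed
  \<comment> \<open>The signs of the weights are those of the cosine of frequency d, so the total
    weight is the value of \<open>L\<close> on this cosine.\<close>
  have wabs: "(\<Sum>m<2 * d. \<bar>w m\<bar>) = (real d)\<^sup>2"
  proof -
    have "(\<Sum>m<2 * d. \<bar>w m\<bar>) = (\<Sum>m<2 * d. (- 1) ^ m * square_dft d m * cos (real_of_int (int d) * ?\<theta> m))"
    proof (intro sum.cong refl)
      fix m assume m: "m \<in> {..<2 * d}"
      have "cos (real_of_int (int d) * ?\<theta> m) = (- 1) ^ m" using d cos_npi2[of m] by simp
      then show "\<bar>w m\<bar> = (- 1) ^ m * square_dft d m * cos (real_of_int (int d) * ?\<theta> m)"
        using square_dft_nonneg[OF d, of m] m by (simp add: w_def abs_mult flip: power_mult_distrib)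
    qed
    also have "\<dots> = (real d)\<^sup>2" using square_dft_inversion[OF d, of "int d"] by simp
    finally show ?thesis .
  qed
  have Labs: "\<bar>L \<phi>\<bar> \<le> (real d)\<^sup>2 * B" if "\<And>m. \<bar>\<phi> m\<bar> \<le> B" for \<phi> B
  proof -
    have "\<bar>L \<phi>\<bar> \<le> (\<Sum>m<2 * d. \<bar>w m * \<phi> m\<bar>)" unfolding L_def by (rule sum_abs)
    also have "\<dots> \<le> (\<Sum>m<2 * d. \<bar>w m\<bar> * B)"
      by (intro sum_mono) (simp add: abs_mult mult_left_mono that)
    finally show ?thesis by (simp add: wabs flip: sum_distrib_right)
  qed
  define \<tau> where "\<tau> j = b j * (1 / 128) ^ Suc j * L (\<lambda>m. s m ^ Suc j)" for j
  have "(\<lambda>j. \<Sum>m<2 * d. w m * (b j * (s m / 128) ^ Suc j)) sums (\<Sum>m<2 * d. w m * p (s m / 128))"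
    using s01 by (intro sums_sum sums_mult p) (auto simp: field_simps)
  moreover have "(\<Sum>m<2 * d. w m * (b j * (s m / 128) ^ Suc j)) = \<tau> j" for j
    by (simp add: \<tau>_def L_def sum_distrib_left power_divide mult_ac del: power_Suc)
  ultimately have "\<tau> sums L (\<lambda>m. p (s m / 128))" by (simp add: L_def)
  \<comment> \<open>The linear term contributes \<open>- b 0 / 256\<close>: -1/2 from
    \<open>L s\<close> and 1/128 from rescaling the interval. Adding it back leaves only terms of
    degree above d, since \<open>L\<close> annihilates the powers from 2 to d.\<close>
  then have "(\<lambda>j. \<tau> j + (if j = 0 then b 0 / 256 else 0)) sums (L (\<lambda>m. p (s m / 128)) + b 0 / 256)"
    using sums_single[of 0 "\<lambda>_. b 0 / 256"] by (intro sums_add) auto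
  moreover have "norm (\<Sum>j. \<tau> j + (if j = 0 then b 0 / 256 else 0)) \<le> (\<Sum>j. (real d)\<^sup>2 * (1 / 64) ^ d * (1 / 2) ^ Suc j)"
  proof (rule norm_suminf_le)
    show "summable (\<lambda>j. (real d)\<^sup>2 * (1 / 64) ^ d * (1 / 2 :: real) ^ Suc j)"
      using power_half_series by (intro summable_mult) (rule sums_summable)
    fix j
    show "norm (\<tau> j + (if j = 0 then b 0 / 256 else 0)) \<le> (real d)\<^sup>2 * (1 / 64) ^ d * (1 / 2) ^ Suc j"
    proof (cases "j = 0")
      case True
      then show ?thesis by (simp add: \<tau>_def Ls)
    next
      case False
      then obtain i where i: "j = Suc i" by (cases j) auto
      show ?thesis
      proof (cases "Suc j \<le> d")
        case True
        have "L (\<lambda>m. s m ^ Suc j) = 0"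
          using Lj[of 0 i] True i by simp
        then show ?thesis using False by (simp add: \<tau>_def)
      next
        case dj: False
        have "\<bar>s m ^ Suc j\<bar> \<le> 1" for m
          using s01[of m] by (simp add: power_abs power_le_one del: power_Suc)
        from Labs[OF this] have L1: "\<bar>L (\<lambda>m. s m ^ Suc j)\<bar> \<le> (real d)\<^sup>2" by simp
        \<comment> \<open>The powers of 1/64 give the truncation error, and those of 1/2 remain as a
          convergent geometric series.\<close>
        have "(1 / 128 :: real) ^ Suc j = (1 / 64) ^ Suc j * (1 / 2) ^ Suc j"
          by (simp add: power_mult_distrib[symmetric] del: power_Suc)
        also have "\<dots> \<le> (1 / 64) ^ d * (1 / 2) ^ Suc j"
          using dj by (intro mult_right_mono power_decreasing) auto
        finally have 128: "(1 / 128 :: real) ^ Suc j \<le> (1 / 64) ^ d * (1 / 2) ^ Suc j" .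
        have "\<bar>\<tau> j\<bar> = \<bar>b j\<bar> * ((1 / 128) ^ Suc j * \<bar>L (\<lambda>m. s m ^ Suc j)\<bar>)"
          unfolding \<tau>_def by (simp add: abs_mult del: power_Suc)
        also have "\<dots> \<le> 1 * (((1 / 64) ^ d * (1 / 2) ^ Suc j) * (real d)\<^sup>2)"
          by (intro mult_mono b 128 L1) auto
        finally show ?thesis using False by (simp add: mult_ac)
      qed
    qed
  qed
  moreover have "(\<Sum>j. (real d)\<^sup>2 * (1 / 64) ^ d * (1 / 2) ^ Suc j) = (real d)\<^sup>2 * (1 / 64) ^ d"
    using sums_unique[OF sums_mult[OF power_half_series, of "(real d)\<^sup>2 * (1 / 64) ^ d"]] by simp
  ultimately have "\<bar>L (\<lambda>m. p (s m / 128)) + b 0 / 256\<bar> \<le> (real d)\<^sup>2 * (1 / 64) ^ d"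
    by (simp add: sums_iff)
  moreover have "\<bar>L (\<lambda>m. p (s m / 128))\<bar> \<le> (real d)\<^sup>2 * M"
    using s01 by (intro Labs M) (auto simp: field_simps)
  ultimately have "b 0 / 256 \<le> (real d)\<^sup>2 * M + (real d)\<^sup>2 * (1 / 64) ^ d" by linarith
  then show ?thesis by (simp add: algebra_simps)
qed

section \<open>Optimising the truncation degree\<close>

lemma square_le_two_power: "(real d)\<^sup>2 \<le> 2 * 2 ^ d"
proof (induction d rule: less_induct)
  case (less d)
  show ?case
  proof (cases "d \<le> 3")
    case True
    then have "d \<in> {0, 1, 2, 3}" by auto
    then show ?thesis by auto
  next
    case False
    then obtain e where e: "d = Suc e" "e \<ge> 3" by (cases d) auto
    have e3: "real e \<ge> 3" using e by simp
    then have "3 * real e \<le> real e * real e" by (intro mult_right_mono) auto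
    with e3 have "1 + 2 * real e \<le> real e * real e" by linarith
    then have "(real d)\<^sup>2 \<le> 2 * (real e)\<^sup>2" using e by (simp add: power2_eq_square algebra_simps)
    also have "\<dots> \<le> 2 * (2 * 2 ^ e)" using less[of e] e by simp
    finally show ?thesis using e by simp
  qed
qed

text \<open>The degree d is taken just large enough for the truncation error to be absorbed by half
  of \<open>b 0\<close>. The remaining loss is a multiple of
  \<open>(ln (1 / b 0) + 3)\<^sup>2\<close>, which \<open>Phi\<close> matches up to a
  constant.\<close>

lemma extremal_power_series:
  fixes b :: "nat \<Rightarrow> real"
  assumes b: "\<And>j. \<bar>b j\<bar> \<le> 1" and b0: "b 0 \<ge> 0"
    and p: "\<And>t. 0 \<le> t \<Longrightarrow> t \<le> 1 / 128 \<Longrightarrow> (\<lambda>j. b j * t ^ Suc j) sums p t"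
    and M: "\<And>t. 0 \<le> t \<Longrightarrow> t \<le> 1 / 128 \<Longrightarrow> \<bar>p t\<bar> \<le> M"
  shows "1 / 8192 * Phi (b 0) \<le> M"
proof (cases "b 0 = 0")
  case True
  have "0 \<le> M" using M[of 0] by simp
  then show ?thesis using True by (simp add: Phi_def)
next
  case False
  define a where "a = b 0"
  have a: "0 < a" "a \<le> 1" using False b0 b[of 0] by (auto simp: a_def)
  define l where "l = ln (1 / a)"
  have l: "l \<ge> 0" "exp (- l) = a" using a by (auto simp: l_def ln_div)
  \<comment> \<open>The summand 2 makes \<open>512 * (1 / 32) ^ d\<close> at most half of
    \<open>(1 / 32) powr l\<close>, and \<open>exp 1 \<le> 32\<close> bounds this by
    \<open>a / 2\<close>.\<close>
  define d where "d = nat \<lceil>l\<rceil> + 2"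
  have d: "l + 2 \<le> real d" "real d \<le> l + 3" "d \<ge> 1"
    using l by (auto simp: d_def) linarith+
  have "256 * (real d)\<^sup>2 * (1 / 64) ^ d \<le> 256 * (2 * 2 ^ d) * (1 / 64) ^ d"
    by (intro mult_right_mono mult_left_mono square_le_two_power) auto
  also have "\<dots> = 512 * (1 / 32) ^ d"
    by (simp add: power_mult_distrib[symmetric] mult.assoc)
  also have "(1 / 32 :: real) ^ d = (1 / 32) powr real d" by (simp add: powr_realpow)
  also have "512 * \<dots> \<le> 512 * (1 / 32) powr (l + 2)"
    using d by (intro mult_left_mono powr_mono') auto
  also have "\<dots> = (1 / 32) powr l / 2" by (simp add: powr_add power_divide)
  also have "\<dots> \<le> exp (- l) / 2"
  proof -
    have "exp 1 \<le> (32 :: real)" using exp_le by simp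
    then have "1 \<le> ln (32 :: real)" by (subst ln_ge_iff) auto
    then have "l * 1 \<le> l * ln 32" using l by (intro mult_left_mono) auto
    then show ?thesis by (simp add: powr_def ln_div)
  qed
  finally have small: "256 * (real d)\<^sup>2 * (1 / 64) ^ d \<le> a / 2" using l by simp
  have "a \<le> 256 * (real d)\<^sup>2 * (M + (1 / 64) ^ d)"
    unfolding a_def by (rule endpoint_derivative_bound[OF d(3) b p M])
  then have "a / 2 \<le> 256 * (real d)\<^sup>2 * M" using small by (simp add: algebra_simps)
  also have "\<dots> \<le> 256 * (l + 3)\<^sup>2 * M"
    using d l M[of 0] by (intro mult_right_mono mult_left_mono power_mono) auto
  finally have aM: "a \<le> 512 * (l + 3)\<^sup>2 * M" by simp
  have M0: "M \<ge> 0" using M[of 0] by simp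
  \<comment> \<open>The constant is 512 times 16. For \<open>l \<le> 1\<close> the factor
    \<open>(l + 3)\<^sup>2\<close> is at most 16 and \<open>Phi a \<le> a\<close>; for larger l it
    is at most \<open>16 * l\<^sup>2\<close>, which cancels against the denominator in
    \<open>Phi a \<le> a / l\<^sup>2\<close>. At a = 1, where \<open>Phi\<close> takes its
    conventional value, l is 0.\<close>
  have "Phi a \<le> 8192 * M"
  proof (cases "a = 1 \<or> l \<le> 1")
    case True
    have "Phi a \<le> a" by (auto simp: Phi_def)
    moreover have "l \<le> 1" using True by (auto simp: l_def)
    then have "(l + 3)\<^sup>2 \<le> 4\<^sup>2" using l by (intro power_mono) auto
    then have "512 * (l + 3)\<^sup>2 * M \<le> 512 * 16 * M" using M0 by (intro mult_right_mono mult_left_mono) auto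
    ultimately show ?thesis using aM by linarith
  next
    case False
    then have "Phi a \<le> a / l\<^sup>2" using a by (auto simp: Phi_def l_def)
    also have "\<dots> \<le> 512 * (l + 3)\<^sup>2 * M / l\<^sup>2" using aM by (intro divide_right_mono) auto
    also have "\<dots> \<le> 512 * (4 * l)\<^sup>2 * M / l\<^sup>2"
      using False M0 by (intro divide_right_mono mult_right_mono mult_left_mono power_mono) auto
    also have "\<dots> = 8192 * M" using False by (simp add: field_simps)
    finally show ?thesis .
  qed
  then show ?thesis by (simp add: a_def)
qed

section \<open>Sums over multi-indices\<close>

lemma multi_indices_0: "multi_indices 0 k = (if k = 0 then {\<lambda>_. undefined} else {})"
  by (auto simp: multi_indices_def)

lemma multi_indices_deg_0: "multi_indices n 0 = {\<lambda>i\<in>{..<n}. 0}"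
  by (auto simp: multi_indices_def PiE_iff extensional_def fun_eq_iff)

text \<open>With j the degree in the first n coordinates, splitting off the last one gives the sum
  the shape of a Cauchy product.\<close>

lemma sum_multi_indices_Suc:
  "(\<Sum>\<alpha>\<in>multi_indices (Suc n) k. G \<alpha>) = (\<Sum>j\<le>k. \<Sum>\<alpha>\<in>multi_indices n j. G (\<alpha>(n := k - j)))"
proof -
  have "(\<Sum>j\<le>k. \<Sum>\<alpha>\<in>multi_indices n j. G (\<alpha>(n := k - j)))
      = (\<Sum>(j, \<alpha>)\<in>Sigma {..k} (multi_indices n). G (\<alpha>(n := k - j)))"
    by (rule sum.Sigma) (auto simp: finite_multi_indices)
  also have "\<dots> = (\<Sum>\<alpha>\<in>multi_indices (Suc n) k. G \<alpha>)"
  proof (rule sum.reindex_bij_witness[where i = "\<lambda>\<alpha>. (k - \<alpha> n, restrict \<alpha> {..<n})" and j = "\<lambda>(j, \<alpha>). \<alpha>(n := k - j)"])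
    fix p assume p: "p \<in> Sigma {..k} (multi_indices n)"
    then obtain j \<alpha> where p': "p = (j, \<alpha>)" "j \<le> k" "\<alpha> \<in> multi_indices n j" by auto
    then have "restrict (\<alpha>(n := k - j)) {..<n} = \<alpha>"
      by (auto simp: multi_indices_def PiE_iff extensional_def fun_eq_iff)
    then show "(\<lambda>\<alpha>. (k - \<alpha> n, restrict \<alpha> {..<n})) (case p of (j, \<alpha>) \<Rightarrow> \<alpha>(n := k - j)) = p"
      using p' by simp
    show "(case p of (j, \<alpha>) \<Rightarrow> \<alpha>(n := k - j)) \<in> multi_indices (Suc n) k"
      using p' by (auto simp: multi_indices_def PiE_iff extensional_def)
    show "G (case p of (j, \<alpha>) \<Rightarrow> \<alpha>(n := k - j)) = (case p of (j, \<alpha>) \<Rightarrow> G (\<alpha>(n := k - j)))"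
      by (simp add: p')
  next
    fix \<alpha> assume \<alpha>: "\<alpha> \<in> multi_indices (Suc n) k"
    then have s: "(\<Sum>i<n. \<alpha> i) + \<alpha> n = k" by (simp add: multi_indices_def)
    then have "k - (k - \<alpha> n) = \<alpha> n" by simp
    then show "(case (k - \<alpha> n, restrict \<alpha> {..<n}) of (j, \<alpha>) \<Rightarrow> \<alpha>(n := k - j)) = \<alpha>"
      using \<alpha> by (auto simp: multi_indices_def PiE_iff extensional_def fun_eq_iff)
    show "(k - \<alpha> n, restrict \<alpha> {..<n}) \<in> Sigma {..k} (multi_indices n)"
      using s by (auto simp: multi_indices_def)
  qed
  finally show ?thesis ..
qed

text \<open>Cauchy products, one coordinate at a time; absolute summability is carried along because
  each product relies on it. This lifts the one-dimensional Hermite series to n variables.\<close>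

lemma prod_power_series:
  fixes c :: "nat \<Rightarrow> nat \<Rightarrow> real"
  assumes "\<And>i. i < n \<Longrightarrow> summable (\<lambda>k. \<bar>c i k * t ^ k\<bar>)"
  shows "summable (\<lambda>k. \<bar>(\<Sum>\<alpha>\<in>multi_indices n k. \<Prod>i<n. c i (\<alpha> i)) * t ^ k\<bar>)"
    and "(\<lambda>k. (\<Sum>\<alpha>\<in>multi_indices n k. \<Prod>i<n. c i (\<alpha> i)) * t ^ k) sums (\<Prod>i<n. \<Sum>k. c i k * t ^ k)"
  using assms
proof (induction n)
  case 0
  have eq: "(\<Sum>\<alpha>\<in>multi_indices 0 k. \<Prod>i<0. c i (\<alpha> i)) * t ^ k = (if k = 0 then 1 else 0)" for k
    by (simp add: multi_indices_0)
  {
    case 1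
    show ?case unfolding eq by (intro summable_finite[of "{0}"]) auto
  next
    case 2
    show ?case unfolding eq using sums_single[of 0 "\<lambda>_. 1 :: real"] by simp
  }
next
  case (Suc n)
  define a where "a k = (\<Sum>\<alpha>\<in>multi_indices n k. \<Prod>i<n. c i (\<alpha> i)) * t ^ k" for k
  define b where "b k = c n k * t ^ k" for k
  have conv: "(\<Sum>\<alpha>\<in>multi_indices (Suc n) k. \<Prod>i<Suc n. c i (\<alpha> i)) * t ^ k = (\<Sum>i\<le>k. a i * b (k - i))" for k
  proof -
    have "(\<Sum>\<alpha>\<in>multi_indices (Suc n) k. \<Prod>i<Suc n. c i (\<alpha> i))
      = (\<Sum>j\<le>k. (\<Sum>\<alpha>\<in>multi_indices n j. \<Prod>i<n. c i (\<alpha> i)) * c n (k - j))"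
      unfolding sum_multi_indices_Suc by (simp add: sum_distrib_right)
    also have "\<dots> * t ^ k = (\<Sum>i\<le>k. a i * b (k - i))"
      unfolding a_def b_def sum_distrib_right
      by (intro sum.cong refl) (simp add: mult_ac flip: power_add)
    finally show ?thesis .
  qed
  {
    case 1
    then have a: "summable (\<lambda>k. \<bar>a k\<bar>)" and b: "summable (\<lambda>k. \<bar>b k\<bar>)"
      unfolding a_def b_def using Suc.IH(1) by auto
    have "summable (\<lambda>k. \<Sum>i\<le>k. \<bar>a i\<bar> * \<bar>b (k - i)\<bar>)"
      using Cauchy_product_sums[of "\<lambda>k. \<bar>a k\<bar>" "\<lambda>k. \<bar>b k\<bar>"] a b by (auto intro: sums_summable)
    then show ?case unfolding conv
      by (rule summable_comparison_test[rotated])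
        (auto intro!: exI[of _ 0] order_trans[OF sum_abs] sum_mono simp: abs_mult)
  next
    case 2
    then have a: "summable (\<lambda>k. \<bar>a k\<bar>)" and b: "summable (\<lambda>k. \<bar>b k\<bar>)"
      unfolding a_def b_def using Suc.IH(1) by auto
    have "(\<lambda>k. \<Sum>i\<le>k. a i * b (k - i)) sums ((\<Sum>k. a k) * (\<Sum>k. b k))"
      using Cauchy_product_sums[of a b] a b by simp
    moreover have "(\<Sum>k. a k) = (\<Prod>i<n. \<Sum>k. c i k * t ^ k)"
      using Suc.IH(2) 2 unfolding a_def by (auto simp: sums_iff)
    ultimately show ?case unfolding conv by (simp add: b_def)
  }
qed

section \<open>Multi-indices of degree one and two\<close>

definition pair_index :: "nat \<Rightarrow> nat \<Rightarrow> nat \<Rightarrow> nat \<Rightarrow> nat" where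
  "pair_index n i j = (\<lambda>k\<in>{..<n}. (if k = i then 1 else 0) + (if k = j then 1 else 0))"

lemma sum_multi_indices_1:
  "(\<Sum>\<alpha>\<in>multi_indices n 1. G \<alpha>) = (\<Sum>i<n. G (\<lambda>k\<in>{..<n}. if k = i then 1 else 0))"
proof (induction n arbitrary: G)
  case 0
  then show ?case by (simp add: multi_indices_0)
next
  case (Suc n)
  have 1: "(\<lambda>i\<in>{..<n}. 0)(n := 1) = (\<lambda>k\<in>{..<Suc n}. if k = n then 1 else 0 :: nat)"
    by (auto simp: fun_eq_iff)
  have 2: "(\<lambda>k\<in>{..<n}. if k = i then 1 else 0)(n := 0) = (\<lambda>k\<in>{..<Suc n}. if k = i then 1 else 0 :: nat)"
    if "i < n" for i using that by (auto simp: fun_eq_iff)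
  have "(\<Sum>\<alpha>\<in>multi_indices (Suc n) 1. G \<alpha>)
    = (\<Sum>\<alpha>\<in>multi_indices n 0. G (\<alpha>(n := 1))) + (\<Sum>\<alpha>\<in>multi_indices n 1. G (\<alpha>(n := 0)))"
    unfolding sum_multi_indices_Suc by (simp add: numeral_2_eq_2)
  also have "\<dots> = G ((\<lambda>i\<in>{..<n}. 0)(n := 1)) + (\<Sum>i<n. G ((\<lambda>k\<in>{..<n}. if k = i then 1 else 0)(n := 0)))"
    unfolding Suc.IH multi_indices_deg_0 by simp
  also have "(\<Sum>i<n. G ((\<lambda>k\<in>{..<n}. if k = i then 1 else 0)(n := 0)))
      = (\<Sum>i<n. G (\<lambda>k\<in>{..<Suc n}. if k = i then 1 else 0))"
    by (intro sum.cong refl) (simp only: 2 lessThan_iff)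
  also have "G ((\<lambda>i\<in>{..<n}. 0)(n := 1)) + \<dots> = (\<Sum>i<Suc n. G (\<lambda>k\<in>{..<Suc n}. if k = i then 1 else 0))"
    unfolding 1 sum.lessThan_Suc by (rule add.commute)
  finally show ?case .
qed

lemma sum_multi_indices_2:
  "(\<Sum>\<alpha>\<in>multi_indices n 2. G \<alpha>) = (\<Sum>j<n. \<Sum>i\<le>j. G (pair_index n i j))"
proof (induction n arbitrary: G)
  case 0
  then show ?case by (simp add: multi_indices_0)
next
  case (Suc n)
  have 1: "(\<lambda>i\<in>{..<n}. 0)(n := 2) = pair_index (Suc n) n n"
    by (auto simp: fun_eq_iff pair_index_def)
  have 2: "(\<lambda>k\<in>{..<n}. if k = i then 1 else 0)(n := 1) = pair_index (Suc n) i n"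
    if "i < n" for i using that by (auto simp: fun_eq_iff pair_index_def)
  have 3: "(pair_index n i j)(n := 0) = pair_index (Suc n) i j"
    if "i \<le> j" "j < n" for i j using that by (auto simp: fun_eq_iff pair_index_def)
  have "(\<Sum>\<alpha>\<in>multi_indices (Suc n) 2. G \<alpha>)
    = (\<Sum>\<alpha>\<in>multi_indices n 0. G (\<alpha>(n := 2))) + (\<Sum>\<alpha>\<in>multi_indices n 1. G (\<alpha>(n := 1)))
     + (\<Sum>\<alpha>\<in>multi_indices n 2. G (\<alpha>(n := 0)))"
    unfolding sum_multi_indices_Suc by (simp add: numeral_2_eq_2)
  also have "\<dots> = G ((\<lambda>i\<in>{..<n}. 0)(n := 2)) + (\<Sum>i<n. G ((\<lambda>k\<in>{..<n}. if k = i then 1 else 0)(n := 1)))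
     + (\<Sum>j<n. \<Sum>i\<le>j. G ((pair_index n i j)(n := 0)))"
    unfolding Suc.IH sum_multi_indices_1 multi_indices_deg_0 by simp
  also have "\<dots> = G (pair_index (Suc n) n n) + (\<Sum>i<n. G (pair_index (Suc n) i n))
     + (\<Sum>j<n. \<Sum>i\<le>j. G (pair_index (Suc n) i j))"
    unfolding 1 using 2 3 by simp
  also have "\<dots> = (\<Sum>j<Suc n. \<Sum>i\<le>j. G (pair_index (Suc n) i j))"
    by (simp add: lessThan_Suc_atMost[symmetric] add_ac)
  finally show ?case .
qed

section \<open>Quadratic forms and traces of products\<close>

lemma double_sum_Suc:
  fixes h :: "nat \<Rightarrow> nat \<Rightarrow> real"
  shows "(\<Sum>i<Suc n. \<Sum>j<Suc n. h i j) = (\<Sum>i<n. \<Sum>j<n. h i j) + (\<Sum>i<n. h i n) + (\<Sum>j<n. h n j) + h n n"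
  by (simp add: sum.distrib add_ac)

lemma sum_symmetric:
  fixes h :: "nat \<Rightarrow> nat \<Rightarrow> real"
  assumes "\<And>i j. h i j = h j i"
  shows "(\<Sum>i<n. \<Sum>j<n. h i j) = (\<Sum>j<n. 2 * (\<Sum>i<j. h i j) + h j j)"
proof (induction n)
  case (Suc n)
  have "(\<Sum>j<n. h n j) = (\<Sum>i<n. h i n)" by (simp add: assms[of n])
  then show ?case unfolding double_sum_Suc Suc by simp
qed simp

text \<open>Induction by Schur complements. If \<open>S n n > 0\<close>, then S is the sum of its
  complement \<open>S'\<close>, whose last row vanishes, and a rank-one matrix. The first is covered
  by the induction hypothesis, and the second paired with T is a value of the form of T, up to the
  positive factor \<open>1 / S n n\<close>.\<close>

lemma psd_trace_nonneg:
  fixes S T :: "nat \<Rightarrow> nat \<Rightarrow> real"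
  assumes "\<And>i j. S i j = S j i" "\<And>i j. T i j = T j i"
    and "\<And>v. (\<Sum>i<n. \<Sum>j<n. S i j * (v i * v j)) \<ge> 0"
    and "\<And>v. (\<Sum>i<n. \<Sum>j<n. T i j * (v i * v j)) \<ge> 0"
  shows "(\<Sum>i<n. \<Sum>j<n. S i j * T i j) \<ge> 0"
  using assms
proof (induction n arbitrary: S)
  case (Suc n)
  note symS = Suc.prems(1) and symT = Suc.prems(2)
  define Q where "Q S v = (\<Sum>i<n. \<Sum>j<n. S i j * (v i * v j))" for S :: "nat \<Rightarrow> nat \<Rightarrow> real" and v :: "nat \<Rightarrow> real"
  have expand: "(\<Sum>i<Suc n. \<Sum>j<Suc n. R i j * (v i * v j))
      = Q R v + 2 * v n * (\<Sum>i<n. R i n * v i) + R n n * (v n)\<^sup>2"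
    if "\<And>i j. R i j = R j i" for R v
  proof -
    have rs: "R n j * (v n * v j) = R j n * (v j * v n)" for j
      by (subst that) (simp add: mult.commute)
    have "(\<Sum>j<n. R n j * (v n * v j)) = (\<Sum>i<n. R i n * (v i * v n))" by (simp only: rs)
    then show ?thesis
      unfolding double_sum_Suc Q_def by (simp add: sum_distrib_left power2_eq_square mult_ac)
  qed
  have S: "Q S v + 2 * x * (\<Sum>i<n. S i n * v i) + S n n * x\<^sup>2 \<ge> 0" for v x
  proof -
    have "Q S (v(n := x)) = Q S v" "(\<Sum>i<n. S i n * (v(n := x)) i) = (\<Sum>i<n. S i n * v i)"
      by (simp_all add: Q_def)
    then show ?thesis using Suc.prems(3)[of "v(n := x)"] unfolding expand[OF symS]
      by (simp del: fun_upd_apply add: fun_upd_same)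
  qed
  have T: "Q T v + 2 * x * (\<Sum>i<n. T i n * v i) + T n n * x\<^sup>2 \<ge> 0" for v x
  proof -
    have "Q T (v(n := x)) = Q T v" "(\<Sum>i<n. T i n * (v(n := x)) i) = (\<Sum>i<n. T i n * v i)"
      by (simp_all add: Q_def)
    then show ?thesis using Suc.prems(4)[of "v(n := x)"] unfolding expand[OF symT]
      by (simp del: fun_upd_apply add: fun_upd_same)
  qed
  have T0: "(\<Sum>i<n. \<Sum>j<n. T i j * (v i * v j)) \<ge> 0" for v using T[of v 0] by (simp add: Q_def)
  have split: "(\<Sum>i<Suc n. \<Sum>j<Suc n. S i j * T i j)
      = (\<Sum>i<n. \<Sum>j<n. S i j * T i j) + 2 * (\<Sum>i<n. S i n * T i n) + S n n * T n n"
  proof -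
    have "S n j * T n j = S j n * T j n" for j
      using symS[of n j] symT[of n j] by simp
    then have "(\<Sum>j<n. S n j * T n j) = (\<Sum>i<n. S i n * T i n)" by simp
    then show ?thesis unfolding double_sum_Suc by simp
  qed
  have Snn: "S n n \<ge> 0" using S[of "\<lambda>_. 0" 1] by (simp add: Q_def)
  show ?case
  proof (cases "S n n = 0")
    case True
    \<comment> \<open>With \<open>S n n = 0\<close> the form is affine in the last coordinate with
      slope \<open>2 * S i n\<close>, so a nonzero entry would let it become negative; at the point
      chosen below its value is -1.\<close>
    have "S i n = 0" if i: "i < n" for i
    proof (rule ccontr)
      assume ne: "S i n \<noteq> 0"
      define v where "v k = (if k = i then 1 else 0 :: real)" for k
      have "(\<Sum>k<n. S k n * v k) = S i n" unfolding v_def using i by (simp add: if_distrib cong: if_cong)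
      then show False using S[of v "- (Q S v + 1) / (2 * S i n)"] True ne by (simp add: field_simps)
    qed
    then have "(\<Sum>i<Suc n. \<Sum>j<Suc n. S i j * T i j) = (\<Sum>i<n. \<Sum>j<n. S i j * T i j)"
      unfolding split using True by simp
    moreover have "\<dots> \<ge> 0"
      using S[of _ 0] by (intro Suc.IH symS symT T0) (simp add: Q_def)
    ultimately show ?thesis by simp
  next
    case False
    then have s: "S n n > 0" using Snn by simp
    define S' where "S' i j = S i j - S i n * S j n / S n n" for i j
    have "(\<Sum>i<n. \<Sum>j<n. S' i j * (v i * v j)) \<ge> 0" for v
    proof -
      define b where "b = (\<Sum>i<n. S i n * v i)"
      have "b * b = (\<Sum>i<n. \<Sum>j<n. (S i n * S j n) * (v i * v j))"
        unfolding b_def sum_product by (simp add: mult_ac)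
      then have "(\<Sum>i<n. \<Sum>j<n. S' i j * (v i * v j)) = Q S v - b * b / S n n"
        unfolding S'_def Q_def by (simp add: left_diff_distrib sum_subtractf sum_divide_distrib)
      \<comment> \<open>The form of S at the minimising value of the last coordinate.\<close>
      also have "\<dots> = Q S v + 2 * (- b / S n n) * b + S n n * (- b / S n n)\<^sup>2"
        using s by (simp add: power2_eq_square field_simps)
      also have "\<dots> \<ge> 0" using S[of v "- b / S n n"] by (simp add: b_def)
      finally show ?thesis .
    qed
    then have "(\<Sum>i<n. \<Sum>j<n. S' i j * T i j) \<ge> 0"
      using symS by (intro Suc.IH symT T0) (auto simp: S'_def mult.commute)
    moreover have "Q T (\<lambda>i. S i n) / S n n + 2 * (\<Sum>i<n. S i n * T i n) + S n n * T n n \<ge> 0"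
    proof -
      have "(Q T (\<lambda>i. S i n) + 2 * S n n * (\<Sum>i<n. T i n * S i n) + T n n * (S n n)\<^sup>2) / S n n \<ge> 0"
        using T[of "\<lambda>i. S i n" "S n n"] s by (intro divide_nonneg_nonneg) auto
      then show ?thesis using s by (simp add: add_divide_distrib power2_eq_square mult_ac)
    qed
    moreover have "(\<Sum>i<n. \<Sum>j<n. S i j * T i j) = (\<Sum>i<n. \<Sum>j<n. S' i j * T i j) + Q T (\<lambda>i. S i n) / S n n"
      unfolding S'_def Q_def by (simp add: left_diff_distrib right_diff_distrib sum_subtractf sum_divide_distrib mult_ac)
    ultimately show ?thesis unfolding split by linarith
  qed
qed simp

text \<open>The symmetric second difference quotient \<open>D\<close> is itself the sum of a power
  series, with value \<open>2 * c 2\<close> at 0 and nonnegative values elsewhere; continuity at 0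
  gives the sign.\<close>

lemma second_coeff_nonneg:
  fixes c :: "nat \<Rightarrow> real"
  assumes S: "\<And>t. (\<lambda>k. c k * t ^ k) sums S t" and mid: "\<And>t. S t + S (- t) \<ge> 2 * S 0"
  shows "c 2 \<ge> 0"
proof -
  define D where "D t = (if t = 0 then 2 * c 2 else (S t + S (- t) - 2 * S 0) / t\<^sup>2)" for t
  have "(\<lambda>k. (c (k + 2) * (1 + (- 1) ^ k)) * t ^ k) sums D t" for t
  proof (cases "t = 0")
    case True
    then show ?thesis using powser_sums_zero[of "\<lambda>k. c (k + 2) * (1 + (- 1) ^ k)"]
      by (simp add: D_def mult.commute numeral_2_eq_2)
  next
    case False
    have S0: "S 0 = c 0" using S[of 0] powser_sums_zero[of c] sums_unique2 by blast
    have "(\<lambda>k. c k * t ^ k + c k * (- t) ^ k) sums (S t + S (- t))"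
      by (intro sums_add S)
    then have "(\<lambda>k. c (k + 2) * t ^ (k + 2) + c (k + 2) * (- t) ^ (k + 2)) sums (S t + S (- t) - 2 * S 0)"
      by (subst sums_iff_shift[of _ 2]) (simp add: S0 numeral_2_eq_2)
    from sums_divide[OF this, of "t\<^sup>2"]
    have "(\<lambda>k. (c (k + 2) * t ^ (k + 2) + c (k + 2) * (- t) ^ (k + 2)) / t\<^sup>2) sums D t"
      using False by (simp add: D_def)
    moreover have "(c (k + 2) * t ^ (k + 2) + c (k + 2) * (- t) ^ (k + 2)) / t\<^sup>2
        = (c (k + 2) * (1 + (- 1) ^ k)) * t ^ k" for k
    proof -
      have "(- t) ^ (k + 2) = (- 1) ^ k * t ^ k * t\<^sup>2"
        using power_mult_distrib[of "- 1" t k] by (simp add: power_add power2_eq_square)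
      then show ?thesis using False by (simp add: power_add power2_eq_square field_simps)
    qed
    ultimately show ?thesis by simp
  qed
  then have "(D \<longlongrightarrow> c (0 + 2) * (1 + (- 1) ^ 0)) (at 0)"
    by (intro powser_limit_0[of 1]) auto
  moreover have "eventually (\<lambda>t. D t \<ge> 0) (at 0)"
    unfolding eventually_at_filter D_def using mid by (intro always_eventually) auto
  ultimately have "0 \<le> c (0 + 2) * (1 + (- 1) ^ 0)"
    by (rule tendsto_lowerbound) simp
  then show ?thesis by (simp add: numeral_2_eq_2)
qed

text \<open>The expansion at \<open>\<rho>\<close> shows that the second derivative there is
  \<open>2 * c 2 / (1 - \<rho>)\<^sup>2\<close>, hence nonnegative, and the one at 0 gives a
  vanishing first derivative. The coefficients change with \<open>\<rho>\<close> and are valid on a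
  window of radius \<open>(1 - \<rho>) / 8\<close>, so derivatives are computed window by window and
  only their signs are combined.\<close>

lemma mono_from_local_power_series:
  fixes F :: "real \<Rightarrow> real"
  assumes loc: "\<And>\<rho>. 0 \<le> \<rho> \<Longrightarrow> \<rho> < 1 \<Longrightarrow>
      \<exists>c. c 2 \<ge> 0 \<and> (\<rho> = 0 \<longrightarrow> c 1 = 0) \<and> (\<forall>r. \<bar>r\<bar> < 1 / 8 \<longrightarrow> (\<lambda>k. c k * r ^ k) sums F (\<rho> + (1 - \<rho>) * r))"
    and \<rho>: "0 \<le> \<rho>" "\<rho> \<le> \<rho>'" "\<rho>' < 1"
  shows "F \<rho> \<le> F \<rho>'"
proof -
  have D: "\<exists>y. (F has_real_derivative deriv F u) (at u) \<and> (deriv F has_real_derivative y) (at u) \<and> y \<ge> 0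
      \<and> (u = 0 \<longrightarrow> deriv F u = 0)" if u: "0 \<le> u" "u < 1" for u
  proof -
    obtain c where c: "c 2 \<ge> 0" "u = 0 \<Longrightarrow> c 1 = 0"
      "\<And>r. \<bar>r\<bar> < 1 / 8 \<Longrightarrow> (\<lambda>k. c k * r ^ k) sums F (u + (1 - u) * r)"
      using loc[OF u] by blast
    define A A' where "A r = (\<Sum>k. c k * r ^ k)" and "A' r = (\<Sum>k. diffs c k * r ^ k)" for r
    define W where "W = {u - (1 - u) / 8 <..< u + (1 - u) / 8}"
    have W: "open W" "u \<in> W" using u by (auto simp: W_def)
    have r: "\<bar>(v - u) / (1 - u)\<bar> < 1 / 8" if "v \<in> W" for v
    proof -
      have "u - (1 - u) / 8 < v" "v < u + (1 - u) / 8" using that by (auto simp: W_def)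
      then have "\<bar>v - u\<bar> < (1 - u) / 8" by linarith
      then show ?thesis using u by (simp add: abs_divide pos_divide_less_eq)
    qed
    have sm: "summable (\<lambda>k. c k * r ^ k)" if "norm r < 1 / 8" for r
      using c(3)[of r] that by (auto intro: sums_summable)
    have smd: "summable (\<lambda>k. diffs c k * r ^ k)" if "norm r < 1 / 8" for r
      using termdiff_converges[of r "1/8" c] sm that by blast
    have F: "F v = A ((v - u) / (1 - u))" if "v \<in> W" for v
    proof -
      have "F (u + (1 - u) * ((v - u) / (1 - u))) = A ((v - u) / (1 - u))"
        using c(3)[OF r[OF that]] unfolding A_def by (simp add: sums_iff)
      then show ?thesis using u by simp
    qed
    have dA: "(A has_real_derivative A' r) (at r)" if "\<bar>r\<bar> < 1 / 8" for r
      unfolding A_def[abs_def] A'_def by (rule termdiffs_strong'[of "1/8"]) (use sm that in auto)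
    have dA': "(A' has_real_derivative (\<Sum>k. diffs (diffs c) k * 0 ^ k)) (at 0)"
      unfolding A'_def[abs_def] by (rule termdiffs_strong'[of "1/8"]) (use smd in auto)
    have dF: "(F has_real_derivative A' ((v - u) / (1 - u)) / (1 - u)) (at v)" if v: "v \<in> W" for v
    proof -
      have "((\<lambda>v. A ((v - u) / (1 - u))) has_real_derivative A' ((v - u) / (1 - u)) * (1 / (1 - u))) (at v)"
        using u by (intro DERIV_chain2[where f = A] dA r v) (auto intro!: derivative_eq_intros)
      then show ?thesis
        using has_field_derivative_transform_within_open[OF _ W(1) v, of "\<lambda>v. A ((v - u) / (1 - u))" _ F] F by simp
    qed
    have dF': "deriv F v = A' ((v - u) / (1 - u)) / (1 - u)" if "v \<in> W" for v
      using dF[OF that] by (rule DERIV_imp_deriv)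
    have "((\<lambda>v. A' ((v - u) / (1 - u)) / (1 - u)) has_real_derivative
        (\<Sum>k. diffs (diffs c) k * 0 ^ k) * (1 / (1 - u)) / (1 - u)) (at u)"
      using dA' u by (intro DERIV_cdivide DERIV_chain2[where f = A']) (auto intro!: derivative_eq_intros)
    then have "(deriv F has_real_derivative (\<Sum>k. diffs (diffs c) k * 0 ^ k) * (1 / (1 - u)) / (1 - u)) (at u)"
      using has_field_derivative_transform_within_open[OF _ W, of "\<lambda>v. A' ((v - u) / (1 - u)) / (1 - u)" _ "deriv F"] dF' by simp
    moreover have "(\<Sum>k. diffs (diffs c) k * 0 ^ k) * (1 / (1 - u)) / (1 - u) \<ge> 0"
      using c(1) u unfolding powser_zero by (auto simp: diffs_def numeral_2_eq_2)
    moreover have "deriv F u = 0" if "u = 0"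
      using dF'[OF W(2)] c(2)[OF that] that by (simp add: A'_def diffs_def)
    ultimately show ?thesis using dF[OF W(2)] dF'[OF W(2)] by auto
  qed
  have "deriv F u \<ge> 0" if u: "0 \<le> u" "u < 1" for u
  proof -
    have "deriv F 0 \<le> deriv F u"
    proof (rule DERIV_nonneg_imp_nondecreasing[OF u(1)])
      fix x assume "0 \<le> x" "x \<le> u"
      then show "\<exists>y. (deriv F has_real_derivative y) (at x) \<and> 0 \<le> y"
        using D[of x] u by auto
    qed
    then show ?thesis using D[of 0] by auto
  qed
  note nonneg = this
  show ?thesis
  proof (rule DERIV_nonneg_imp_nondecreasing[OF \<rho>(2)])
    fix x assume "\<rho> \<le> x" "x \<le> \<rho>'"
    then have "0 \<le> x" "x < 1" using \<rho> by auto
    then show "\<exists>y. (F has_real_derivative y) (at x) \<and> 0 \<le> y"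
      using D[of x] nonneg[of x] by auto
  qed
qed

section \<open>Hermite expansions\<close>

lemma integrable_mult_squares:
  fixes f g :: "'a \<Rightarrow> real"
  assumes [measurable]: "f \<in> borel_measurable M" "g \<in> borel_measurable M"
    and f: "integrable M (\<lambda>x. (f x)\<^sup>2)" and g: "integrable M (\<lambda>x. (g x)\<^sup>2)"
  shows "integrable M (\<lambda>x. f x * g x)"
    and "(\<integral>x. \<bar>f x * g x\<bar> \<partial>M) \<le> ((\<integral>x. (f x)\<^sup>2 \<partial>M) + (\<integral>x. (g x)\<^sup>2 \<partial>M)) / 2"
proof -
  have le: "\<bar>f x * g x\<bar> \<le> ((f x)\<^sup>2 + (g x)\<^sup>2) / 2" for x
    using sum_squares_bound[of "\<bar>f x\<bar>" "\<bar>g x\<bar>"] by (simp add: abs_mult)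
  have int: "integrable M (\<lambda>x. ((f x)\<^sup>2 + (g x)\<^sup>2) / 2)" using f g by simp
  show 1: "integrable M (\<lambda>x. f x * g x)"
    by (rule Bochner_Integration.integrable_bound[OF int]) (use le in auto)
  have "(\<integral>x. \<bar>f x * g x\<bar> \<partial>M) \<le> (\<integral>x. ((f x)\<^sup>2 + (g x)\<^sup>2) / 2 \<partial>M)"
    using 1 int le by (intro integral_mono) auto
  also have "\<dots> = ((\<integral>x. (f x)\<^sup>2 \<partial>M) + (\<integral>x. (g x)\<^sup>2 \<partial>M)) / 2"
    using f g by simp
  finally show "(\<integral>x. \<bar>f x * g x\<bar> \<partial>M) \<le> ((\<integral>x. (f x)\<^sup>2 \<partial>M) + (\<integral>x. (g x)\<^sup>2 \<partial>M)) / 2" .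
qed

section \<open>Squared norms, orthonormality and Bessel's inequality\<close>

definition sq_mass :: "nat \<Rightarrow> ((nat \<Rightarrow> real) \<Rightarrow> real) \<Rightarrow> real" where
  "sq_mass n f = (\<integral>x. (f x)\<^sup>2 \<partial>std_gaussian n)"

lemma sq_mass_nonneg: "sq_mass n f \<ge> 0"
  unfolding sq_mass_def by (rule integral_nonneg_AE) simp

definition degree_part :: "nat \<Rightarrow> nat \<Rightarrow> ((nat \<Rightarrow> real) \<Rightarrow> real) \<Rightarrow> ((nat \<Rightarrow> real) \<Rightarrow> real) \<Rightarrow> real" where
  "degree_part n k f g = (\<Sum>\<alpha>\<in>multi_indices n k. hermite_coeff n f \<alpha> * hermite_coeff n g \<alpha>)"

lemma hermite_multi_measurable [measurable]: "hermite_multi n \<alpha> \<in> borel_measurable (std_gaussian n)"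
  unfolding hermite_multi_def[abs_def] by measurable

lemma hermite_multi_orthonormal:
  assumes "\<alpha> \<in> {..<n} \<rightarrow>\<^sub>E UNIV" "\<beta> \<in> {..<n} \<rightarrow>\<^sub>E UNIV"
  shows "integrable (std_gaussian n) (\<lambda>x. hermite_multi n \<alpha> x * hermite_multi n \<beta> x)"
    and "(\<integral>x. hermite_multi n \<alpha> x * hermite_multi n \<beta> x \<partial>std_gaussian n) = (if \<alpha> = \<beta> then 1 else 0)"
proof -
  have pN: "prob_space std_normal_distribution" by (rule prob_space_normal_density) simp
  interpret N: product_sigma_finite "\<lambda>_. std_normal_distribution"
    by (rule product_sigma_finite.intro) (rule prob_space_imp_sigma_finite[OF pN])
  have eq: "(\<lambda>x. hermite_multi n \<alpha> x * hermite_multi n \<beta> x) = (\<lambda>x. \<Prod>i<n. (\<lambda>y. hermite (\<alpha> i) y * hermite (\<beta> i) y) (x i))"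
    by (simp add: hermite_multi_def prod.distrib)
  show "integrable (std_gaussian n) (\<lambda>x. hermite_multi n \<alpha> x * hermite_multi n \<beta> x)"
    unfolding eq std_gaussian_def by (intro N.product_integrable_prod hermite_orthonormal) simp
  have "(\<integral>x. hermite_multi n \<alpha> x * hermite_multi n \<beta> x \<partial>std_gaussian n)
      = (\<Prod>i<n. \<integral>y. hermite (\<alpha> i) y * hermite (\<beta> i) y \<partial>std_normal_distribution)"
    unfolding eq std_gaussian_def by (intro N.product_integral_prod hermite_orthonormal) simp
  also have "\<dots> = (\<Prod>i<n. if \<alpha> i = \<beta> i then 1 else 0)"
    by (simp only: hermite_orthonormal)
  also have "\<dots> = (if \<alpha> = \<beta> then 1 else 0)"
  proof (cases "\<alpha> = \<beta>")
    case False
    then obtain i where "i < n" "\<alpha> i \<noteq> \<beta> i" using PiE_ext[OF assms] by auto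
    then have "(\<Prod>i<n. if \<alpha> i = \<beta> i then 1 else 0 :: real) = 0" by (intro prod_zero) auto
    then show ?thesis using False by simp
  qed simp
  finally show "(\<integral>x. hermite_multi n \<alpha> x * hermite_multi n \<beta> x \<partial>std_gaussian n) = (if \<alpha> = \<beta> then 1 else 0)" .
qed

lemma multi_indices_PiE: "\<alpha> \<in> multi_indices n k \<Longrightarrow> \<alpha> \<in> {..<n} \<rightarrow>\<^sub>E UNIV"
  by (simp add: multi_indices_def)

lemma hermite_multi_sq:
  assumes "\<alpha> \<in> multi_indices n k"
  shows "integrable (std_gaussian n) (\<lambda>x. (hermite_multi n \<alpha> x)\<^sup>2)"
    and "(\<integral>x. (hermite_multi n \<alpha> x)\<^sup>2 \<partial>std_gaussian n) = 1"
  using hermite_multi_orthonormal[OF multi_indices_PiE multi_indices_PiE, OF assms assms]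
  by (simp_all add: power2_eq_square)

lemma integrable_mult_hermite_multi:
  assumes f: "square_integrable n f" and \<alpha>: "\<alpha> \<in> multi_indices n k"
  shows "integrable (std_gaussian n) (\<lambda>x. f x * hermite_multi n \<alpha> x)"
    and "(\<integral>x. \<bar>f x * hermite_multi n \<alpha> x\<bar> \<partial>std_gaussian n) \<le> (sq_mass n f + 1) / 2"
  using integrable_mult_squares[of f "std_gaussian n" "hermite_multi n \<alpha>"] f hermite_multi_sq[OF \<alpha>]
  by (simp_all add: square_integrable_def sq_mass_def)

text \<open>Expand the nonnegative integral of the squared remainder after projection onto the
  Hermite polynomials of degree k.\<close>

lemma bessel_degree:
  assumes f: "square_integrable n f"
  shows "(\<Sum>\<alpha>\<in>multi_indices n k. (hermite_coeff n f \<alpha>)\<^sup>2) \<le> sq_mass n f"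
proof -
  let ?G = "std_gaussian n" and ?A = "multi_indices n k" and ?c = "hermite_coeff n f" and ?h = "hermite_multi n"
  have f2: "integrable ?G (\<lambda>x. (f x)\<^sup>2)" using f by (simp add: square_integrable_def)
  have fh: "integrable ?G (\<lambda>x. f x * ?h \<alpha> x)" if "\<alpha> \<in> ?A" for \<alpha>
    by (rule integrable_mult_hermite_multi[OF f that])
  have hh: "integrable ?G (\<lambda>x. ?h \<alpha> x * ?h \<beta> x)"
    "(\<integral>x. ?h \<alpha> x * ?h \<beta> x \<partial>?G) = (if \<alpha> = \<beta> then 1 else 0)" if "\<alpha> \<in> ?A" "\<beta> \<in> ?A" for \<alpha> \<beta>
    using hermite_multi_orthonormal[OF multi_indices_PiE multi_indices_PiE, OF that] by auto
  have expand: "(f x - (\<Sum>\<alpha>\<in>?A. ?c \<alpha> * ?h \<alpha> x))\<^sup>2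
      = (f x)\<^sup>2 - 2 * (\<Sum>\<alpha>\<in>?A. ?c \<alpha> * (f x * ?h \<alpha> x)) + (\<Sum>\<alpha>\<in>?A. \<Sum>\<beta>\<in>?A. ?c \<alpha> * ?c \<beta> * (?h \<alpha> x * ?h \<beta> x))" for x
    by (simp add: power2_diff sum_product sum_distrib_left mult_ac power2_eq_square[of "sum _ _"])
  have "0 \<le> (\<integral>x. (f x - (\<Sum>\<alpha>\<in>?A. ?c \<alpha> * ?h \<alpha> x))\<^sup>2 \<partial>?G)"
    by (rule integral_nonneg_AE) simp
  also have "\<dots> = sq_mass n f - 2 * (\<Sum>\<alpha>\<in>?A. ?c \<alpha> * ?c \<alpha>) + (\<Sum>\<alpha>\<in>?A. \<Sum>\<beta>\<in>?A. ?c \<alpha> * ?c \<beta> * (if \<alpha> = \<beta> then 1 else 0))"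
    unfolding expand using f2 fh hh
    by (simp add: sq_mass_def hermite_coeff_def gauss_expectation_def)
  also have "\<dots> = sq_mass n f - (\<Sum>\<alpha>\<in>?A. (?c \<alpha>)\<^sup>2)"
    by (simp add: finite_multi_indices power2_eq_square if_distrib sum.If_cases cong: if_cong)
  finally show ?thesis by simp
qed

text \<open>The arithmetic mean of the squared norms stands in for the product of the norms: it
  equals 1 when both masses are 1, and when the functions depend on a conditioning variable, its
  integrability follows directly from that of the masses.\<close>

lemma degree_part_bound:
  assumes f: "square_integrable n f" and g: "square_integrable n g"
  shows "\<bar>degree_part n k f g\<bar> \<le> (sq_mass n f + sq_mass n g) / 2"
proof -
  let ?A = "multi_indices n k"
  have le: "\<bar>a * b\<bar> \<le> (a\<^sup>2 + b\<^sup>2) / 2" for a b :: real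
    using sum_squares_bound[of "\<bar>a\<bar>" "\<bar>b\<bar>"] by (simp add: abs_mult)
  have "\<bar>degree_part n k f g\<bar> \<le> (\<Sum>\<alpha>\<in>?A. ((hermite_coeff n f \<alpha>)\<^sup>2 + (hermite_coeff n g \<alpha>)\<^sup>2) / 2)"
    unfolding degree_part_def by (intro order_trans[OF sum_abs] sum_mono le)
  also have "\<dots> = ((\<Sum>\<alpha>\<in>?A. (hermite_coeff n f \<alpha>)\<^sup>2) + (\<Sum>\<alpha>\<in>?A. (hermite_coeff n g \<alpha>)\<^sup>2)) / 2"
    by (simp add: sum.distrib flip: sum_divide_distrib)
  also have "\<dots> \<le> (sq_mass n f + sq_mass n g) / 2"
    using bessel_degree[OF f] bessel_degree[OF g] by (intro divide_right_mono add_mono) auto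
  finally show ?thesis .
qed

section \<open>Integrating Hermite series term by term\<close>

context
  fixes n :: nat
begin

interpretation G: prob_space "std_gaussian n" by (rule prob_space_std_gaussian)
interpretation GG: pair_sigma_finite "std_gaussian n" "std_gaussian n" ..

lemma integrable_pair_product:
  assumes a: "integrable (std_gaussian n) a" and b: "integrable (std_gaussian n) (b :: _ \<Rightarrow> real)"
  shows "integrable (std_gaussian n \<Otimes>\<^sub>M std_gaussian n) (\<lambda>(x, y). a x * b y)"
    and "(\<integral>p. (\<lambda>(x, y). a x * b y) p \<partial>(std_gaussian n \<Otimes>\<^sub>M std_gaussian n))
       = (\<integral>x. a x \<partial>std_gaussian n) * (\<integral>x. b x \<partial>std_gaussian n)"
proof -
  have [measurable]: "a \<in> borel_measurable (std_gaussian n)" "b \<in> borel_measurable (std_gaussian n)"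
    using a b by auto
  show int: "integrable (std_gaussian n \<Otimes>\<^sub>M std_gaussian n) (\<lambda>(x, y). a x * b y)"
    by (rule GG.Fubini_integrable) (use a b in \<open>auto simp: abs_mult\<close>)
  show "(\<integral>p. (\<lambda>(x, y). a x * b y) p \<partial>(std_gaussian n \<Otimes>\<^sub>M std_gaussian n))
       = (\<integral>x. a x \<partial>std_gaussian n) * (\<integral>x. b x \<partial>std_gaussian n)"
    by (subst GG.integral_fst'[OF int, symmetric]) simp
qed

text \<open>The correlated law has the product of Mehler kernels as density, and the Mehler series
  separates the two vectors, so each term integrates to a product of Hermite coefficients.\<close>

lemma corr_law_expansion:
  assumes f: "square_integrable n f" and g: "square_integrable n g" and r: "\<bar>r\<bar> < 1 / 8"
  shows "(\<lambda>k. degree_part n k f g * r ^ k) sums (\<integral>p. f (fst p) * g (snd p) \<partial>corr_law n r)"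
proof -
  let ?G = "std_gaussian n"
  let ?GG = "?G \<Otimes>\<^sub>M ?G"
  let ?h = "hermite_multi n"
  have [measurable]: "f \<in> borel_measurable ?G" "g \<in> borel_measurable ?G"
    using f g by (auto simp: square_integrable_def)
  define u where "u k p = (\<Sum>\<alpha>\<in>multi_indices n k. (f (fst p) * ?h \<alpha> (fst p)) * (g (snd p) * ?h \<alpha> (snd p)) * r ^ k)" for k p
  have prod_int: "integrable ?GG (\<lambda>p. (f (fst p) * ?h \<alpha> (fst p)) * (g (snd p) * ?h \<alpha> (snd p)))"
    and prod_eq: "(\<integral>p. (f (fst p) * ?h \<alpha> (fst p)) * (g (snd p) * ?h \<alpha> (snd p)) \<partial>?GG)
      = hermite_coeff n f \<alpha> * hermite_coeff n g \<alpha>"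
    and prod_abs: "(\<integral>p. \<bar>(f (fst p) * ?h \<alpha> (fst p)) * (g (snd p) * ?h \<alpha> (snd p))\<bar> \<partial>?GG)
      \<le> (sq_mass n f + 1) / 2 * ((sq_mass n g + 1) / 2)"
    if \<alpha>: "\<alpha> \<in> multi_indices n k" for \<alpha> k
  proof -
    note F = integrable_mult_hermite_multi[OF f \<alpha>] and G = integrable_mult_hermite_multi[OF g \<alpha>]
    show "integrable ?GG (\<lambda>p. (f (fst p) * ?h \<alpha> (fst p)) * (g (snd p) * ?h \<alpha> (snd p)))"
      using integrable_pair_product(1)[OF F(1) G(1)] by (simp add: case_prod_beta')
    show "(\<integral>p. (f (fst p) * ?h \<alpha> (fst p)) * (g (snd p) * ?h \<alpha> (snd p)) \<partial>?GG)
      = hermite_coeff n f \<alpha> * hermite_coeff n g \<alpha>"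
      using integrable_pair_product(2)[OF F(1) G(1)]
      by (simp add: case_prod_beta' hermite_coeff_def gauss_expectation_def)
    have "(\<integral>p. \<bar>(f (fst p) * ?h \<alpha> (fst p)) * (g (snd p) * ?h \<alpha> (snd p))\<bar> \<partial>?GG)
       = (\<integral>x. \<bar>f x * ?h \<alpha> x\<bar> \<partial>?G) * (\<integral>x. \<bar>g x * ?h \<alpha> x\<bar> \<partial>?G)"
      using integrable_pair_product(2)[OF integrable_abs[OF F(1)] integrable_abs[OF G(1)]]
      by (simp add: case_prod_beta' abs_mult)
    also have "\<dots> \<le> (sq_mass n f + 1) / 2 * ((sq_mass n g + 1) / 2)"
      using sq_mass_nonneg[of n f] by (intro mult_mono F(2) G(2)) (auto intro!: integral_nonneg_AE)
    finally show "(\<integral>p. \<bar>(f (fst p) * ?h \<alpha> (fst p)) * (g (snd p) * ?h \<alpha> (snd p))\<bar> \<partial>?GG)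
      \<le> (sq_mass n f + 1) / 2 * ((sq_mass n g + 1) / 2)" .
  qed
  have u_int: "integrable ?GG (u k)" for k
    unfolding u_def[abs_def] using prod_int by (intro Bochner_Integration.integrable_sum integrable_mult_left) auto
  have u_eq: "(\<integral>p. u k p \<partial>?GG) = degree_part n k f g * r ^ k" for k
    unfolding u_def degree_part_def using prod_int prod_eq
    by (subst Bochner_Integration.integral_sum) (auto simp: sum_distrib_right)
  define W where "W = (sq_mass n f + 1) / 2 * ((sq_mass n g + 1) / 2)"
  have u_abs: "(\<integral>p. norm (u k p) \<partial>?GG) \<le> W * (real (card (multi_indices n k)) * \<bar>r\<bar> ^ k)" for k
  proof -
    have "(\<integral>p. norm (u k p) \<partial>?GG)
      \<le> (\<integral>p. (\<Sum>\<alpha>\<in>multi_indices n k. \<bar>(f (fst p) * ?h \<alpha> (fst p)) * (g (snd p) * ?h \<alpha> (snd p))\<bar> * \<bar>r\<bar> ^ k) \<partial>?GG)"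
    proof (rule integral_mono)
      show "integrable ?GG (\<lambda>p. norm (u k p))" using u_int by (rule integrable_norm)
      show "integrable ?GG (\<lambda>p. \<Sum>\<alpha>\<in>multi_indices n k. \<bar>(f (fst p) * ?h \<alpha> (fst p)) * (g (snd p) * ?h \<alpha> (snd p))\<bar> * \<bar>r\<bar> ^ k)"
        using prod_int by (intro Bochner_Integration.integrable_sum integrable_mult_left integrable_abs) auto
      show "norm (u k p) \<le> (\<Sum>\<alpha>\<in>multi_indices n k. \<bar>(f (fst p) * ?h \<alpha> (fst p)) * (g (snd p) * ?h \<alpha> (snd p))\<bar> * \<bar>r\<bar> ^ k)" for p
        unfolding u_def real_norm_def by (intro order_trans[OF sum_abs] sum_mono) (simp add: abs_mult power_abs)
    qed
    also have "\<dots> = (\<Sum>\<alpha>\<in>multi_indices n k. (\<integral>p. \<bar>(f (fst p) * ?h \<alpha> (fst p)) * (g (snd p) * ?h \<alpha> (snd p))\<bar> \<partial>?GG) * \<bar>r\<bar> ^ k)"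
      using prod_int by (subst Bochner_Integration.integral_sum) (auto intro: integrable_abs)
    also have "\<dots> \<le> (\<Sum>\<alpha>\<in>multi_indices n k. W * \<bar>r\<bar> ^ k)"
      unfolding W_def using prod_abs by (intro sum_mono mult_right_mono) auto
    finally show ?thesis by (simp add: mult_ac)
  qed
  \<comment> \<open>With all coefficients equal to 1 the product series counts multi-indices, which
    makes the bounds \<open>u_abs\<close> summable.\<close>
  have "summable (\<lambda>k. \<bar>(\<Sum>\<alpha>\<in>multi_indices n k. \<Prod>i<n. 1) * r ^ k\<bar>)"
    using r by (intro prod_power_series(1)[where c = "\<lambda>_ _. 1"]) (auto simp: power_abs intro!: summable_geometric)
  then have card_sum: "summable (\<lambda>k. W * (real (card (multi_indices n k)) * \<bar>r\<bar> ^ k))"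
    by (intro summable_mult) (simp add: abs_mult power_abs)
  have u_fact: "u k p = f (fst p) * g (snd p) * ((\<Sum>\<alpha>\<in>multi_indices n k. \<Prod>i<n. hermite (\<alpha> i) (fst p i) * hermite (\<alpha> i) (snd p i)) * r ^ k)" for k p
    unfolding u_def hermite_multi_def prod.distrib by (simp add: sum_distrib_left sum_distrib_right mult_ac)
  have ser: "summable (\<lambda>k. \<bar>hermite k x * hermite k y * r ^ k\<bar>)" for x y
    by (rule abs_summable_mehler[OF r])
  have u_pt: "summable (\<lambda>k. norm (u k p))" for p
    unfolding u_fact real_norm_def abs_mult[of "f (fst p) * g (snd p)"]
    using prod_power_series(1)[of n "\<lambda>i k. hermite k (fst p i) * hermite k (snd p i)" r] ser
    by (intro summable_mult) simp
  have u_sum: "(\<Sum>k. u k p) = f (fst p) * g (snd p) * (\<Prod>i<n. mehler_kernel r (fst p i) (snd p i))" for p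
  proof -
    have "(\<lambda>k. (\<Sum>\<alpha>\<in>multi_indices n k. \<Prod>i<n. hermite (\<alpha> i) (fst p i) * hermite (\<alpha> i) (snd p i)) * r ^ k)
        sums (\<Prod>i<n. mehler_kernel r (fst p i) (snd p i))"
      using prod_power_series(2)[of n "\<lambda>i k. hermite k (fst p i) * hermite k (snd p i)" r] ser mehler_sums[OF r]
      by (simp add: sums_iff)
    then show ?thesis unfolding u_fact by (intro sums_unique[symmetric] sums_mult)
  qed
  have "(\<lambda>k. \<integral>p. u k p \<partial>?GG) sums (\<integral>p. (\<Sum>k. u k p) \<partial>?GG)"
    by (rule sums_integral[OF u_int])
      (use u_pt u_abs in \<open>auto intro!: summable_comparison_test[OF _ card_sum] exI[of _ 0] integral_nonneg_AE\<close>)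
  moreover have "(\<integral>p. (\<Sum>k. u k p) \<partial>?GG) = (\<integral>p. f (fst p) * g (snd p) \<partial>corr_law n r)"
  proof -
    have [measurable]: "(\<lambda>p. \<Prod>i<n. mehler_kernel r (fst p i) (snd p i)) \<in> borel_measurable ?GG"
      unfolding mehler_kernel_def by measurable
    have nn: "mehler_kernel r x y \<ge> 0" for x y
      using r by (simp add: mehler_kernel_def abs_square_le_1)
    have "(\<integral>p. f (fst p) * g (snd p) \<partial>corr_law n r)
       = (\<integral>p. (\<Prod>i<n. mehler_kernel r (fst p i) (snd p i)) *\<^sub>R (f (fst p) * g (snd p)) \<partial>?GG)"
      using r by (subst corr_law_eq_density, simp, unfold case_prod_beta', subst integral_density)
        (auto intro!: prod_nonneg nn)
    then show ?thesis unfolding u_sum by (simp add: mult_ac)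
  qed
  ultimately show ?thesis by (simp add: u_eq)
qed

text \<open>The law shifted by \<open>t * v\<close> has a product density whose factors are the
  Hermite generating functions at \<open>t * v i\<close>. Expanding it turns the mean of the shifted
  function into a power series in t with Hermite coefficients. The factor 1 in \<open>sh\<close>
  matches the affine map with s = 1.\<close>

lemma gauss_shift_expansion:
  fixes v :: "nat \<Rightarrow> real"
  assumes f: "square_integrable n f"
  defines "sh t \<equiv> (\<lambda>x. \<lambda>i\<in>{..<n}. t * v i + 1 * x i)"
  shows "integrable (std_gaussian n) (\<lambda>x. f (sh t x))"
    and "(\<lambda>k. (\<Sum>\<alpha>\<in>multi_indices n k. hermite_coeff n f \<alpha> * (\<Prod>i<n. v i ^ \<alpha> i / sqrt (fact (\<alpha> i)))) * t ^ k)
        sums (\<integral>x. f (sh t x) \<partial>std_gaussian n)"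
proof -
  let ?G = "std_gaussian n"
  let ?h = "hermite_multi n"
  define d where "d \<alpha> = (\<Prod>i<n. v i ^ \<alpha> i / sqrt (fact (\<alpha> i)))" for \<alpha> :: "nat \<Rightarrow> nat"
  have [measurable]: "f \<in> borel_measurable ?G" using f by (auto simp: square_integrable_def)
  have [measurable]: "sh t \<in> ?G \<rightarrow>\<^sub>M ?G"
    unfolding sh_def by (intro measurable_std_gaussian_restrict) measurable
  define u where "u k x = (\<Sum>\<alpha>\<in>multi_indices n k. (f x * ?h \<alpha> x) * d \<alpha> * t ^ k)" for k x
  have u_int: "integrable ?G (u k)" for k
    unfolding u_def[abs_def] using integrable_mult_hermite_multi[OF f]
    by (intro Bochner_Integration.integrable_sum integrable_mult_left) auto
  have u_eq: "(\<integral>x. u k x \<partial>?G) = (\<Sum>\<alpha>\<in>multi_indices n k. hermite_coeff n f \<alpha> * d \<alpha>) * t ^ k" for k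
    unfolding u_def using integrable_mult_hermite_multi[OF f]
    by (subst Bochner_Integration.integral_sum) (auto simp: sum_distrib_right hermite_coeff_def gauss_expectation_def)
  define W where "W = (sq_mass n f + 1) / 2"
  have d_abs: "\<bar>d \<alpha>\<bar> = (\<Prod>i<n. \<bar>v i\<bar> ^ \<alpha> i / sqrt (fact (\<alpha> i)))" for \<alpha>
    by (simp add: d_def abs_prod abs_divide power_abs)
  have u_abs: "(\<integral>x. norm (u k x) \<partial>?G) \<le> W * ((\<Sum>\<alpha>\<in>multi_indices n k. \<bar>d \<alpha>\<bar>) * \<bar>t\<bar> ^ k)" for k
  proof -
    have "(\<integral>x. norm (u k x) \<partial>?G) \<le> (\<integral>x. (\<Sum>\<alpha>\<in>multi_indices n k. \<bar>f x * ?h \<alpha> x\<bar> * (\<bar>d \<alpha>\<bar> * \<bar>t\<bar> ^ k)) \<partial>?G)"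
    proof (rule integral_mono)
      show "integrable ?G (\<lambda>x. norm (u k x))" using u_int by (rule integrable_norm)
      show "integrable ?G (\<lambda>x. \<Sum>\<alpha>\<in>multi_indices n k. \<bar>f x * ?h \<alpha> x\<bar> * (\<bar>d \<alpha>\<bar> * \<bar>t\<bar> ^ k))"
        using integrable_mult_hermite_multi[OF f]
        by (intro Bochner_Integration.integrable_sum integrable_mult_left integrable_abs) auto
      show "norm (u k x) \<le> (\<Sum>\<alpha>\<in>multi_indices n k. \<bar>f x * ?h \<alpha> x\<bar> * (\<bar>d \<alpha>\<bar> * \<bar>t\<bar> ^ k))" for x
        unfolding u_def real_norm_def by (intro order_trans[OF sum_abs] sum_mono) (simp add: abs_mult power_abs)
    qed
    also have "\<dots> = (\<Sum>\<alpha>\<in>multi_indices n k. (\<integral>x. \<bar>f x * ?h \<alpha> x\<bar> \<partial>?G) * (\<bar>d \<alpha>\<bar> * \<bar>t\<bar> ^ k))"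
      using integrable_mult_hermite_multi[OF f]
      by (subst Bochner_Integration.integral_sum) (auto intro: integrable_abs)
    also have "\<dots> \<le> (\<Sum>\<alpha>\<in>multi_indices n k. W * (\<bar>d \<alpha>\<bar> * \<bar>t\<bar> ^ k))"
      unfolding W_def using integrable_mult_hermite_multi[OF f] by (intro sum_mono mult_right_mono) auto
    finally show ?thesis by (simp add: sum_distrib_left sum_distrib_right)
  qed
  have "summable (\<lambda>k. \<bar>(\<Sum>\<alpha>\<in>multi_indices n k. \<Prod>i<n. \<bar>v i\<bar> ^ \<alpha> i / sqrt (fact (\<alpha> i))) * t ^ k\<bar>)"
  proof (rule prod_power_series(1)[where c = "\<lambda>i k. \<bar>v i\<bar> ^ k / sqrt (fact k)"])
    fix i
    show "summable (\<lambda>k. \<bar>\<bar>v i\<bar> ^ k / sqrt (fact k) * t ^ k\<bar>)"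
      using summable_power_div_sqrt_fact[of "\<bar>v i\<bar> * \<bar>t\<bar>"] by (simp add: abs_mult power_abs power_mult_distrib)
  qed
  then have d_sum: "summable (\<lambda>k. W * ((\<Sum>\<alpha>\<in>multi_indices n k. \<bar>d \<alpha>\<bar>) * \<bar>t\<bar> ^ k))"
    unfolding d_abs[symmetric] by (intro summable_mult) (simp add: abs_mult power_abs sum_nonneg)
  have u_fact: "u k x = f x * ((\<Sum>\<alpha>\<in>multi_indices n k. \<Prod>i<n. hermite (\<alpha> i) (x i) * (v i ^ \<alpha> i / sqrt (fact (\<alpha> i)))) * t ^ k)" for k x
    unfolding u_def hermite_multi_def d_def prod.distrib by (simp add: sum_distrib_left sum_distrib_right mult_ac)
  have coef: "hermite k y * (v i ^ k / sqrt (fact k)) * t ^ k = hermite k y * ((t * v i) ^ k / sqrt (fact k))" for k y i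
    by (simp add: power_mult_distrib)
  have ser: "summable (\<lambda>k. \<bar>hermite k y * (v i ^ k / sqrt (fact k)) * t ^ k\<bar>)" for y i
    unfolding coef by (rule abs_summable_hermite_generating)
  have u_pt: "summable (\<lambda>k. norm (u k x))" for x
    unfolding u_fact real_norm_def abs_mult[of "f x"]
    using prod_power_series(1)[of n "\<lambda>i k. hermite k (x i) * (v i ^ k / sqrt (fact k))" t] ser
    by (intro summable_mult) simp
  have u_sum: "(\<Sum>k. u k x) = (\<Prod>i<n. affine_density (t * v i) 1 (x i)) * f x" for x
  proof -
    have one: "(\<Sum>k. hermite k (x i) * (v i ^ k / sqrt (fact k)) * t ^ k) = affine_density (t * v i) 1 (x i)" for i
    proof -
      have "(\<Sum>k. hermite k (x i) * (v i ^ k / sqrt (fact k)) * t ^ k) = exp (x i * (t * v i) - (t * v i)\<^sup>2 / 2)"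
        unfolding coef by (rule sums_unique[symmetric, OF hermite_generating])
      also have "x i * (t * v i) - (t * v i)\<^sup>2 / 2 = (x i)\<^sup>2 / 2 - (x i - t * v i)\<^sup>2 / (2 * 1\<^sup>2)"
        by (simp add: power2_diff field_simps)
      finally show ?thesis by (simp add: affine_density_def)
    qed
    have "(\<lambda>k. (\<Sum>\<alpha>\<in>multi_indices n k. \<Prod>i<n. hermite (\<alpha> i) (x i) * (v i ^ \<alpha> i / sqrt (fact (\<alpha> i)))) * t ^ k)
        sums (\<Prod>i<n. affine_density (t * v i) 1 (x i))"
      using prod_power_series(2)[of n "\<lambda>i k. hermite k (x i) * (v i ^ k / sqrt (fact k))" t] ser
      by (simp only: one)
    then show ?thesis unfolding u_fact
      by (subst mult.commute[of _ "f x"]) (intro sums_unique[symmetric] sums_mult)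
  qed
  have S: "AE x in ?G. summable (\<lambda>k. norm (u k x))" "summable (\<lambda>k. \<integral>x. norm (u k x) \<partial>?G)"
    using u_pt u_abs by (auto intro!: summable_comparison_test[OF _ d_sum] exI[of _ 0] integral_nonneg_AE)
  have sm: "(\<lambda>k. \<integral>x. u k x \<partial>?G) sums (\<integral>x. (\<Sum>k. u k x) \<partial>?G)"
    by (rule sums_integral[OF u_int S])
  have si: "integrable ?G (\<lambda>x. \<Sum>k. u k x)"
    by (rule integrable_suminf[OF u_int S])
  have D: "distr ?G ?G (sh t) = density ?G (\<lambda>y. ennreal (\<Prod>i<n. affine_density (t * v i) 1 (y i)))"
    unfolding sh_def by (rule distr_std_gaussian_affine) simp
  have nn: "(\<Prod>i<n. affine_density (t * v i) 1 (y i)) \<ge> 0" for y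
    by (intro prod_nonneg) (simp add: affine_density_nonneg)
  have [measurable]: "(\<lambda>y. \<Prod>i<n. affine_density (t * v i) 1 (y i)) \<in> borel_measurable ?G"
    by measurable
  have "integrable (distr ?G ?G (sh t)) f"
    unfolding D using si nn by (subst integrable_density) (auto simp: u_sum)
  then show "integrable ?G (\<lambda>x. f (sh t x))"
    by (subst (asm) integrable_distr_eq) auto
  have "(\<integral>x. f (sh t x) \<partial>?G) = (\<integral>x. f x \<partial>distr ?G ?G (sh t))"
    by (subst integral_distr) auto
  also have "\<dots> = (\<integral>x. (\<Sum>k. u k x) \<partial>?G)"
    unfolding D using nn by (subst integral_density) (auto simp: u_sum)
  finally show "(\<lambda>k. (\<Sum>\<alpha>\<in>multi_indices n k. hermite_coeff n f \<alpha> * (\<Prod>i<n. v i ^ \<alpha> i / sqrt (fact (\<alpha> i)))) * t ^ k)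
        sums (\<integral>x. f (sh t x) \<partial>?G)"
    using sm by (simp add: u_eq d_def)
qed

end

section \<open>Monotonicity of the correlation\<close>

lemma pair_index_commute: "pair_index n i j = pair_index n j i"
  by (auto simp: pair_index_def fun_eq_iff)

lemma prod_pair_index:
  fixes v :: "nat \<Rightarrow> real"
  assumes "i \<le> j" "j < n"
  shows "(\<Prod>k<n. v k ^ pair_index n i j k / sqrt (fact (pair_index n i j k)))
       = v i * v j / (if i = j then sqrt 2 else 1)"
proof (cases "i = j")
  case True
  have "(\<Prod>k<n. v k ^ pair_index n i j k / sqrt (fact (pair_index n i j k)))
      = (\<Prod>k<n. if k = j then v j * v j / sqrt 2 else 1)"
    using True by (intro prod.cong refl) (auto simp: pair_index_def power2_eq_square numeral_2_eq_2)
  then show ?thesis using True assms by simp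
next
  case False
  have "(\<Prod>k<n. v k ^ pair_index n i j k / sqrt (fact (pair_index n i j k)))
      = (\<Prod>k<n. (if k = i then v i else 1) * (if k = j then v j else 1))"
    using False by (intro prod.cong refl) (auto simp: pair_index_def)
  then show ?thesis using False assms by (simp add: prod.distrib)
qed

lemma convex_fun_section:
  assumes "convex_fun n f"
  shows "convex_fun n (\<lambda>h. f (lincomb n a w b h))"
  unfolding convex_fun_def
proof (intro ballI allI impI)
  fix x y :: "nat \<Rightarrow> real" and u v :: real
  assume uv: "0 \<le> u" "0 \<le> v" "u + v = 1"
  have "lincomb n a w b (\<lambda>i\<in>{..<n}. u * x i + v * y i)
      = (\<lambda>i\<in>{..<n}. u * lincomb n a w b x i + v * lincomb n a w b y i)"
  proof (rule PiE_UNIV_eqI[of _ n])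
    fix i assume "i < n"
    moreover have "a * p + b * (u * q + v * r) = u * (a * p + b * q) + v * (a * p + b * r)" for p q r
      using uv(3) by algebra
    ultimately show "lincomb n a w b (\<lambda>i\<in>{..<n}. u * x i + v * y i) i
      = (\<lambda>i\<in>{..<n}. u * lincomb n a w b x i + v * lincomb n a w b y i) i"
      by (simp add: lincomb_apply)
  qed auto
  then show "f (lincomb n a w b (\<lambda>i\<in>{..<n}. u * x i + v * y i)) \<le> u * f (lincomb n a w b x) + v * f (lincomb n a w b y)"
    using assms uv lincomb_in unfolding convex_fun_def by simp
qed

text \<open>Midpoint convexity of f passes to the mean of f shifted by \<open>t * v\<close> as a
  function of t, whose quadratic coefficient is this form. It stands for half the averaged Hessian
  in direction v, with shifts of the Gaussian in place of derivatives of f.\<close>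

lemma degree_two_form_nonneg:
  assumes f: "square_integrable n f" and conv: "convex_fun n f"
  shows "(\<Sum>\<alpha>\<in>multi_indices n 2. hermite_coeff n f \<alpha> * (\<Prod>i<n. v i ^ \<alpha> i / sqrt (fact (\<alpha> i)))) \<ge> 0"
proof (rule second_coeff_nonneg[where S = "\<lambda>t. \<integral>x. f (\<lambda>i\<in>{..<n}. t * v i + 1 * x i) \<partial>std_gaussian n"])
  define sh where "sh t x = (\<lambda>i\<in>{..<n}. t * v i + 1 * x i)" for t x
  show "(\<lambda>k. (\<Sum>\<alpha>\<in>multi_indices n k. hermite_coeff n f \<alpha> * (\<Prod>i<n. v i ^ \<alpha> i / sqrt (fact (\<alpha> i)))) * t ^ k)
    sums (\<integral>x. f (\<lambda>i\<in>{..<n}. t * v i + 1 * x i) \<partial>std_gaussian n)" for t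
    by (rule gauss_shift_expansion[OF f])
  fix t
  have int: "integrable (std_gaussian n) (\<lambda>x. f (sh t x))" for t
    unfolding sh_def by (rule gauss_shift_expansion[OF f])
  have "2 * f (sh 0 x) \<le> f (sh t x) + f (sh (- t) x)" for x
  proof -
    have "sh 0 x = (\<lambda>i\<in>{..<n}. 1 / 2 * sh t x i + 1 / 2 * sh (- t) x i)"
      by (auto simp: sh_def fun_eq_iff field_simps)
    moreover have "f (\<lambda>i\<in>{..<n}. 1 / 2 * sh t x i + 1 / 2 * sh (- t) x i) \<le> 1 / 2 * f (sh t x) + 1 / 2 * f (sh (- t) x)"
      using conv[unfolded convex_fun_def, rule_format, of "sh t x" "sh (- t) x" "1/2" "1/2"] by (simp add: sh_def)
    ultimately show ?thesis by simp
  qed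
  then have "(\<integral>x. 2 * f (sh 0 x) \<partial>std_gaussian n) \<le> (\<integral>x. f (sh t x) + f (sh (- t) x) \<partial>std_gaussian n)"
    using int by (intro integral_mono) auto
  then have "2 * (\<integral>x. f (sh 0 x) \<partial>std_gaussian n)
    \<le> (\<integral>x. f (sh t x) \<partial>std_gaussian n) + (\<integral>x. f (sh (- t) x) \<partial>std_gaussian n)"
    using int by simp
  then show "2 * (\<integral>x. f (\<lambda>i\<in>{..<n}. 0 * v i + 1 * x i) \<partial>std_gaussian n)
    \<le> (\<integral>x. f (\<lambda>i\<in>{..<n}. t * v i + 1 * x i) \<partial>std_gaussian n)
     + (\<integral>x. f (\<lambda>i\<in>{..<n}. - t * v i + 1 * x i) \<partial>std_gaussian n)"
    unfolding sh_def .
qed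

lemma degree_part_2_nonneg:
  assumes f: "square_integrable n f" "convex_fun n f" and g: "square_integrable n g" "convex_fun n g"
  shows "degree_part n 2 f g \<ge> 0"
proof -
  \<comment> \<open>The averaged Hessian. The diagonal factor compensates for the normalisation
    \<open>1 / sqrt (fact 2)\<close> of the Hermite polynomial, and with it the trace of the product
    of the two matrices is twice the degree-two part.\<close>
  define D where "D f i j = hermite_coeff n f (pair_index n i j) * (if i = j then sqrt 2 else 1)" for f i j
  have sym: "D f i j = D f j i" for f i j
    unfolding D_def by (simp add: pair_index_commute)
  have form: "(\<Sum>i<n. \<Sum>j<n. D f i j * (v i * v j)) \<ge> 0" if "square_integrable n f" "convex_fun n f" for f v
  proof -
    have "(\<Sum>i<n. \<Sum>j<n. D f i j * (v i * v j)) = (\<Sum>j<n. 2 * (\<Sum>i<j. D f i j * (v i * v j)) + D f j j * (v j * v j))"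
      using sym by (intro sum_symmetric) (simp add: mult.commute)
    also have "\<dots> = (\<Sum>j<n. \<Sum>i\<le>j. 2 * (hermite_coeff n f (pair_index n i j) * (\<Prod>k<n. v k ^ pair_index n i j k / sqrt (fact (pair_index n i j k)))))"
    proof (intro sum.cong refl)
      fix j assume "j \<in> {..<n}"
      then have p: "(\<Prod>k<n. v k ^ pair_index n i j k / sqrt (fact (pair_index n i j k)))
          = v i * v j / (if i = j then sqrt 2 else 1)" if "i \<le> j" for i
        using that by (intro prod_pair_index) auto
      have "(\<Sum>i\<le>j. 2 * (hermite_coeff n f (pair_index n i j) * (\<Prod>k<n. v k ^ pair_index n i j k / sqrt (fact (pair_index n i j k)))))
        = (\<Sum>i\<le>j. 2 * (hermite_coeff n f (pair_index n i j) * (v i * v j / (if i = j then sqrt 2 else 1))))"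
        using p by simp
      also have "\<dots> = (\<Sum>i<j. 2 * (D f i j * (v i * v j))) + 2 * (hermite_coeff n f (pair_index n j j) * (v j * v j / sqrt 2))"
        by (simp add: D_def flip: lessThan_Suc_atMost)
      also have "2 * (hermite_coeff n f (pair_index n j j) * (v j * v j / sqrt 2)) = D f j j * (v j * v j)"
        by (simp add: D_def field_simps)
      finally show "2 * (\<Sum>i<j. D f i j * (v i * v j)) + D f j j * (v j * v j)
        = (\<Sum>i\<le>j. 2 * (hermite_coeff n f (pair_index n i j) * (\<Prod>k<n. v k ^ pair_index n i j k / sqrt (fact (pair_index n i j k)))))"
        by (simp add: sum_distrib_left)
    qed
    also have "\<dots> = 2 * (\<Sum>\<alpha>\<in>multi_indices n 2. hermite_coeff n f \<alpha> * (\<Prod>i<n. v i ^ \<alpha> i / sqrt (fact (\<alpha> i))))"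
      unfolding sum_multi_indices_2 by (simp add: sum_distrib_left)
    finally show ?thesis using degree_two_form_nonneg[OF that, of v] by simp
  qed
  have "0 \<le> (\<Sum>i<n. \<Sum>j<n. D f i j * D g i j)"
    by (rule psd_trace_nonneg[OF sym sym form[OF f] form[OF g]])
  also have "\<dots> = (\<Sum>j<n. 2 * (\<Sum>i<j. D f i j * D g i j) + D f j j * D g j j)"
    using sym by (intro sum_symmetric) simp
  also have "\<dots> = (\<Sum>j<n. 2 * (\<Sum>i\<le>j. hermite_coeff n f (pair_index n i j) * hermite_coeff n g (pair_index n i j)))"
    by (intro sum.cong refl) (simp add: D_def flip: lessThan_Suc_atMost)
  also have "\<dots> = 2 * degree_part n 2 f g"
    unfolding degree_part_def sum_multi_indices_2 by (simp add: sum_distrib_left)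
  finally show ?thesis by simp
qed

section \<open>Correlated expectations as a function of the correlation\<close>

context
  fixes n :: nat
begin

interpretation G: prob_space "std_gaussian n" by (rule prob_space_std_gaussian)
interpretation GG: pair_sigma_finite "std_gaussian n" "std_gaussian n" ..
interpretation GGG: pair_sigma_finite "std_gaussian n" "std_gaussian n \<Otimes>\<^sub>M std_gaussian n" ..

lemma integrable_lincomb:
  assumes f: "integrable (std_gaussian n) (f :: _ \<Rightarrow> real)" and cs: "c\<^sup>2 + s\<^sup>2 = 1" "s \<noteq> 0"
  shows "integrable (std_gaussian n \<Otimes>\<^sub>M std_gaussian n) (\<lambda>p. f (lincomb n c (fst p) s (snd p)))"
    and "(\<integral>p. f (lincomb n c (fst p) s (snd p)) \<partial>(std_gaussian n \<Otimes>\<^sub>M std_gaussian n)) = (\<integral>x. f x \<partial>std_gaussian n)"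
proof -
  let ?G = "std_gaussian n"
  let ?GG = "?G \<Otimes>\<^sub>M ?G"
  have [measurable]: "f \<in> borel_measurable ?G" using f by auto
  have D: "distr ?GG ?G (\<lambda>p. lincomb n c (fst p) s (snd p)) = ?G"
    using distr_gauss_lincomb[OF cs, of n] by (simp add: case_prod_beta')
  have "integrable (distr ?GG ?G (\<lambda>p. lincomb n c (fst p) s (snd p))) f" unfolding D by (rule f)
  then show "integrable ?GG (\<lambda>p. f (lincomb n c (fst p) s (snd p)))"
    by (subst (asm) integrable_distr_eq) auto
  have "(\<integral>p. f (lincomb n c (fst p) s (snd p)) \<partial>?GG) = (\<integral>x. f x \<partial>distr ?GG ?G (\<lambda>p. lincomb n c (fst p) s (snd p)))"
    by (subst integral_distr) auto
  then show "(\<integral>p. f (lincomb n c (fst p) s (snd p)) \<partial>?GG) = (\<integral>x. f x \<partial>?G)" unfolding D .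
qed

lemma integrable_fst_gaussian:
  assumes f: "integrable (std_gaussian n) (f :: _ \<Rightarrow> real)"
  shows "integrable (std_gaussian n \<Otimes>\<^sub>M std_gaussian n) (\<lambda>p. f (fst p))"
    and "(\<integral>p. f (fst p) \<partial>(std_gaussian n \<Otimes>\<^sub>M std_gaussian n)) = (\<integral>x. f x \<partial>std_gaussian n)"
  using integrable_pair_product[OF f, of "\<lambda>_. 1"] by (simp_all add: case_prod_beta' G.prob_space)

lemma unit_sqrt:
  assumes "\<bar>c\<bar> < 1"
  shows "c\<^sup>2 + (sqrt (1 - c\<^sup>2))\<^sup>2 = 1" "sqrt (1 - c\<^sup>2) \<noteq> 0"
  using assms by (auto simp: abs_square_le_1 abs_square_less_1 power2_eq_1_iff)

lemma integrable_corr_law: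
  assumes f: "square_integrable n f" and g: "square_integrable n g" and c: "\<bar>c\<bar> < 1"
  shows "integrable (corr_law n c) (\<lambda>p. f (fst p) * g (snd p))"
proof -
  have [measurable]: "f \<in> borel_measurable (std_gaussian n)" "g \<in> borel_measurable (std_gaussian n)"
    and sq: "integrable (std_gaussian n) (\<lambda>x. (f x)\<^sup>2)" "integrable (std_gaussian n) (\<lambda>x. (g x)\<^sup>2)"
    using f g by (auto simp: square_integrable_def)
  have "integrable (corr_law n c) (\<lambda>p. (f (fst p))\<^sup>2)"
    unfolding corr_law_def using integrable_fst_gaussian(1)[OF sq(1)]
    by (subst integrable_distr_eq) (auto simp: case_prod_beta')
  moreover have "integrable (corr_law n c) (\<lambda>p. (g (snd p))\<^sup>2)"
    unfolding corr_law_def using integrable_lincomb(1)[OF sq(2) unit_sqrt[OF c]]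
    by (subst integrable_distr_eq) (auto simp: case_prod_beta')
  ultimately show ?thesis
    by (intro integrable_mult_squares) measurable
qed

definition correlation :: "((nat \<Rightarrow> real) \<Rightarrow> real) \<Rightarrow> ((nat \<Rightarrow> real) \<Rightarrow> real) \<Rightarrow> real \<Rightarrow> real" where
  "correlation f g c = (\<integral>p. f (fst p) * g (snd p) \<partial>corr_law n c)"

lemma correlation_eq:
  assumes [measurable]: "f \<in> borel_measurable (std_gaussian n)" "g \<in> borel_measurable (std_gaussian n)"
  shows "correlation f g c = (\<integral>p. f (fst p) * g (lincomb n c (fst p) (sqrt (1 - c\<^sup>2)) (snd p)) \<partial>(std_gaussian n \<Otimes>\<^sub>M std_gaussian n))"
  unfolding correlation_def corr_law_def by (subst integral_distr) (auto simp: case_prod_beta')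

text \<open>Fubini's theorem for the square of f. The sections are controlled only for almost every
  w; the integrability of their masses later provides a dominating function.\<close>

lemma section_properties:
  assumes f: "square_integrable n f" and cs: "c\<^sup>2 + s\<^sup>2 = 1" "s \<noteq> 0"
  shows "AE w in std_gaussian n. square_integrable n (\<lambda>h. f (lincomb n c w s h))"
    and "integrable (std_gaussian n) (\<lambda>w. sq_mass n (\<lambda>h. f (lincomb n c w s h)))"
proof -
  have [measurable]: "f \<in> borel_measurable (std_gaussian n)" and sq: "integrable (std_gaussian n) (\<lambda>x. (f x)\<^sup>2)"
    using f by (auto simp: square_integrable_def)
  note I = integrable_lincomb(1)[OF sq cs]
  have "AE w in std_gaussian n. integrable (std_gaussian n) (\<lambda>h. (f (lincomb n c w s h))\<^sup>2)"
    using GG.AE_integrable_fst'[OF I] by simp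
  then show "AE w in std_gaussian n. square_integrable n (\<lambda>h. f (lincomb n c w s h))"
    using AE_space by eventually_elim (auto simp: square_integrable_def)
  show "integrable (std_gaussian n) (\<lambda>w. sq_mass n (\<lambda>h. f (lincomb n c w s h)))"
    using GG.integrable_fst'[OF I] by (simp add: sq_mass_def)
qed

text \<open>For almost every common component w, the expansion at correlation 0 applies to the two
  sections. The mean \<open>B w\<close> of the section masses bounds all coefficients at once, so
  \<open>B w * \<bar>r\<bar> ^ k\<close> dominates the series and integration over w can be done
  term by term.\<close>

lemma correlation_local_expansion:
  assumes f: "square_integrable n f" and g: "square_integrable n g"
    and \<rho>: "0 \<le> \<rho>" "\<rho> < 1" and r: "\<bar>r\<bar> < 1 / 8"
  defines "sec \<equiv> (\<lambda>f w h. f (lincomb n (sqrt \<rho>) w (sqrt (1 - \<rho>)) h))"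
  shows "(\<lambda>k. (\<integral>w. degree_part n k (sec f w) (sec g w) \<partial>std_gaussian n) * r ^ k) sums correlation f g (\<rho> + (1 - \<rho>) * r)"
proof -
  let ?G = "std_gaussian n"
  let ?GG = "?G \<Otimes>\<^sub>M ?G"
  define \<sigma> \<tau> q c where "\<sigma> = sqrt \<rho>" and "\<tau> = sqrt (1 - \<rho>)" and "q = sqrt (1 - r\<^sup>2)"
    and "c = \<rho> + (1 - \<rho>) * r"
  have [measurable]: "f \<in> borel_measurable ?G" "g \<in> borel_measurable ?G"
    using f g by (auto simp: square_integrable_def)
  have cs: "\<sigma>\<^sup>2 + \<tau>\<^sup>2 = 1" "\<tau> \<noteq> 0" using \<rho> by (auto simp: \<sigma>_def \<tau>_def)
  have sec_def': "sec f w = (\<lambda>h. f (lincomb n \<sigma> w \<tau> h))" for f :: "(nat \<Rightarrow> real) \<Rightarrow> real" and w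
    by (simp add: sec_def \<sigma>_def \<tau>_def)
  have c1: "\<bar>c\<bar> < 1"
  proof -
    have "(1 - \<rho>) * \<bar>r\<bar> < (1 - \<rho>) * 1" using \<rho> r by (intro mult_strict_left_mono) auto
    moreover have "\<bar>(1 - \<rho>) * r\<bar> = (1 - \<rho>) * \<bar>r\<bar>" using \<rho> by (simp add: abs_mult)
    ultimately have "\<bar>(1 - \<rho>) * r\<bar> < 1 - \<rho>" by simp
    moreover have "\<bar>c\<bar> \<le> \<bar>\<rho>\<bar> + \<bar>(1 - \<rho>) * r\<bar>" unfolding c_def by (rule abs_triangle_ineq)
    ultimately show ?thesis using \<rho> by simp
  qed
  define T where "T = (\<lambda>(w, h, z). (lincomb n \<sigma> w \<tau> h, lincomb n \<sigma> w \<tau> (lincomb n r h q z)))"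
  have T [measurable]: "T \<in> ?G \<Otimes>\<^sub>M ?GG \<rightarrow>\<^sub>M ?GG" unfolding T_def by measurable
  have law: "corr_law n c = distr (?G \<Otimes>\<^sub>M ?GG) ?GG T"
    unfolding c_def T_def q_def \<sigma>_def \<tau>_def using corr_law_compose[OF \<rho>, of r n] r by simp
  have int: "integrable (?G \<Otimes>\<^sub>M ?GG) (\<lambda>p. f (fst (T p)) * g (snd (T p)))"
    using integrable_corr_law[OF f g c1] unfolding law by (subst (asm) integrable_distr_eq) auto
  define u where "u k w = degree_part n k (sec f w) (sec g w) * r ^ k" for k w
  have "correlation f g c = (\<integral>p. f (fst (T p)) * g (snd (T p)) \<partial>(?G \<Otimes>\<^sub>M ?GG))"
    unfolding correlation_def law by (subst integral_distr) auto
  also have "\<dots> = (\<integral>w. \<integral>p. f (fst (T (w, p))) * g (snd (T (w, p))) \<partial>?GG \<partial>?G)"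
    by (rule GGG.integral_fst'[OF int, symmetric])
  also have "\<dots> = (\<integral>w. \<integral>p. sec f w (fst p) * sec g w (lincomb n r (fst p) q (snd p)) \<partial>?GG \<partial>?G)"
    by (simp add: T_def sec_def' case_prod_beta')
  also have "\<dots> = (\<integral>w. (\<Sum>k. u k w) \<partial>?G)"
  proof (rule integral_cong_AE)
    show "(\<lambda>w. \<integral>p. sec f w (fst p) * sec g w (lincomb n r (fst p) q (snd p)) \<partial>?GG) \<in> borel_measurable ?G"
      unfolding sec_def' by measurable
    show "(\<lambda>w. \<Sum>k. u k w) \<in> borel_measurable ?G"
      unfolding u_def degree_part_def hermite_coeff_def gauss_expectation_def sec_def' by measurable
    show "AE w in ?G. (\<integral>p. sec f w (fst p) * sec g w (lincomb n r (fst p) q (snd p)) \<partial>?GG) = (\<Sum>k. u k w)"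
      using section_properties(1)[OF f cs] section_properties(1)[OF g cs]
    proof eventually_elim
      case (elim w)
      then have sf: "square_integrable n (sec f w)" and sg: "square_integrable n (sec g w)"
        by (simp_all add: sec_def')
      have "(\<lambda>k. u k w) sums correlation (sec f w) (sec g w) r"
        unfolding u_def correlation_def by (rule corr_law_expansion[OF sf sg r])
      then show ?case
        using correlation_eq[of "sec f w" "sec g w" r] sf sg
        by (simp add: sums_iff q_def square_integrable_def)
    qed
  qed
  finally have eq: "correlation f g c = (\<integral>w. (\<Sum>k. u k w) \<partial>?G)" .
  define B where "B w = (sq_mass n (sec f w) + sq_mass n (sec g w)) / 2" for w
  have B: "integrable ?G B"
    unfolding B_def[abs_def] sec_def'
    using section_properties(2)[OF f cs] section_properties(2)[OF g cs] by auto
  have bound: "AE w in ?G. \<forall>k. \<bar>degree_part n k (sec f w) (sec g w)\<bar> \<le> B w"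
    using section_properties(1)[OF f cs] section_properties(1)[OF g cs]
  proof eventually_elim
    case (elim w)
    then show ?case unfolding B_def sec_def' by (intro allI degree_part_bound)
  qed
  have B0: "B w \<ge> 0" for w unfolding B_def by (simp add: sq_mass_nonneg)
  have meas [measurable]: "(\<lambda>w. degree_part n k (sec f w) (sec g w)) \<in> borel_measurable ?G" for k
    unfolding degree_part_def hermite_coeff_def gauss_expectation_def sec_def' by measurable
  have dint: "integrable ?G (\<lambda>w. degree_part n k (sec f w) (sec g w))" for k
    by (rule Bochner_Integration.integrable_bound[OF B meas]) (use bound B0 in \<open>auto elim!: eventually_mono\<close>)
  have u_int: "integrable ?G (u k)" for k
    unfolding u_def[abs_def] using dint by simp
  have geo: "summable (\<lambda>k. \<bar>r\<bar> ^ k)" using r by (intro summable_geometric) auto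
  have "(\<lambda>k. \<integral>w. u k w \<partial>?G) sums (\<integral>w. (\<Sum>k. u k w) \<partial>?G)"
  proof (rule sums_integral[OF u_int])
    show "AE w in ?G. summable (\<lambda>k. norm (u k w))"
      using bound
    proof eventually_elim
      case (elim w)
      have "summable (\<lambda>k. B w * \<bar>r\<bar> ^ k)" by (intro summable_mult geo)
      then show ?case
        by (rule summable_comparison_test[rotated])
          (use elim in \<open>auto simp: u_def abs_mult power_abs intro!: exI[of _ 0] mult_right_mono\<close>)
    qed
    have "summable (\<lambda>k. (\<integral>w. B w \<partial>?G) * \<bar>r\<bar> ^ k)" by (intro summable_mult geo)
    then show "summable (\<lambda>k. \<integral>w. norm (u k w) \<partial>?G)"
    proof (rule summable_comparison_test[rotated], intro exI allI impI)
      fix k :: nat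
      have "(\<integral>w. norm (u k w) \<partial>?G) \<le> (\<integral>w. B w * \<bar>r\<bar> ^ k \<partial>?G)"
      proof (rule integral_mono_AE)
        show "integrable ?G (\<lambda>w. norm (u k w))" by (rule integrable_norm[OF u_int])
        show "integrable ?G (\<lambda>w. B w * \<bar>r\<bar> ^ k)" using B by simp
        show "AE w in ?G. norm (u k w) \<le> B w * \<bar>r\<bar> ^ k"
          using bound by eventually_elim (simp add: u_def abs_mult power_abs mult_right_mono)
      qed
      then show "norm (\<integral>w. norm (u k w) \<partial>?G) \<le> (\<integral>w. B w \<partial>?G) * \<bar>r\<bar> ^ k"
        by (simp add: integral_nonneg_AE)
    qed
  qed
  then show ?thesis unfolding eq[symmetric] by (simp add: u_def c_def)
qed

lemma correlation_expansion:
  assumes "square_integrable n f" "square_integrable n g" "\<bar>r\<bar> < 1 / 8"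
  shows "(\<lambda>k. degree_part n k f g * r ^ k) sums correlation f g r"
  unfolding correlation_def by (rule corr_law_expansion[OF assms])

text \<open>The reflection is the affine map with factor -1, whose density relative to the Gaussian
  is 1; it changes the sign of a Hermite product of odd degree and leaves f fixed.\<close>

lemma hermite_coeff_odd:
  assumes f: "square_integrable n f" and sym: "centrally_symmetric n f"
    and \<alpha>: "\<alpha> \<in> multi_indices n k" and k: "odd k"
  shows "hermite_coeff n f \<alpha> = 0"
proof -
  let ?G = "std_gaussian n"
  have [measurable]: "f \<in> borel_measurable ?G" using f by (auto simp: square_integrable_def)
  define R :: "(nat \<Rightarrow> real) \<Rightarrow> nat \<Rightarrow> real" where "R x = (\<lambda>i\<in>{..<n}. 0 + (- 1) * x i)" for x
  have [measurable]: "R \<in> ?G \<rightarrow>\<^sub>M ?G"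
    unfolding R_def[abs_def] by (intro measurable_std_gaussian_restrict) measurable
  have "affine_density 0 (- 1) y = 1" for y by (simp add: affine_density_def)
  then have D: "distr ?G ?G R = ?G"
    using distr_std_gaussian_affine[of "- 1" n "\<lambda>_. 0"] unfolding R_def[abs_def] by (simp add: density_1)
  have "hermite_coeff n f \<alpha> = (\<integral>x. f x * hermite_multi n \<alpha> x \<partial>distr ?G ?G R)"
    unfolding D hermite_coeff_def gauss_expectation_def ..
  also have "\<dots> = (\<integral>x. f (R x) * hermite_multi n \<alpha> (R x) \<partial>?G)"
    by (subst integral_distr) auto
  also have "\<dots> = (\<integral>x. - (f x * hermite_multi n \<alpha> x) \<partial>?G)"
  proof (rule Bochner_Integration.integral_cong[OF refl])
    fix x assume x: "x \<in> space ?G"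
    have R': "R x = (\<lambda>i\<in>{..<n}. - x i)" by (simp add: R_def)
    have "f (R x) = f x"
      unfolding R' using sym x unfolding centrally_symmetric_def space_std_gaussian by metis
    moreover have "hermite_multi n \<alpha> (R x) = (- 1) ^ k * hermite_multi n \<alpha> x"
    proof -
      have "hermite_multi n \<alpha> (R x) = (\<Prod>i<n. (- 1) ^ \<alpha> i * hermite (\<alpha> i) (x i))"
        unfolding hermite_multi_def R_def by (simp add: hermite_minus)
      then show ?thesis
        using \<alpha> by (simp add: prod.distrib hermite_multi_def multi_indices_def flip: power_sum)
    qed
    ultimately show "f (R x) * hermite_multi n \<alpha> (R x) = - (f x * hermite_multi n \<alpha> x)"
      using k by simp
  qed
  also have "\<dots> = - hermite_coeff n f \<alpha>"
    by (simp add: hermite_coeff_def gauss_expectation_def)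
  finally show ?thesis by simp
qed

lemma degree_part_odd:
  assumes "square_integrable n f" "centrally_symmetric n f" "odd k"
  shows "degree_part n k f g = 0"
  unfolding degree_part_def by (intro sum.neutral) (auto simp: hermite_coeff_odd[OF assms(1,2) _ assms(3)])

lemma correlation_mono:
  assumes f: "square_integrable n f" "centrally_symmetric n f" "convex_fun n f"
    and g: "square_integrable n g" "convex_fun n g"
    and \<rho>: "0 \<le> \<rho>" "\<rho> \<le> \<rho>'" "\<rho>' < 1"
  shows "correlation f g \<rho> \<le> correlation f g \<rho>'"
proof (rule mono_from_local_power_series[OF _ \<rho>])
  fix \<rho> :: real assume \<rho>: "0 \<le> \<rho>" "\<rho> < 1"
  define sec where "sec = (\<lambda>f w h. f (lincomb n (sqrt \<rho>) w (sqrt (1 - \<rho>)) h) :: real)"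
  have cs: "(sqrt \<rho>)\<^sup>2 + (sqrt (1 - \<rho>))\<^sup>2 = 1" "sqrt (1 - \<rho>) \<noteq> 0" using \<rho> by auto
  show "\<exists>c. c 2 \<ge> 0 \<and> (\<rho> = 0 \<longrightarrow> c 1 = 0) \<and>
     (\<forall>r. \<bar>r\<bar> < 1 / 8 \<longrightarrow> (\<lambda>k. c k * r ^ k) sums correlation f g (\<rho> + (1 - \<rho>) * r))"
  \<comment> \<open>At 0 the expansion of f and g themselves is used: the linear coefficient has to
    vanish there, which comes from the symmetry of f, and sections do not inherit this
    symmetry.\<close>
  proof (cases "\<rho> = 0")
    case True
    have "degree_part n 1 f g = 0" using degree_part_odd[OF f(1,2), of 1] by simp
    moreover have "(\<lambda>k. degree_part n k f g * r ^ k) sums correlation f g (\<rho> + (1 - \<rho>) * r)"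
      if "\<bar>r\<bar> < 1 / 8" for r
      using correlation_expansion[OF f(1) g(1) that] True by simp
    ultimately show ?thesis
      using degree_part_2_nonneg[OF f(1,3) g] by (intro exI[of _ "\<lambda>k. degree_part n k f g"]) blast
  next
    case False
    have "AE w in std_gaussian n. 0 \<le> degree_part n 2 (sec f w) (sec g w)"
      using section_properties(1)[OF f(1) cs] section_properties(1)[OF g(1) cs]
      by eventually_elim (auto simp: sec_def intro!: degree_part_2_nonneg convex_fun_section f g)
    then have "0 \<le> (\<integral>w. degree_part n 2 (sec f w) (sec g w) \<partial>std_gaussian n)"
      by (rule integral_nonneg_AE)
    moreover have "(\<lambda>k. (\<integral>w. degree_part n k (sec f w) (sec g w) \<partial>std_gaussian n) * r ^ k)
        sums correlation f g (\<rho> + (1 - \<rho>) * r)" if "\<bar>r\<bar> < 1 / 8" for r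
      unfolding sec_def by (rule correlation_local_expansion[OF f(1) g(1) \<rho> that])
    ultimately show ?thesis
      using False by (intro exI[of _ "\<lambda>k. \<integral>w. degree_part n k (sec f w) (sec g w) \<partial>std_gaussian n"]) blast
  qed
qed

section \<open>The two ends of the correlation range\<close>

lemma correlation_0:
  assumes "square_integrable n f" "square_integrable n g"
  shows "correlation f g 0 = gauss_expectation n f * gauss_expectation n g"
proof -
  have "hermite_multi n (\<lambda>i\<in>{..<n}. 0) x = 1" for x by (simp add: hermite_multi_def)
  then have "degree_part n 0 f g = gauss_expectation n f * gauss_expectation n g"
    by (simp add: degree_part_def multi_indices_deg_0 hermite_coeff_def)
  then show ?thesis
    using correlation_expansion[OF assms, of 0] powser_sums_zero[of "\<lambda>k. degree_part n k f g"]
    by (simp add: sums_iff)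
qed

text \<open>Only the two-dimensional slice spanned by \<open>x\<close> and \<open>z\<close> matters, and there the library's
  continuity theorem for convex functions applies.\<close>

lemma tendsto_convex_lincomb:
  assumes conv: "convex_fun n g" and x: "x \<in> {..<n} \<rightarrow>\<^sub>E UNIV"
    and a: "a \<longlonglongrightarrow> 1" and b: "b \<longlonglongrightarrow> 0"
  shows "(\<lambda>m. g (lincomb n (a m) x (b m) z)) \<longlonglongrightarrow> g x"
proof -
  define H where "H p = g (lincomb n (fst p) x (snd p) z)" for p :: "real \<times> real"
  have "convex_on UNIV H"
  proof (rule convex_onI)
    fix t :: real and p q :: "real \<times> real" assume t: "0 < t" "t < 1"
    have "lincomb n (fst ((1 - t) *\<^sub>R p + t *\<^sub>R q)) x (snd ((1 - t) *\<^sub>R p + t *\<^sub>R q)) z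
        = (\<lambda>i\<in>{..<n}. (1 - t) * lincomb n (fst p) x (snd p) z i + t * lincomb n (fst q) x (snd q) z i)"
      by (auto simp: lincomb_def fun_eq_iff algebra_simps)
    then show "H ((1 - t) *\<^sub>R p + t *\<^sub>R q) \<le> (1 - t) * H p + t * H q"
      using conv t unfolding H_def convex_fun_def by simp
  qed simp
  then have "isCont H (1, 0)"
    using convex_on_continuous[of UNIV H] by (simp add: continuous_on_eq_continuous_at)
  moreover have "(\<lambda>m. (a m, b m)) \<longlonglongrightarrow> (1, 0)" using a b by (rule tendsto_Pair)
  ultimately have "(\<lambda>m. H (a m, b m)) \<longlonglongrightarrow> H (1, 0)" by (rule isCont_tendsto_compose)
  moreover have "lincomb n 1 x 0 z = x"
    using x by (intro PiE_UNIV_eqI[OF lincomb_in]) (auto simp: lincomb_apply)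
  ultimately show ?thesis by (simp add: H_def)
qed

text \<open>The function \<open>f x * g y\<close> need not be dominated as the correlation tends to 1, so Fatou's lemma is
  applied to \<open>(f x - g y)\<^sup>2\<close>, whose diagonal terms do not depend on the correlation.\<close>

lemma correlation_le_expectation_mult:
  assumes f: "square_integrable n f" "centrally_symmetric n f" "convex_fun n f"
    and g: "square_integrable n g" "convex_fun n g"
    and \<rho>: "0 \<le> \<rho>" "\<rho> < 1"
  shows "correlation f g \<rho> \<le> gauss_expectation n (\<lambda>x. f x * g x)"
proof -
  let ?G = "std_gaussian n"
  let ?GG = "?G \<Otimes>\<^sub>M ?G"
  have [measurable]: "f \<in> borel_measurable ?G" "g \<in> borel_measurable ?G"
    and f2: "integrable ?G (\<lambda>x. (f x)\<^sup>2)" and g2: "integrable ?G (\<lambda>x. (g x)\<^sup>2)"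
    using f g by (auto simp: square_integrable_def)
  \<comment> \<open>A sequence that starts at \<open>\<rho>\<close>, stays above it and tends to 1
    from below, so that monotonicity compares every term with \<open>\<rho>\<close>.\<close>
  define c where "c m = 1 - (1 - \<rho>) / real (Suc m)" for m
  define s where "s m = sqrt (1 - (c m)\<^sup>2)" for m
  have c: "\<rho> \<le> c m" "c m < 1" for m
    using \<rho> mult_left_mono[of 1 "real (Suc m)" "1 - \<rho>"] by (auto simp: c_def field_simps)
  then have c1: "\<bar>c m\<bar> < 1" for m using \<rho> by (smt (verit))
  have "(\<lambda>m. (1 - \<rho>) / real (Suc m)) \<longlonglongrightarrow> 0"
    using tendsto_mult[OF tendsto_const[of "1 - \<rho>"] LIMSEQ_inverse_real_of_nat] by (simp add: divide_inverse)
  then have cl: "c \<longlonglongrightarrow> 1"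
    unfolding c_def using tendsto_diff[OF tendsto_const[of 1]] by fastforce
  have sl: "s \<longlonglongrightarrow> 0"
    using tendsto_real_sqrt[OF tendsto_diff[OF tendsto_const tendsto_power[OF cl, of 2], of 1]]
    by (simp add: s_def[abs_def])
  define D where "D m p = (f (fst p) - g (lincomb n (c m) (fst p) (s m) (snd p)))\<^sup>2" for m p
  define V where "V = sq_mass n f + sq_mass n g"
  have D: "integrable ?GG (D m)" "(\<integral>p. D m p \<partial>?GG) = V - 2 * correlation f g (c m)" for m
  proof -
    note gl = integrable_lincomb[OF g2 unit_sqrt[OF c1[of m]], folded s_def]
    note fl = integrable_fst_gaussian[OF f2]
    have fg: "integrable ?GG (\<lambda>p. f (fst p) * g (lincomb n (c m) (fst p) (s m) (snd p)))"
      using fl gl by (intro integrable_mult_squares(1)) measurable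
    have eq: "D m p = (f (fst p))\<^sup>2 + (g (lincomb n (c m) (fst p) (s m) (snd p)))\<^sup>2
        - 2 * (f (fst p) * g (lincomb n (c m) (fst p) (s m) (snd p)))" for p
      by (simp add: D_def power2_diff)
    show "integrable ?GG (D m)" unfolding eq[abs_def] using fl gl fg by simp
    show "(\<integral>p. D m p \<partial>?GG) = V - 2 * correlation f g (c m)"
      unfolding eq using fl gl fg by (simp add: V_def sq_mass_def correlation_eq s_def)
  qed
  have fg: "integrable ?G (\<lambda>x. f x * g x)"
    by (rule integrable_mult_squares(1)) (use f2 g2 in auto)
  have E: "integrable ?G (\<lambda>x. (f x - g x)\<^sup>2)"
    "(\<integral>x. (f x - g x)\<^sup>2 \<partial>?G) = V - 2 * gauss_expectation n (\<lambda>x. f x * g x)"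
    using f2 g2 fg by (simp_all add: power2_diff V_def sq_mass_def gauss_expectation_def mult.assoc)
  have "ennreal (V - 2 * gauss_expectation n (\<lambda>x. f x * g x)) = (\<integral>\<^sup>+p. ennreal ((f (fst p) - g (fst p))\<^sup>2) \<partial>?GG)"
    using E integrable_fst_gaussian[OF E(1)] by (subst nn_integral_eq_integral) auto
  also have "\<dots> = (\<integral>\<^sup>+p. liminf (\<lambda>m. ennreal (D m p)) \<partial>?GG)"
  proof (rule nn_integral_cong)
    fix p assume "p \<in> space ?GG"
    then have "fst p \<in> {..<n} \<rightarrow>\<^sub>E UNIV" by (simp add: space_pair_measure mem_Times_iff space_std_gaussian)
    then have "(\<lambda>m. D m p) \<longlonglongrightarrow> (f (fst p) - g (fst p))\<^sup>2"
      unfolding D_def by (intro tendsto_power tendsto_diff tendsto_const tendsto_convex_lincomb g cl sl)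
    then have "(\<lambda>m. ennreal (D m p)) \<longlonglongrightarrow> ennreal ((f (fst p) - g (fst p))\<^sup>2)" by (rule tendsto_ennrealI)
    then show "ennreal ((f (fst p) - g (fst p))\<^sup>2) = liminf (\<lambda>m. ennreal (D m p))"
      by (simp add: lim_imp_Liminf)
  qed
  also have "\<dots> \<le> liminf (\<lambda>m. \<integral>\<^sup>+p. ennreal (D m p) \<partial>?GG)"
    unfolding D_def by (rule nn_integral_liminf) measurable
  also have "\<dots> \<le> liminf (\<lambda>m. ennreal (V - 2 * correlation f g \<rho>))"
  proof (intro Liminf_mono always_eventually allI)
    fix m
    have "(\<integral>\<^sup>+p. ennreal (D m p) \<partial>?GG) = ennreal (V - 2 * correlation f g (c m))"
    proof -
      have "AE p in ?GG. 0 \<le> D m p" by (simp add: D_def)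
      from nn_integral_eq_integral[OF D(1) this] show ?thesis by (simp only: D(2))
    qed
    also have "\<dots> \<le> ennreal (V - 2 * correlation f g \<rho>)"
      using correlation_mono[OF f g \<rho>(1) c] by (intro ennreal_leI) simp
    finally show "(\<integral>\<^sup>+p. ennreal (D m p) \<partial>?GG) \<le> ennreal (V - 2 * correlation f g \<rho>)" .
  qed
  also have "\<dots> = ennreal (V - 2 * correlation f g \<rho>)" by (simp add: Liminf_const)
  finally have le: "ennreal (V - 2 * gauss_expectation n (\<lambda>x. f x * g x)) \<le> ennreal (V - 2 * correlation f g \<rho>)" .
  \<comment> \<open>\<open>ennreal\<close> sends negative numbers to 0, so the inequality can be
    read back in the reals only if its right-hand side is nonnegative. It is the integral of the
    square \<open>D 0\<close>, because \<open>c 0 = \<rho>\<close>.\<close>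
  have "V - 2 * correlation f g \<rho> \<ge> 0"
  proof -
    have "0 \<le> (\<integral>p. D 0 p \<partial>?GG)" by (rule integral_nonneg_AE) (simp add: D_def)
    then show ?thesis using D(2)[of 0] by (simp add: c_def)
  qed
  then show ?thesis using le by (simp add: ennreal_le_iff)
qed

end

theorem theorem31:
  shows "\<exists>C::real. C > 0 \<and>
    (\<forall>(n::nat) (f :: (nat \<Rightarrow> real) \<Rightarrow> real) (g :: (nat \<Rightarrow> real) \<Rightarrow> real).
      n \<ge> 1 \<longrightarrow>
      centrally_symmetric n f \<longrightarrow> convex_fun n f \<longrightarrow> square_integrable n f \<longrightarrow> gauss_norm n f \<le> 1 \<longrightarrow>
      centrally_symmetric n g \<longrightarrow> convex_fun n g \<longrightarrow> square_integrable n g \<longrightarrow> gauss_norm n g \<le> 1 \<longrightarrow>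
      (\<Sum>\<alpha>\<in>multi_indices n 2. hermite_coeff n f \<alpha> * hermite_coeff n g \<alpha>) \<in> {0..1} \<and>
      gauss_expectation n (\<lambda>x. f x * g x) - gauss_expectation n f * gauss_expectation n g
        \<ge> 1 / C * Phi (\<Sum>\<alpha>\<in>multi_indices n 2. hermite_coeff n f \<alpha> * hermite_coeff n g \<alpha>))"
proof (rule exI[of _ 8192], intro conjI allI impI)
  fix n :: nat and f g :: "(nat \<Rightarrow> real) \<Rightarrow> real"
  assume sf: "centrally_symmetric n f" and cf: "convex_fun n f" and f: "square_integrable n f" and nf: "gauss_norm n f \<le> 1"
    and cg: "convex_fun n g" and g: "square_integrable n g" and ng: "gauss_norm n g \<le> 1"
  have mass: "sq_mass n f \<le> 1" "sq_mass n g \<le> 1"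
    using nf ng by (simp_all add: gauss_norm_def gauss_expectation_def sq_mass_def)
  have bound: "\<bar>degree_part n k f g\<bar> \<le> 1" for k
    using degree_part_bound[OF f g, of k] mass by simp
  have nonneg: "0 \<le> degree_part n 2 f g" by (rule degree_part_2_nonneg[OF f cf g cg])
  show "(\<Sum>\<alpha>\<in>multi_indices n 2. hermite_coeff n f \<alpha> * hermite_coeff n g \<alpha>) \<in> {0..1}"
    using nonneg bound[of 2] by (simp add: degree_part_def)
  define F where "F = correlation n f g"
  define p where "p t = F (sqrt t) - F 0" for t
  have series: "(\<lambda>j. degree_part n (2 * Suc j) f g * t ^ Suc j) sums p t" if t: "0 \<le> t" "t \<le> 1 / 128" for t
  proof -
    \<comment> \<open>The interval ends at 1/128 so that \<open>sqrt t\<close> stays strictly below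
      the radius 1/8 of the Mehler series, with a factor 2 to spare in t.\<close>
    have "sqrt t < sqrt (1 / 64)" using t by (intro real_sqrt_less_mono) auto
    then have s: "\<bar>sqrt t\<bar> < 1 / 8" using t by (simp add: real_sqrt_divide)
    have "(\<lambda>k. degree_part n k f g * sqrt t ^ k) sums F (sqrt t)"
      unfolding F_def by (rule correlation_expansion[OF f g s])
    moreover have "degree_part n k f g * sqrt t ^ k = 0" if "k \<notin> range (\<lambda>j. 2 * j)" for k
    proof -
      have "odd k" using that by (auto elim!: evenE)
      then show ?thesis by (simp add: degree_part_odd[OF f sf])
    qed
    ultimately have "(\<lambda>j. degree_part n (2 * j) f g * sqrt t ^ (2 * j)) sums F (sqrt t)"
      using sums_mono_reindex[of "\<lambda>j. 2 * j" "\<lambda>k. degree_part n k f g * sqrt t ^ k"]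
      by (simp add: strict_mono_def)
    then have "(\<lambda>j. degree_part n (2 * j) f g * t ^ j) sums F (sqrt t)"
      using t by (simp add: power_mult)
    then have "(\<lambda>j. degree_part n (2 * Suc j) f g * t ^ Suc j) sums (F (sqrt t) - degree_part n 0 f g)"
      by (subst sums_Suc_iff) simp
    moreover have "F 0 = degree_part n 0 f g"
      using correlation_expansion[OF f g, of 0] powser_sums_zero[of "\<lambda>k. degree_part n k f g"]
      by (simp add: sums_iff F_def)
    ultimately show ?thesis by (simp add: p_def)
  qed
  have p: "\<bar>p t\<bar> \<le> gauss_expectation n (\<lambda>x. f x * g x) - gauss_expectation n f * gauss_expectation n g"
    if t: "0 \<le> t" "t \<le> 1 / 128" for t
  proof -
    have s: "0 \<le> sqrt t" "sqrt t < 1" using t by auto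
    have "F 0 \<le> F (sqrt t)" unfolding F_def using s by (intro correlation_mono f sf cf g cg) auto
    moreover have "F (sqrt t) \<le> gauss_expectation n (\<lambda>x. f x * g x)"
      unfolding F_def by (rule correlation_le_expectation_mult[OF f sf cf g cg s])
    moreover have "F 0 = gauss_expectation n f * gauss_expectation n g"
      unfolding F_def by (rule correlation_0[OF f g])
    ultimately show ?thesis by (simp add: p_def)
  qed
  have "1 / 8192 * Phi (degree_part n (2 * Suc 0) f g)
      \<le> gauss_expectation n (\<lambda>x. f x * g x) - gauss_expectation n f * gauss_expectation n g"
    by (rule extremal_power_series[where b = "\<lambda>j. degree_part n (2 * Suc j) f g", OF bound _ series p])
      (use nonneg in simp_all)
  then show "gauss_expectation n (\<lambda>x. f x * g x) - gauss_expectation n f * gauss_expectation n g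
        \<ge> 1 / 8192 * Phi (\<Sum>\<alpha>\<in>multi_indices n 2. hermite_coeff n f \<alpha> * hermite_coeff n g \<alpha>)"
    by (simp add: degree_part_def)
qed simp

end
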